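(* The group $2V$ is presented, as a group, by the generators $A_i,B_i,C_i,\pi_i,\overline{\pi}_i$ ($i\in\mathbb N$) and the following relations, in which $X,Y$ range over $\{A,B\}$ (each independently) and all subscripts are in $\mathbb N$: (1) $X_qY_m=Y_mX_{q+1}$ for $m<q$; (2) $\pi_qX_m=X_m\pi_{q+1}$ for $m<q$; (3) $\pi_qX_q=X_{q+1}\pi_q\pi_{q+1}$ for $q\ge0$; (4) $\pi_qX_m=X_m\pi_q$ for $m>q+1$; (5) $\overline{\pi}_qX_m=X_m\overline{\pi}_{q+1}$ for $m<q$; (6) $\overline{\pi}_mA_m=\pi_m\overline{\pi}_{m+1}$ for $m\ge0$; (7) $\overline{\pi}_mB_m=C_{m+1}\pi_m\overline{\pi}_{m+1}$ for $m\ge0$; (8) $C_qX_m=X_mC_{q+1}$ for $m<q$; (9) $C_mA_m=B_mC_{m+2}\pi_{m+1}$ for $m\ge0$; (10) $\pi_qC_m=C_m\pi_q$ for $m>q+1$; (11) $A_mB_{m+1}B_m=B_mA_{m+1}A_m\pi_{m+1}$ for $m\ge0$; (12) $\pi_q\pi_m=\pi_m\pi_q$ for $|m-q|\ge2$; (13) $\pi_m\pi_{m+1}\pi_m=\pi_{m+1}\pi_m\pi_{m+1}$ for $m\ge0$; (14) $\overline{\pi}_q\pi_m=\pi_m\overline{\pi}_q$ for $q\ge m+2$; (15) $\pi_m\overline{\pi}_{m+1}\pi_m=\overline{\pi}_{m+1}\pi_m\overline{\pi}_{m+1}$ for $m\ge0$; (16) $\pi_m^2=1$ for $m\ge0$;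 (17) $\overline{\pi}_m^{\,2}=1$ for $m\ge0$.
   Context: $\mathbb N=\{0,1,2,\dots\}$. For $i\in\mathbb N$ let $S_i=[2i,2i+1]\times[0,1]$. Let $C\subset[0,1]$ be the usual middle-thirds Cantor set and let $\mathcal Y=\bigcup_{i\in\mathbb N}(2i+C)\times C$. The trivial pattern is $\{S_i\mid i\in\mathbb N\}$. A simple increment of a pattern replaces one rectangle $R$ of the pattern either by its (closed) left third and right third (vertical division) or by its (closed) bottom third and top third (horizontal division), leaving the other rectangles alone. A pattern is a set of rectangles obtainable from the trivial pattern by finitely many simple increments. A numbered pattern is a bijection from $\mathbb N$ to the rectangles of a pattern for which there are $j,k\in\mathbb N$ such that for every $i>k$ the square $S_i$ contains only one rectangle of the pattern and its number is $i+j$. A pair $(P,Q)$ of numbered patterns defines a homeomorphism of $\mathcal Y$: for each $i$, it takes the intersection of $\mathcal Y$ with the $i$-th rectangle of $Q$ onto the intersection of $\mathcal Y$ with the $i$-th rectangle of $P$ by the unique affine map of the form $(x,y)\mapsto(a+3^jx,b+3^ky)$, $j,k\in\mathbb Z$, that does so. The group $\widehat{2V}$ is the set of all homeomorphisms of $\mathcal Y$ obtained this way, under composition (acting on the left, composed right to left). Let $E$ be the trivial pattern with $S_i$ numbered $i$. A numbered pattern $P$ is identified with the element $(P,E)$ of $\widehat{2V}$; these elements form a submonoid, and for $P,Q$ in this submonoid $(P,Q)=PQ^{-1}$. The group $2V$ is the subgroup of $\widehat{2V}$ consisting of those elements that act as the identity off $\mathcal Y\cap S_0$. Elements of $\widehat{2V}$,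 for $i\in\mathbb N$: $v_i$ is the numbered pattern in which $S_i$ is divided vertically, with left piece numbered $i$ and right piece numbered $i+1$, and every $S_j$ with $j\neq i$ is a single rectangle, numbered $j$ if $j<i$ and $j+1$ if $j>i$. $h_i$ is defined in the same way with $S_i$ divided horizontally, the bottom piece numbered $i$ and the top piece numbered $i+1$. $\sigma_i$ is the trivial pattern with $S_i$ numbered $i+1$, $S_{i+1}$ numbered $i$, and $S_j$ numbered $j$ for $j\notin\{i,i+1\}$. Elements of $2V$, for $i\ge0$ (with $(P,Q)=PQ^{-1}$): $A_i=(v_0^{i+1}v_1,\,v_0^{i+2})$, $B_i=(v_0^{i+1}h_1,\,v_0^{i+2})$, $C_i=(v_0^ih_0,\,v_0^{i+1})$, $\pi_i=(v_0^{i+2}\sigma_1,\,v_0^{i+2})$, $\overline{\pi}_i=(v_0^{i+1}\sigma_0,\,v_0^{i+1})$. *)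

theory Defs
  imports Complex_Main "HOL-Algebra.Bij" "HOL-Algebra.Coset"
begin

section \<open>Group presentations\<close>

(* The letter (x, True) stands for the generator x and (x, False) for its formal inverse. *)
type_synonym 'a gword = "('a \<times> bool) list"

inductive cancels :: "'a gword \<Rightarrow> 'a gword \<Rightarrow> bool" where
  "cancels (u @ [(x, b), (x, \<not> b)] @ w) (u @ w)"

definition word_class :: "'a gword \<Rightarrow> 'a gword set" where
  "word_class u = {w. equivclp cancels u w}"

definition free_group :: "'a gword set monoid" where
  "free_group =
     \<lparr>carrier = range word_class,
      mult = (\<lambda>U W. \<Union>u\<in>U. \<Union>w\<in>W. word_class (u @ w)),
      one = word_class []\<rparr>"

definition free_gen :: "'a \<Rightarrow> 'a gword set" where
  "free_gen x = word_class [(x, True)]"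

definition positive_word :: "'a list \<Rightarrow> 'a gword set" where
  "positive_word xs = word_class (map (\<lambda>x. (x, True)) xs)"

definition normal_closure :: "('g, 'b) monoid_scheme \<Rightarrow> 'g set \<Rightarrow> 'g set" where
  "normal_closure G R = \<Inter>{N. N \<lhd> G \<and> R \<subseteq> N}"

definition is_presented_by ::
  "('g, 'b) monoid_scheme \<Rightarrow> ('a \<Rightarrow> 'g) \<Rightarrow> 'a gword set set \<Rightarrow> bool" where
  "is_presented_by G gens R \<longleftrightarrow>
     group G \<and> (\<forall>x. gens x \<in> carrier G) \<and> R \<subseteq> carrier free_group \<and>
     (\<exists>\<phi> \<in> iso (free_group Mod normal_closure free_group R) G.
        \<forall>x. \<phi> (normal_closure free_group R #>\<^bsub>free_group\<^esub> free_gen x) = gens x)"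

(* All relations used below are equations between positive words; u = w has relator u w^{-1}. *)
definition relators :: "('a list \<times> 'a list) set \<Rightarrow> 'a gword set set" where
  "relators E =
     {positive_word u \<otimes>\<^bsub>free_group\<^esub> inv\<^bsub>free_group\<^esub> positive_word w | u w. (u, w) \<in> E}"

lemma word_class_eq_iff: "word_class u = word_class w \<longleftrightarrow> equivclp cancels u w"
  unfolding word_class_def
  by (auto intro: equivclp_trans equivclp_sym)

lemma equivclp_cancels_append:
  assumes "equivclp cancels u u'" "equivclp cancels w w'"
  shows "equivclp cancels (u @ w) (u' @ w')"
proof -
  have right: "cancels (a @ c) (b @ c)" if "cancels a b" for a b c :: "'a gword"
    using that by cases (metis append.assoc cancels.intros)
  have left: "cancels (c @ a) (c @ b)" if "cancels a b" for a b c :: "'a gword"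
    using that by cases (metis append.assoc cancels.intros)
  have "equivclp cancels (u @ w) (u' @ w)"
    using assms(1)
    by (induction rule: equivclp_induct)
      (auto intro: right equivclp_into_equivclp)
  moreover have "equivclp cancels (u' @ w) (u' @ w')"
    using assms(2)
    by (induction rule: equivclp_induct)
      (auto intro: left equivclp_into_equivclp)
  ultimately show ?thesis by (rule equivclp_trans)
qed

lemma free_group_mult:
  "word_class u \<otimes>\<^bsub>free_group\<^esub> word_class w = word_class (u @ w)"
proof -
  have *: "word_class (u' @ w') = word_class (u @ w)"
    if "u' \<in> word_class u" "w' \<in> word_class w" for u' w'
    unfolding word_class_eq_iff
    using that by (intro equivclp_sym[OF equivclp_cancels_append]) (simp_all add: word_class_def)
  have "u \<in> word_class u" "w \<in> word_class w"
    by (simp_all add: word_class_def)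
  then have "(\<Union>u'\<in>word_class u. \<Union>w'\<in>word_class w. word_class (u' @ w')) = word_class (u @ w)"
    using * by (intro equalityI UN_least) blast+
  then show ?thesis
    by (simp add: free_group_def)
qed

lemma word_class_inverse:
  "word_class (rev (map (\<lambda>(x, b). (x, \<not> b)) u) @ u) = word_class []"
proof (induction u)
  case (Cons a u)
  obtain x b where a: "a = (x, b)" by (cases a)
  let ?r = "rev (map (\<lambda>(x, b). (x, \<not> b)) u)"
  have "cancels (?r @ [(x, \<not> b), (x, \<not> \<not> b)] @ u) (?r @ u)"
    by (rule cancels.intros)
  then have "word_class (?r @ [(x, \<not> b), (x, b)] @ u) = word_class (?r @ u)"
    by (simp add: word_class_eq_iff r_into_equivclp)
  then show ?case
    using Cons by (simp add: a)
qed simp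

lemma group_free_group: "group (free_group :: 'a gword set monoid)"
proof (rule groupI)
  have car: "carrier free_group = range (word_class :: 'a gword \<Rightarrow> _)"
    and one: "\<one>\<^bsub>free_group\<^esub> = word_class ([] :: 'a gword)"
    by (simp_all add: free_group_def)
  fix U V W :: "'a gword set"
  show "\<one>\<^bsub>free_group\<^esub> \<in> carrier (free_group :: 'a gword set monoid)"
    by (simp add: car one)
  assume "U \<in> carrier free_group"
  then obtain u where u: "U = word_class u" by (auto simp: car)
  show "\<one>\<^bsub>free_group\<^esub> \<otimes>\<^bsub>free_group\<^esub> U = U"
    by (simp add: u one free_group_mult)
  show "\<exists>W\<in>carrier free_group. W \<otimes>\<^bsub>free_group\<^esub> U = \<one>\<^bsub>free_group\<^esub>"
    using word_class_inverse[of u] by (auto simp: u car one free_group_mult)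
  assume "V \<in> carrier free_group"
  then obtain v where v: "V = word_class v" by (auto simp: car)
  show "U \<otimes>\<^bsub>free_group\<^esub> V \<in> carrier free_group"
    by (simp add: u v car free_group_mult)
  assume "W \<in> carrier free_group"
  then obtain w where w: "W = word_class w" by (auto simp: car)
  show "U \<otimes>\<^bsub>free_group\<^esub> V \<otimes>\<^bsub>free_group\<^esub> W =
      U \<otimes>\<^bsub>free_group\<^esub> (V \<otimes>\<^bsub>free_group\<^esub> W)"
    by (simp add: u v w free_group_mult)
qed

section \<open>Patterns\<close>

definition unit_square :: "nat \<Rightarrow> (real \<times> real) set" where
  "unit_square i = {2 * real i .. 2 * real i + 1} \<times> {0..1}"

primrec cantor_stage :: "nat \<Rightarrow> real set" where
  "cantor_stage 0 = {0..1}"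
| "cantor_stage (Suc n) =
     (\<lambda>x. x / 3) ` cantor_stage n \<union> (\<lambda>x. (x + 2) / 3) ` cantor_stage n"

definition cantor_set :: "real set" where
  "cantor_set = (\<Inter>n. cantor_stage n)"

definition cantor_squares :: "(real \<times> real) set" where
  "cantor_squares = (\<Union>i::nat. (\<lambda>x. 2 * real i + x) ` cantor_set \<times> cantor_set)"

definition trivial_pattern :: "(real \<times> real) set set" where
  "trivial_pattern = range unit_square"

inductive simple_increment ::
  "(real \<times> real) set set \<Rightarrow> (real \<times> real) set set \<Rightarrow> bool" where
  vertical:
    "\<lbrakk>a < b; c < d; {a..b} \<times> {c..d} \<in> P\<rbrakk> \<Longrightarrow>
     simple_increment P
       ((P - {{a..b} \<times> {c..d}}) \<union>
        {{a .. a + (b - a) / 3} \<times> {c..d}, {b - (b - a) / 3 .. b} \<times> {c..d}})"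
| horizontal:
    "\<lbrakk>a < b; c < d; {a..b} \<times> {c..d} \<in> P\<rbrakk> \<Longrightarrow>
     simple_increment P
       ((P - {{a..b} \<times> {c..d}}) \<union>
        {{a..b} \<times> {c .. c + (d - c) / 3}, {a..b} \<times> {d - (d - c) / 3 .. d}})"

definition is_pattern :: "(real \<times> real) set set \<Rightarrow> bool" where
  "is_pattern P \<longleftrightarrow> simple_increment\<^sup>*\<^sup>* trivial_pattern P"

definition numbered_pattern :: "(nat \<Rightarrow> (real \<times> real) set) \<Rightarrow> bool" where
  "numbered_pattern P \<longleftrightarrow>
     inj P \<and> is_pattern (range P) \<and>
     (\<exists>j k. \<forall>i>k. \<forall>n. P n \<subseteq> unit_square i \<longleftrightarrow> n = i + j)"

section \<open>The groups\<close>

(* The restriction to extensional functions makes the map unique as a HOL function. *)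
definition pattern_map ::
  "(nat \<Rightarrow> (real \<times> real) set) \<Rightarrow> (nat \<Rightarrow> (real \<times> real) set) \<Rightarrow> real \<times> real \<Rightarrow> real \<times> real" where
  "pattern_map P Q =
     (THE f. f \<in> extensional cantor_squares \<and>
        (\<forall>i. f ` (cantor_squares \<inter> Q i) = cantor_squares \<inter> P i \<and>
             (\<exists>(a::real) (b::real) (j::int) (k::int).
                \<forall>(x, y) \<in> cantor_squares \<inter> Q i.
                  f (x, y) = (a + 3 powi j * x, b + 3 powi k * y))))"

definition hat_2V :: "(real \<times> real \<Rightarrow> real \<times> real) monoid" where
  "hat_2V = (BijGroup cantor_squares)
     \<lparr>carrier := {pattern_map P Q | P Q. numbered_pattern P \<and> numbered_pattern Q}\<rparr>"

definition group_2V :: "(real \<times> real \<Rightarrow> real \<times> real) monoid" where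
  "group_2V = hat_2V
     \<lparr>carrier := {f \<in> carrier hat_2V. \<forall>p \<in> cantor_squares - unit_square 0. f p = p}\<rparr>"

(* The trivial pattern with its standard numbering is unit_square itself. *)
definition pattern_elt ::
  "(nat \<Rightarrow> (real \<times> real) set) \<Rightarrow> real \<times> real \<Rightarrow> real \<times> real" where
  "pattern_elt P = pattern_map P unit_square"

definition v_pattern :: "nat \<Rightarrow> nat \<Rightarrow> (real \<times> real) set" where
  "v_pattern i n =
     (if n < i then unit_square n
      else if n = i then {2 * real i .. 2 * real i + 1 / 3} \<times> {0..1}
      else if n = i + 1 then {2 * real i + 2 / 3 .. 2 * real i + 1} \<times> {0..1}
      else unit_square (n - 1))"

definition h_pattern :: "nat \<Rightarrow> nat \<Rightarrow> (real \<times> real) set" where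
  "h_pattern i n =
     (if n < i then unit_square n
      else if n = i then {2 * real i .. 2 * real i + 1} \<times> {0 .. 1 / 3}
      else if n = i + 1 then {2 * real i .. 2 * real i + 1} \<times> {2 / 3 .. 1}
      else unit_square (n - 1))"

definition sigma_pattern :: "nat \<Rightarrow> nat \<Rightarrow> (real \<times> real) set" where
  "sigma_pattern i n =
     (if n = i then unit_square (i + 1)
      else if n = i + 1 then unit_square i
      else unit_square n)"

abbreviation v_elt where "v_elt i \<equiv> pattern_elt (v_pattern i)"
abbreviation h_elt where "h_elt i \<equiv> pattern_elt (h_pattern i)"
abbreviation sigma_elt where "sigma_elt i \<equiv> pattern_elt (sigma_pattern i)"

section \<open>Generators and relations\<close>

datatype gen_2V = gA nat | gB nat | gC nat | gPi nat | gPibar nat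

definition v0_quotient ::
  "(real \<times> real \<Rightarrow> real \<times> real) \<Rightarrow> nat \<Rightarrow> nat \<Rightarrow> real \<times> real \<Rightarrow> real \<times> real" where
  "v0_quotient f m n =
     (v_elt 0 [^]\<^bsub>hat_2V\<^esub> m \<otimes>\<^bsub>hat_2V\<^esub> f) \<otimes>\<^bsub>hat_2V\<^esub> inv\<^bsub>hat_2V\<^esub> (v_elt 0 [^]\<^bsub>hat_2V\<^esub> n)"

primrec elt_2V :: "gen_2V \<Rightarrow> real \<times> real \<Rightarrow> real \<times> real" where
  "elt_2V (gA i) = v0_quotient (v_elt 1) (i + 1) (i + 2)"
| "elt_2V (gB i) = v0_quotient (h_elt 1) (i + 1) (i + 2)"
| "elt_2V (gC i) = v0_quotient (h_elt 0) i (i + 1)"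
| "elt_2V (gPi i) = v0_quotient (sigma_elt 1) (i + 2) (i + 2)"
| "elt_2V (gPibar i) = v0_quotient (sigma_elt 0) (i + 1) (i + 1)"

inductive_set relations_2V :: "(gen_2V list \<times> gen_2V list) set" where
  r1: "\<lbrakk>X \<in> {gA, gB}; Y \<in> {gA, gB}; m < q\<rbrakk> \<Longrightarrow>
       ([X q, Y m], [Y m, X (q + 1)]) \<in> relations_2V"
| r2: "\<lbrakk>X \<in> {gA, gB}; m < q\<rbrakk> \<Longrightarrow> ([gPi q, X m], [X m, gPi (q + 1)]) \<in> relations_2V"
| r3: "X \<in> {gA, gB} \<Longrightarrow> ([gPi q, X q], [X (q + 1), gPi q, gPi (q + 1)]) \<in> relations_2V"
| r4: "\<lbrakk>X \<in> {gA, gB}; m > q + 1\<rbrakk> \<Longrightarrow> ([gPi q, X m], [X m, gPi q]) \<in> relations_2V"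
| r5: "\<lbrakk>X \<in> {gA, gB}; m < q\<rbrakk> \<Longrightarrow> ([gPibar q, X m], [X m, gPibar (q + 1)]) \<in> relations_2V"
| r6: "([gPibar m, gA m], [gPi m, gPibar (m + 1)]) \<in> relations_2V"
| r7: "([gPibar m, gB m], [gC (m + 1), gPi m, gPibar (m + 1)]) \<in> relations_2V"
| r8: "\<lbrakk>X \<in> {gA, gB}; m < q\<rbrakk> \<Longrightarrow> ([gC q, X m], [X m, gC (q + 1)]) \<in> relations_2V"
| r9: "([gC m, gA m], [gB m, gC (m + 2), gPi (m + 1)]) \<in> relations_2V"
| r10: "m > q + 1 \<Longrightarrow> ([gPi q, gC m], [gC m, gPi q]) \<in> relations_2V"
| r11: "([gA m, gB (m + 1), gB m], [gB m, gA (m + 1), gA m, gPi (m + 1)]) \<in> relations_2V"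
| r12: "\<bar>int m - int q\<bar> \<ge> 2 \<Longrightarrow> ([gPi q, gPi m], [gPi m, gPi q]) \<in> relations_2V"
| r13: "([gPi m, gPi (m + 1), gPi m], [gPi (m + 1), gPi m, gPi (m + 1)]) \<in> relations_2V"
| r14: "q \<ge> m + 2 \<Longrightarrow> ([gPibar q, gPi m], [gPi m, gPibar q]) \<in> relations_2V"
| r15: "([gPi m, gPibar (m + 1), gPi m], [gPibar (m + 1), gPi m, gPibar (m + 1)])
          \<in> relations_2V"
| r16: "([gPi m, gPi m], []) \<in> relations_2V"
| r17: "([gPibar m, gPibar m], []) \<in> relations_2V"

end

theory Submission
  imports Defs "HOL-Library.Sublist" "HOL-Library.Countable" "HOL-Library.Multiset"
begin

text \<open>
  The rectangles of a pattern inside one square are addressed by pairs of binary words, one word for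
  each direction, where \<^term>\<open>False\<close> is the left or bottom third and
  \<^term>\<open>True\<close> the right or top third. An element of 2V carries one partition of
  \<^term>\<open>unit_square 0\<close> into cells, numbered from 0 to \<open>k\<close>, onto another
  one. Write such a numbered partition as a list in which number \<open>i\<close> stands at position
  \<open>k - i\<close>; the positions count from the last number because the subscripts of the
  generators do.

  Every list \<open>L\<close> with \<open>k + 1\<close> entries should correspond to the element of
  2V that carries the standard list \<open>comb k\<close>, the pattern of \<open>v_0^k\<close>, onto
  \<open>L\<close>. If an entry of \<open>L\<close> is cut in two, or if two adjacent entries are
  exchanged, this element is multiplied on the right by a generator (or by 1): a cut at position
  \<open>m\<close> gives \<open>A_m\<close> or \<open>B_m\<close>, except that at the last position
  a vertical cut gives 1 and a horizontal cut gives \<open>C_m\<close>; an exchange of the positions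
  \<open>m\<close> and \<open>m + 1\<close> gives \<open>\<pi>_m\<close>, or the barred generator if
  \<open>m + 1\<close> is the last position. In terms of these level generators the seventeen
  families of relations say what holds for cuts and exchanges of lists: cuts of different entries
  commute, an exchange can be moved past a cut, cutting vertically and then both halves horizontally
  agrees with the opposite order up to one exchange, and exchanges satisfy the Coxeter relations of
  the symmetric group (the locale \<open>level_group\<close>).

  The main point is coherence: in every group that satisfies the relations, the product of the
  generators along a sequence of cuts and exchanges that leads from the one-element list to
  \<open>L\<close> depends on \<open>L\<close> only (\<open>path_unique\<close>,
  \<open>value_list_cut\<close>, \<open>value_list_exchange\<close>). Reorderings of a list are
  controlled by a normal form for the symmetric group (\<open>ordering_exchange\<close>), so that
  one may pass from lists to sets of cells. There a diamond argument applies, by induction on the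
  number of cuts that are left: a partition that refines the results of two first cuts also refines
  a common further partition, for which the relations give the equality. It rests on the fact that a
  partition into cells that refines another one is always reached from it by cuts
  (\<open>refines_imp_cut_steps\<close>).

  Now let \<open>G\<close> be the presented group. If \<open>f\<close> in 2V carries the list
  \<open>V\<close> onto the list \<open>U\<close>, assign to \<open>f\<close> the quotient of the
  values of \<open>U\<close> and \<open>V\<close> in \<open>G\<close>. Common refinements show that
  this assignment is multiplicative, and it takes the generators of 2V to those of \<open>G\<close>.
  Hence the class of a word in \<open>G\<close> is a value assigned to the element of 2V that the
  word defines, and a word that defines the identity is trivial in \<open>G\<close>
  (\<open>kernel_evaluate\<close>). Generation holds because an element of 2V carries some list onto
  another one, and both are reached from standard lists by generators
  (\<open>evaluate_surjective\<close>).

  The geometric part identifies the given groups. A bijection of the Cantor squares belongs to the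
  group of all pattern maps if and only if it carries all sufficiently small cells to cells by the
  affine maps between them and eventually only shifts the squares (\<open>carrier_hat_2V\<close>).
  This description, unlike the original one, is evidently closed under composition and inversion.
\<close>

section \<open>Cells and partitions\<close>

type_synonym cell = "bool list \<times> bool list"

abbreviation whole :: cell where
  "whole \<equiv> ([], [])"

fun child :: "bool \<Rightarrow> bool \<Rightarrow> cell \<Rightarrow> cell" where
  "child False b (xs, ys) = (xs @ [b], ys)"
| "child True b (xs, ys) = (xs, ys @ [b])"

fun inside :: "cell \<Rightarrow> cell \<Rightarrow> bool" where
  "inside (xs, ys) (us, vs) \<longleftrightarrow> prefix us xs \<and> prefix vs ys"

text \<open>
  Two cells meet if the subsets of a square that they describe intersect. Partitions below are
  maximal sets of pairwise disjoint cells; for finite sets this is the same as being disjoint and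
  covering the square.
\<close>

fun meets :: "cell \<Rightarrow> cell \<Rightarrow> bool" where
  "meets (xs, ys) (us, vs) \<longleftrightarrow>
     (prefix xs us \<or> prefix us xs) \<and> (prefix ys vs \<or> prefix vs ys)"

definition partition_cells :: "cell set \<Rightarrow> bool" where
  "partition_cells D \<longleftrightarrow> finite D \<and> (\<forall>r\<in>D. \<forall>s\<in>D. meets r s \<longrightarrow> r = s) \<and> (\<forall>s. \<exists>r\<in>D. meets r s)"

definition cut_set :: "bool \<Rightarrow> cell \<Rightarrow> cell set \<Rightarrow> cell set" where
  "cut_set c r D = (D - {r}) \<union> {child c True r, child c False r}"

definition refines :: "cell set \<Rightarrow> cell set \<Rightarrow> bool" where
  "refines D' D \<longleftrightarrow> (\<forall>s\<in>D'. \<exists>r\<in>D. inside s r)"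

lemma inside_refl [simp]: "inside r r"
  by (cases r) simp

lemma inside_trans: "inside r s \<Longrightarrow> inside s t \<Longrightarrow> inside r t"
  by (cases r; cases s; cases t) (auto intro: prefix_order.trans)

lemma meets_refl [simp]: "meets r r"
  by (cases r) simp

lemma meets_sym: "meets r s \<Longrightarrow> meets s r"
  by (cases r; cases s) auto

lemma inside_meets: "inside r s \<Longrightarrow> meets r s"
  by (cases r; cases s) auto

lemma inside_both_meets:
  assumes "inside s r" "inside s r'" shows "meets r r'"
  using assms by (cases r; cases r'; cases s) (auto intro: prefix_same_cases dest: prefix_same_cases)

lemma meets_inside_mono: "meets r s \<Longrightarrow> inside r r' \<Longrightarrow> meets r' s"
  by (cases r; cases r'; cases s) (auto intro: prefix_order.trans dest: prefix_same_cases)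

lemma inside_child [simp]: "inside (child c b r) r"
  by (cases r; cases c) auto

lemma child_eq_iff [simp]: "child c b r = child c b' r' \<longleftrightarrow> b = b' \<and> r = r'"
  by (cases r; cases r'; cases c) auto

lemma child_neq [simp]: "child c b r \<noteq> r" "r \<noteq> child c b r"
  by (cases r; cases c; auto)+

lemma meets_children: "meets (child c b r) (child c b' r) \<Longrightarrow> b = b'"
  by (cases r; cases c) auto

lemma meets_child_cases:
  assumes "meets s r" obtains b where "meets s (child c b r)"
proof -
  obtain xs ys us vs where s: "s = (xs, ys)" and r: "r = (us, vs)"
    by (cases s; cases r) auto
  have *: "\<exists>b. prefix (zs @ [b]) ws \<or> prefix ws (zs @ [b])" if "prefix zs ws \<or> prefix ws zs"
    for zs ws :: "bool list"
  proof (cases "prefix ws zs")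
    case True
    then show ?thesis by (auto intro: prefix_order.trans)
  next
    case False
    with that obtain t where t: "ws = zs @ t" by (auto elim: prefixE)
    with False obtain b t' where "t = b # t'" by (cases t) auto
    with t show ?thesis by (intro exI[of _ b]) auto
  qed
  show thesis
    using assms *[of us xs] *[of vs ys] that
    by (cases c) (fastforce simp: s r)+
qed

lemma prefix_length_eq: "prefix xs ys \<Longrightarrow> length xs = length ys \<Longrightarrow> xs = ys"
  by (auto elim: prefixE)

lemma partition_cells_meets: "partition_cells D \<Longrightarrow> r \<in> D \<Longrightarrow> s \<in> D \<Longrightarrow> meets r s \<Longrightarrow> r = s"
  by (auto simp: partition_cells_def)

lemma partition_cells_cover:
  assumes "partition_cells D" obtains r where "r \<in> D" "meets r s"
  using assms unfolding partition_cells_def by blast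

lemma partition_cells_finite: "partition_cells D \<Longrightarrow> finite D"
  by (auto simp: partition_cells_def)

lemma partition_cells_whole: "partition_cells {whole}"
  by (auto simp: partition_cells_def)

lemma child_notin:
  assumes "partition_cells D" "r \<in> D" shows "child c b r \<notin> D"
  using assms partition_cells_meets[of D "child c b r" r] inside_meets[OF inside_child] by fastforce

lemma partition_cells_cut:
  assumes D: "partition_cells D" and r: "r \<in> D"
  shows "partition_cells (cut_set c r D)"
  unfolding partition_cells_def
proof (intro conjI ballI allI impI)
  show "finite (cut_set c r D)"
    using D by (simp add: cut_set_def partition_cells_def)
next
  fix s t assume st: "s \<in> cut_set c r D" "t \<in> cut_set c r D" "meets s t"
  have *: "\<not> meets s (child c b r)" if "s \<in> D" "s \<noteq> r" for s b
    using that D r partition_cells_meets[of D s r] meets_inside_mono[of "child c b r" s r]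
    by (auto dest: meets_sym)
  consider "s \<in> D" "s \<noteq> r" "t \<in> D" "t \<noteq> r" | b where "s \<in> D" "s \<noteq> r" "t = child c b r"
    | b where "t \<in> D" "t \<noteq> r" "s = child c b r" | b b' where "s = child c b r" "t = child c b' r"
    using st(1,2) unfolding cut_set_def by blast
  then show "s = t"
  proof cases
    case 1
    then show ?thesis using D st(3) partition_cells_meets by blast
  next
    case 2
    then show ?thesis using * st(3) by blast
  next
    case 3
    then show ?thesis using * st(3) meets_sym by blast
  next
    case 4
    then show ?thesis using meets_children st(3) by blast
  qed
next
  fix s
  obtain t where t: "t \<in> D" "meets t s" using D by (rule partition_cells_cover)
  show "\<exists>r\<in>cut_set c r D. meets r s"
  proof (cases "t = r")
    case True
    with t obtain b where "meets s (child c b r)" by (blast dest: meets_sym intro: meets_child_cases)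
    then show ?thesis by (cases b) (auto simp: cut_set_def dest: meets_sym)
  next
    case False
    with t show ?thesis by (auto simp: cut_set_def)
  qed
qed

lemma card_cut:
  assumes D: "partition_cells D" and r: "r \<in> D"
  shows "card (cut_set c r D) = Suc (card D)"
proof -
  have f: "finite D" using D by (rule partition_cells_finite)
  have "card (cut_set c r D) = card (D - {r}) + card {child c True r, child c False r}"
    unfolding cut_set_def using child_notin[OF D r] f by (intro card_Un_disjoint) auto
  moreover have "card D = Suc (card (D - {r}))" using f r by (metis card_Suc_Diff1)
  ultimately show ?thesis by simp
qed

lemma refines_refl [simp]: "refines D D"
  by (auto simp: refines_def intro: inside_refl)

lemma refines_trans: "refines D'' D' \<Longrightarrow> refines D' D \<Longrightarrow> refines D'' D"
  by (meson refines_def inside_trans)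

lemma refines_cut: "r \<in> D \<Longrightarrow> refines (cut_set c r D) D"
  by (auto simp: refines_def cut_set_def intro: inside_refl inside_child)

lemma refines_inhabited:
  assumes "partition_cells D" "partition_cells D'" "refines D' D" "r \<in> D"
  shows "\<exists>s\<in>D'. inside s r"
proof -
  obtain s where s: "s \<in> D'" "meets s r" using assms(2) by (rule partition_cells_cover)
  then obtain r' where r': "r' \<in> D" "inside s r'" using assms(3) by (auto simp: refines_def)
  then have "meets r' r" using s meets_inside_mono by blast
  then have "r' = r" using assms r' by (blast intro: partition_cells_meets)
  with s r' show ?thesis by blast
qed

lemma refines_card:
  assumes "partition_cells D" "partition_cells D'" "refines D' D"
  shows "card D \<le> card D'"
proof -
  have "\<forall>r\<in>D. \<exists>s\<in>D'. inside s r" using refines_inhabited[OF assms] by blast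
  then obtain h where h: "\<And>r. r \<in> D \<Longrightarrow> h r \<in> D' \<and> inside (h r) r" by metis
  have "inj_on h D"
    by (rule inj_onI) (metis assms(1) h inside_both_meets partition_cells_meets)
  then show ?thesis
    using h assms(2) by (intro card_inj_on_le[of h]) (auto simp: partition_cells_finite)
qed

text \<open>
  Otherwise the cells inside \<open>r\<close> would include one of full width and one of full
  height. These two meet, hence coincide, and then they are equal to \<open>r\<close>.
\<close>

lemma refines_cut_cases:
  assumes "partition_cells D" "partition_cells D'" "refines D' D" "r \<in> D" "r \<notin> D'"
  shows "\<exists>c. refines D' (cut_set c r D)"
proof -
  obtain xs ys where r: "r = (xs, ys)" by (cases r)
  have ext: "\<exists>b. prefix (zs @ [b]) ws" if "prefix zs ws" "zs \<noteq> ws" for zs ws :: "bool list"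
  proof -
    from that(1) obtain t where "ws = zs @ t" by (auto elim: prefixE)
    with that show ?thesis by (cases t) auto
  qed
  have main: "refines D' (cut_set c r D)"
    if "\<And>s. s \<in> D' \<Longrightarrow> inside s r \<Longrightarrow> \<exists>b. inside s (child c b r)" for c
    unfolding refines_def
  proof
    fix s assume s: "s \<in> D'"
    then obtain t where t: "t \<in> D" "inside s t" using assms(3) by (auto simp: refines_def)
    show "\<exists>r\<in>cut_set c r D. inside s r"
    proof (cases "t = r")
      case True
      with that s t obtain b where "inside s (child c b r)" by blast
      then show ?thesis by (cases b) (auto simp: cut_set_def)
    next
      case False
      with t show ?thesis by (auto simp: cut_set_def)
    qed
  qed
  show ?thesis
  proof (cases "\<exists>vs. (xs, vs) \<in> D' \<and> inside (xs, vs) r")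
    case False
    have "refines D' (cut_set False r D)"
    proof (rule main)
      fix s assume s: "s \<in> D'" "inside s r"
      obtain us vs where "s = (us, vs)" by (cases s)
      with s False ext[of xs us] show "\<exists>b. inside s (child False b r)" by (auto simp: r)
    qed
    then show ?thesis ..
  next
    case True
    then obtain vs where vs: "(xs, vs) \<in> D'" "prefix ys vs" by (auto simp: r)
    have "refines D' (cut_set True r D)"
    proof (rule main)
      fix s assume s: "s \<in> D'" "inside s r"
      obtain us ws where s': "s = (us, ws)" by (cases s)
      have "ws \<noteq> ys"
      proof
        assume "ws = ys"
        with s s' vs have "meets s (xs, vs)" by (auto simp: r)
        then have "s = (xs, vs)" using s vs assms(2) by (blast intro: partition_cells_meets)
        with \<open>ws = ys\<close> s s' assms(5) show False by (auto simp: r)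
      qed
      with s s' ext[of ys ws] show "\<exists>b. inside s (child True b r)" by (auto simp: r)
    qed
    then show ?thesis ..
  qed
qed

text \<open>
  A cell of \<open>D'\<close> inside \<open>r'\<close> lies in no other cell of \<open>D\<close>,
  hence in a child of \<open>r'\<close>. This fact and the next one close the diamonds of the
  coherence argument.
\<close>

lemma refines_cut_cut:
  assumes "partition_cells D" "r \<in> D" "r' \<in> D" "r \<noteq> r'"
    and D': "refines D' (cut_set c r D)" "refines D' (cut_set c' r' D)"
  shows "refines D' (cut_set c' r' (cut_set c r D))"
  unfolding refines_def
proof
  fix s assume s: "s \<in> D'"
  from D'(1) s obtain t where t: "t \<in> cut_set c r D" "inside s t" by (auto simp: refines_def)
  from D'(2) s obtain t' where t': "t' \<in> cut_set c' r' D" "inside s t'" by (auto simp: refines_def)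
  show "\<exists>u\<in>cut_set c' r' (cut_set c r D). inside s u"
  proof (cases "t = r'")
    case True
    then have "t' \<in> D \<Longrightarrow> t' = r'"
      using t t' assms by (meson inside_both_meets partition_cells_meets)
    then show ?thesis using t' by (auto simp: cut_set_def)
  next
    case False
    then show ?thesis using t by (auto simp: cut_set_def)
  qed
qed

text \<open>
  A cell that lies in a half in each direction lies in the quarter where the two halves intersect.
\<close>

lemma refines_cut_cross:
  assumes "partition_cells D" "r \<in> D"
    and D': "refines D' (cut_set False r D)" "refines D' (cut_set True r D)"
  shows "refines D'
    (cut_set True (child False True r) (cut_set True (child False False r) (cut_set False r D)))"
  unfolding refines_def
proof
  let ?N = "cut_set True (child False True r) (cut_set True (child False False r) (cut_set False r D))"
  fix s assume s: "s \<in> D'"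
  from D'(1) s obtain t where t: "t \<in> cut_set False r D" "inside s t" by (auto simp: refines_def)
  from D'(2) s obtain t' where t': "t' \<in> cut_set True r D" "inside s t'" by (auto simp: refines_def)
  show "\<exists>u\<in>?N. inside s u"
  proof (cases "t \<in> D - {r}")
    case True
    then have "t \<in> ?N" using child_notin[OF assms(1,2)] by (auto simp: cut_set_def)
    then show ?thesis using t by blast
  next
    case False
    then obtain b where b: "t = child False b r" using t by (auto simp: cut_set_def)
    with t have sr: "inside s r" using inside_child inside_trans by blast
    have "t' \<in> D \<Longrightarrow> t' = r"
      using sr t' assms by (meson inside_both_meets partition_cells_meets)
    then obtain b' where b': "t' = child True b' r" using t' by (auto simp: cut_set_def)
    have "inside s (child True b' (child False b r))"
      using t t' b b' by (cases r; cases s) auto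
    moreover have "child True b' (child False b r) \<in> ?N"
      by (cases b; cases b'; cases r) (auto simp: cut_set_def)
    ultimately show ?thesis by blast
  qed
qed

lemma refines_subset_eq:
  assumes "partition_cells D" "partition_cells D'" "D \<subseteq> D'"
  shows "D = D'"
proof (rule ccontr)
  assume "D \<noteq> D'"
  then obtain s where s: "s \<in> D'" "s \<notin> D" using assms by blast
  obtain r where "r \<in> D" "meets r s" using assms(1) by (rule partition_cells_cover)
  with s assms show False by (metis partition_cells_meets subsetD)
qed

inductive cut_step :: "cell set \<Rightarrow> cell set \<Rightarrow> bool" where
  "r \<in> D \<Longrightarrow> cut_step D (cut_set c r D)"

text \<open>
  No pinwheels: a refinement into cells can always be obtained by successive cuts, since the first
  cut exists by \<open>refines_cut_cases\<close> and the number of cells is bounded by that of the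
  target.
\<close>

lemma refines_imp_cut_steps:
  assumes "partition_cells D" "partition_cells D'" "refines D' D"
  shows "cut_step\<^sup>*\<^sup>* D D'"
  using assms
proof (induction "card D' - card D" arbitrary: D rule: less_induct)
  case less
  show ?case
  proof (cases "D \<subseteq> D'")
    case True
    with less.prems have "D = D'" by (intro refines_subset_eq)
    then show ?thesis by simp
  next
    case False
    then obtain r where r: "r \<in> D" "r \<notin> D'" by blast
    obtain c where c: "refines D' (cut_set c r D)"
      using refines_cut_cases[OF less.prems r] by blast
    have p: "partition_cells (cut_set c r D)" using less.prems r by (intro partition_cells_cut)
    have "card (cut_set c r D) \<le> card D'" using p less.prems c by (intro refines_card)
    then have "cut_step\<^sup>*\<^sup>* (cut_set c r D) D'"
      using card_cut[OF less.prems(1) r(1), of c] p c less.prems by (intro less.hyps) auto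
    then show ?thesis using r by (meson converse_rtranclp_into_rtranclp cut_step.intros)
  qed
qed

text \<open>
  Grids are cofinal among partitions, so they serve as common refinements.
\<close>

definition grid :: "nat \<Rightarrow> cell set" where
  "grid d = {(xs, ys). length xs = d \<and> length ys = d}"

lemma partition_cells_grid: "partition_cells (grid d)"
  unfolding partition_cells_def
proof (intro conjI ballI allI impI)
  have "grid d = {xs. length xs = d} \<times> {ys. length ys = d}" by (auto simp: grid_def)
  moreover have "finite {xs :: bool list. length xs = d}"
    using finite_lists_length_eq[of "UNIV :: bool set" d] by simp
  ultimately show "finite (grid d)" by simp
next
  fix r s assume "r \<in> grid d" "s \<in> grid d" "meets r s"
  then show "r = s" by (cases r; cases s) (auto simp: grid_def dest: prefix_length_eq)
next
  fix s :: cell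
  have *: "\<exists>zs. length zs = d \<and> (prefix zs ws \<or> prefix ws zs)" for ws :: "bool list"
  proof (cases "d \<le> length ws")
    case True
    then show ?thesis by (intro exI[of _ "take d ws"]) (auto simp: take_is_prefix)
  next
    case False
    then show ?thesis by (intro exI[of _ "ws @ replicate (d - length ws) False"]) auto
  qed
  obtain us vs where "s = (us, vs)" by (cases s)
  with *[of us] *[of vs] show "\<exists>r\<in>grid d. meets r s" by (auto simp: grid_def)
qed

lemma grid_refines:
  assumes "partition_cells D" "\<And>xs ys. (xs, ys) \<in> D \<Longrightarrow> length xs \<le> d \<and> length ys \<le> d"
  shows "refines (grid d) D"
  unfolding refines_def
proof
  fix s assume s: "s \<in> grid d"
  obtain r where r: "r \<in> D" "meets r s" using assms(1) by (rule partition_cells_cover)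
  obtain us vs xs ys where "s = (us, vs)" "r = (xs, ys)" by (cases s; cases r) auto
  with r s assms(2)[of xs ys] have "inside s r"
    by (auto simp: grid_def) (metis le_antisym prefix_length_le prefix_length_eq prefix_order.refl)+
  with r show "\<exists>r\<in>D. inside s r" by blast
qed

lemma bounded_lengths:
  assumes "finite D"
  obtains d where "\<And>xs ys. (xs, ys) \<in> D \<Longrightarrow> length xs \<le> d \<and> length ys \<le> d"
proof
  fix xs ys assume "(xs, ys) \<in> D"
  then have "length xs + length ys \<le> Max ((\<lambda>(xs, ys). length xs + length ys) ` D)"
    using assms by (intro Max_ge) force+
  then show "length xs \<le> Max ((\<lambda>(xs, ys). length xs + length ys) ` D) \<and>
      length ys \<le> Max ((\<lambda>(xs, ys). length xs + length ys) ` D)"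
    by linarith
qed

section \<open>Lists of cells\<close>

fun cut :: "bool \<Rightarrow> nat \<Rightarrow> cell list \<Rightarrow> cell list" where
  "cut c m [] = []"
| "cut c 0 (r # L) = child c True r # child c False r # L"
| "cut c (Suc m) (r # L) = r # cut c m L"

fun exchange :: "nat \<Rightarrow> 'a list \<Rightarrow> 'a list" where
  "exchange 0 (r # s # L) = s # r # L"
| "exchange (Suc m) (r # L) = r # exchange m L"
| "exchange m L = L"

lemma length_cut [simp]: "m < length L \<Longrightarrow> length (cut c m L) = Suc (length L)"
  by (induction c m L rule: cut.induct) auto

lemma length_exchange [simp]: "length (exchange m L) = length L"
  by (induction m L rule: exchange.induct) auto

lemma mset_exchange [simp]: "mset (exchange m L) = mset L"
  by (induction m L rule: exchange.induct) auto

lemma set_exchange [simp]: "set (exchange m L) = set L"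
  by (rule mset_eq_setD) simp

lemma distinct_exchange [simp]: "distinct (exchange m L) = distinct L"
  by (rule mset_eq_imp_distinct_iff) simp

lemma nth_exchange:
  "Suc m < length L \<Longrightarrow> exchange m L ! i = L ! (if i = m then Suc m else if i = Suc m then m else i)"
proof (induction m arbitrary: i L)
  case 0
  then show ?case by (cases L; cases "tl L") (auto simp: nth_Cons split: nat.splits)
next
  case (Suc m)
  then show ?case by (cases L; cases i) auto
qed

lemma set_cut:
  "distinct L \<Longrightarrow> m < length L \<Longrightarrow> set (cut c m L) = cut_set c (L ! m) (set L)"
proof (induction c m L rule: cut.induct)
  case (2 c r L)
  then have "insert r (set L) - {r} = set L" by auto
  then show ?case by (simp add: cut_set_def insert_commute)
next
  case (3 c m r L)
  then have "r \<noteq> L ! m" by auto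
  with 3 show ?case by (simp add: cut_set_def insert_Diff_if insert_commute)
qed simp

lemma nth_cut_less: "m < q \<Longrightarrow> cut c q L ! m = L ! m"
proof (induction m arbitrary: q L)
  case 0
  then show ?case by (cases q; cases L) auto
next
  case (Suc m)
  then show ?case by (cases q; cases L) auto
qed

lemma nth_cut_Suc: "m < q \<Longrightarrow> q < length L \<Longrightarrow> cut c m L ! Suc q = L ! q"
proof (induction m arbitrary: q L)
  case 0
  then show ?case by (cases q; cases L) auto
next
  case (Suc m)
  then show ?case by (cases q; cases L) auto
qed

lemma nth_cut_children:
  "m < length L \<Longrightarrow> cut c m L ! m = child c True (L ! m)"
  "m < length L \<Longrightarrow> cut c m L ! Suc m = child c False (L ! m)"
  by (induction c m L rule: cut.induct) auto

lemma cut_cut: "m < q \<Longrightarrow> cut c (Suc q) (cut d m L) = cut d m (cut c q L)"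
proof (induction m arbitrary: q L)
  case 0
  then show ?case by (cases q; cases L) auto
next
  case (Suc m)
  then show ?case by (cases q; cases L) auto
qed

lemma cut_exchange_less:
  "m < q \<Longrightarrow> cut c m (exchange q L) = exchange (Suc q) (cut c m L)"
proof (induction m arbitrary: q L)
  case 0
  then show ?case by (cases q; cases L) auto
next
  case (Suc m)
  then show ?case by (cases q; cases L) auto
qed

lemma cut_exchange_greater:
  "Suc q < m \<Longrightarrow> cut c m (exchange q L) = exchange q (cut c m L)"
proof (induction q arbitrary: m L)
  case 0
  then obtain m' where "m = Suc (Suc m')" by (cases m; cases "m - 1") auto
  then show ?case by (cases L; cases "tl L") auto
next
  case (Suc q)
  then show ?case by (cases m; cases L) auto
qed

lemma cut_exchange_same:
  "Suc q < length L \<Longrightarrow>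
   cut c q (exchange q L) = exchange (Suc q) (exchange q (cut c (Suc q) L))"
proof (induction q arbitrary: L)
  case 0
  then show ?case by (cases L; cases "tl L") auto
next
  case (Suc q)
  then show ?case by (cases L) auto
qed

lemma cut_exchange_Suc:
  "Suc q < length L \<Longrightarrow>
   cut c (Suc q) (exchange q L) = exchange q (exchange (Suc q) (cut c q L))"
proof (induction q arbitrary: L)
  case 0
  then show ?case by (cases L; cases "tl L") auto
next
  case (Suc q)
  then show ?case by (cases L) auto
qed

text \<open>
  The four quarters appear in the two orders \<open>1, 2, 3, 4\<close> and \<open>1, 3, 2,
  4\<close>; this is the source of the factor \<open>\<pi>\<close> in the relation for
  \<open>A\<close> and \<open>B\<close>.
\<close>

lemma cut_cross:
  "m < length L \<Longrightarrow>
   cut True m (cut True (Suc m) (cut False m L)) =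
   exchange (Suc m) (cut False m (cut False (Suc m) (cut True m L)))"
proof (induction m arbitrary: L)
  case 0
  then obtain r L' where "L = r # L'" by (cases L) auto
  then show ?case by (cases r) auto
next
  case (Suc m)
  then show ?case by (cases L) auto
qed

lemma exchange_exchange [simp]: "exchange m (exchange m L) = L"
  by (induction m L rule: exchange.induct) auto

lemma exchange_swap_far:
  "Suc m < q \<Longrightarrow> exchange m (exchange q L) = exchange q (exchange m L)"
proof (induction m arbitrary: q L)
  case 0
  then obtain q' where "q = Suc (Suc q')" by (cases q; cases "q - 1") auto
  then show ?case by (cases L; cases "tl L") auto
next
  case (Suc m)
  then show ?case by (cases q; cases L) auto
qed

lemma exchange_braid:
  "exchange m (exchange (Suc m) (exchange m L)) = exchange (Suc m) (exchange m (exchange (Suc m) L))"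
  if "Suc (Suc m) < length L"
  using that
proof (induction m arbitrary: L)
  case 0
  then show ?case by (cases L; cases "tl L"; cases "tl (tl L)") auto
next
  case (Suc m)
  then show ?case by (cases L) auto
qed

inductive rearrange :: "'a list \<Rightarrow> 'a list \<Rightarrow> bool" where
  "Suc m < length L \<Longrightarrow> rearrange L (exchange m L)"

lemma rearranges_Cons: "rearrange\<^sup>*\<^sup>* L L' \<Longrightarrow> rearrange\<^sup>*\<^sup>* (x # L) (x # L')"
proof (induction rule: rtranclp_induct)
  case (step L' L'')
  from step(2) have "rearrange (x # L') (x # L'')"
  proof cases
    case (1 m)
    then show ?thesis using rearrange.intros[of "Suc m" "x # L'"] by simp
  qed
  with step(3) show ?case by simp
qed simp

lemma rearranges_move_front: "rearrange\<^sup>*\<^sup>* (K @ x # L) (x # K @ L)"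
proof (induction K)
  case (Cons y K)
  have "rearrange\<^sup>*\<^sup>* (y # (K @ x # L)) (y # x # K @ L)"
    by (rule rearranges_Cons[OF Cons])
  moreover have "rearrange (y # x # K @ L) (x # y # K @ L)"
    using rearrange.intros[of 0 "y # x # K @ L"] by simp
  ultimately show ?case by simp
qed simp

lemma mset_eq_rearranges: "mset L = mset L' \<Longrightarrow> rearrange\<^sup>*\<^sup>* L L'"
proof (induction L' arbitrary: L)
  case (Cons x L')
  then have "x \<in> set L" by (metis list.set_intros(1) mset_eq_setD)
  then obtain K M where L: "L = K @ x # M" by (meson split_list)
  with Cons have "rearrange\<^sup>*\<^sup>* (x # K @ M) (x # L')" by (intro rearranges_Cons) auto
  with L show ?case using rearranges_move_front[of K x M] by simp
qed simp

definition partition_list :: "cell list \<Rightarrow> bool" where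
  "partition_list L \<longleftrightarrow> distinct L \<and> partition_cells (set L)"

lemma distinct_cut:
  assumes "distinct L" "m < length L" "partition_cells (set L)"
  shows "distinct (cut c m L)"
proof -
  have n: "child c b (L ! m) \<notin> set L" for b using assms by (intro child_notin) auto
  have "distinct (cut c m L)"
    if "distinct L" "m < length L" "\<And>b. child c b (L ! m) \<notin> set L" for L
    using that
  proof (induction c m L rule: cut.induct)
    case (3 c m r L)
    then have "r \<notin> set (cut c m L)"
      by (auto simp: set_cut cut_set_def)
    moreover have "distinct (cut c m L)" using 3 by (intro "3.IH") auto
    ultimately show ?case by simp
  qed auto
  from this[OF assms(1,2) n] show ?thesis .
qed

lemma partition_list_cut:
  "partition_list L \<Longrightarrow> m < length L \<Longrightarrow> partition_list (cut c m L)"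
  unfolding partition_list_def
proof (elim conjE, intro conjI)
  assume L: "distinct L" "partition_cells (set L)" "m < length L"
  show "distinct (cut c m L)" using L by (intro distinct_cut)
  show "partition_cells (set (cut c m L))"
    unfolding set_cut[OF L(1,3)] using L by (intro partition_cells_cut) auto
qed

lemma partition_list_exchange [simp]: "partition_list (exchange m L) = partition_list L"
  by (simp add: partition_list_def)

lemma partition_list_of_set:
  assumes "partition_cells D" obtains L where "partition_list L" "set L = D"
  using assms finite_distinct_list[of D] by (auto simp: partition_list_def partition_cells_finite)

text \<open>
  Cuts of list entries realize every refinement of the underlying set in some order, and exchanges
  correct the order.
\<close>

lemma refinement_induct:
  assumes V: "partition_list V" and Z: "partition_list Z" and ref: "refines (set Z) (set V)"
    and start: "P V"
    and cut: "\<And>L c m. partition_list L \<Longrightarrow> P L \<Longrightarrow> m < length L \<Longrightarrow> P (cut c m L)"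
    and exch: "\<And>L m. partition_list L \<Longrightarrow> P L \<Longrightarrow> Suc m < length L \<Longrightarrow> P (exchange m L)"
  shows "P Z"
proof -
  have "cut_step\<^sup>*\<^sup>* (set V) (set Z)"
    using V Z ref by (intro refines_imp_cut_steps) (simp_all add: partition_list_def)
  then have "\<exists>L. partition_list L \<and> set L = set Z \<and> P L"
  proof (induction rule: rtranclp_induct)
    case base
    show ?case using V start by blast
  next
    case (step D D')
    then obtain L where L: "partition_list L" "set L = D" "P L" by blast
    from step(2) obtain r c where r: "r \<in> D" "D' = cut_set c r D" by cases
    from r(1) L(2) obtain m where m: "m < length L" "L ! m = r" by (metis in_set_conv_nth)
    have "partition_list (cut c m L)" using L(1) m(1) by (rule partition_list_cut)
    moreover have "set (cut c m L) = D'"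
      using set_cut[of L m c] L m r by (simp add: partition_list_def)
    moreover have "P (cut c m L)" using L(1,3) m(1) by (rule cut)
    ultimately show ?case by blast
  qed
  then obtain L where L: "partition_list L" "set L = set Z" "P L" by blast
  then have "mset L = mset Z" using Z by (simp add: partition_list_def set_eq_iff_mset_eq_distinct)
  then have "rearrange\<^sup>*\<^sup>* L Z" by (rule mset_eq_rearranges)
  then have "partition_list Z \<and> P Z"
  proof (induction rule: rtranclp_induct)
    case base
    show ?case using L by blast
  next
    case (step L' L'')
    from step(2) obtain m where "Suc m < length L'" "L'' = exchange m L'" by cases
    with step(3) show ?case using exch[of L' m] by simp
  qed
  then show ?thesis ..
qed

section \<open>Level relations\<close>

text \<open>
  \<open>X n c m\<close> stands for the cut in direction \<open>c\<close> at position
  \<open>m\<close> of a list of length \<open>n\<close>, and \<open>S n j\<close> for the exchange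
  of the positions \<open>j\<close> and \<open>j + 1\<close>. Each assumption but the closure
  conditions is the image of an identity between composites of \<^const>\<open>cut\<close> and
  \<^const>\<open>exchange\<close>, where the leftmost factor is applied first.
\<close>

locale level_group = group G for G (structure) +
  fixes X :: "nat \<Rightarrow> bool \<Rightarrow> nat \<Rightarrow> 'a" and S :: "nat \<Rightarrow> nat \<Rightarrow> 'a"
  assumes X_closed [simp]: "X n c m \<in> carrier G"
    and S_closed [simp]: "S n j \<in> carrier G"
    and S_square: "Suc j < n \<Longrightarrow> S n j \<otimes> S n j = \<one>"
    and S_far: "Suc j < i \<Longrightarrow> Suc i < n \<Longrightarrow> S n i \<otimes> S n j = S n j \<otimes> S n i"
    and S_braid: "Suc (Suc j) < n \<Longrightarrow>
      S n j \<otimes> S n (Suc j) \<otimes> S n j = S n (Suc j) \<otimes> S n j \<otimes> S n (Suc j)"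
    and X_X: "m < q \<Longrightarrow> q < n \<Longrightarrow> X n c q \<otimes> X (Suc n) d m = X n d m \<otimes> X (Suc n) c (Suc q)"
    and S_X_less: "m < q \<Longrightarrow> Suc q < n \<Longrightarrow> S n q \<otimes> X n c m = X n c m \<otimes> S (Suc n) (Suc q)"
    and S_X_greater: "Suc q < m \<Longrightarrow> m < n \<Longrightarrow> S n q \<otimes> X n c m = X n c m \<otimes> S (Suc n) q"
    and S_X_same: "Suc q < n \<Longrightarrow>
      S n q \<otimes> X n c q = X n c (Suc q) \<otimes> S (Suc n) q \<otimes> S (Suc n) (Suc q)"
    and X_cross: "m < n \<Longrightarrow>
      X n False m \<otimes> X (Suc n) True (Suc m) \<otimes> X (Suc (Suc n)) True m =
      X n True m \<otimes> X (Suc n) False (Suc m) \<otimes> X (Suc (Suc n)) False m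
        \<otimes> S (Suc (Suc (Suc n))) (Suc m)"
begin

subsection \<open>The normal form for the symmetric group\<close>

text \<open>
  \<open>cycle n i r\<close> moves the entry at position \<open>i + r\<close> to position
  \<open>i\<close>. The element \<open>ordering n i L\<close> leads from the sorted arrangement of
  \<open>L\<close> to \<open>L\<close> itself, where the entries of \<open>L\<close> occupy the
  positions \<open>i, i + 1, ...\<close>: the first entry of \<open>L\<close>, whose place in the
  sorted list is its number of smaller successors, is moved to the front, and the remaining entries
  are arranged afterwards. Any total order on cells would do; the one used comes from an
  enumeration.
\<close>

primrec cycle :: "nat \<Rightarrow> nat \<Rightarrow> nat \<Rightarrow> 'a" where
  "cycle n i 0 = \<one>"
| "cycle n i (Suc r) = S n (i + r) \<otimes> cycle n i r"

fun ordering :: "nat \<Rightarrow> nat \<Rightarrow> cell list \<Rightarrow> 'a" where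
  "ordering n i [] = \<one>"
| "ordering n i (x # L) =
     cycle n i (length (filter (\<lambda>y. to_nat y < to_nat x) L)) \<otimes> ordering n (Suc i) L"

lemma cycle_closed [simp]: "cycle n i r \<in> carrier G"
  by (induction r) auto

lemma ordering_closed [simp]: "ordering n i L \<in> carrier G"
  by (induction L arbitrary: i) auto

lemma cycle_Suc_right: "cycle n i (Suc r) = cycle n (Suc i) r \<otimes> S n i"
  by (induction r) (auto simp: m_assoc)

lemma cycle_far: "Suc j < i \<Longrightarrow> i + r < n \<Longrightarrow> S n j \<otimes> cycle n i r = cycle n i r \<otimes> S n j"
proof (induction r)
  case (Suc r)
  then have "S n j \<otimes> S n (i + r) = S n (i + r) \<otimes> S n j" using S_far[of j "i + r" n] by simp
  with Suc show ?case by (metis add_Suc_right Suc_lessD cycle.simps(2) cycle_closed S_closed m_assoc)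
qed simp

lemma cycle_above:
  "i + r < j \<Longrightarrow> Suc j < n \<Longrightarrow> S n j \<otimes> cycle n i r = cycle n i r \<otimes> S n j"
proof (induction r)
  case (Suc r)
  then have "S n j \<otimes> S n (i + r) = S n (i + r) \<otimes> S n j" using S_far[of "i + r" j n] by simp
  with Suc show ?case by (metis add_Suc_right Suc_lessD cycle.simps(2) cycle_closed S_closed m_assoc)
qed simp

text \<open>
  Conjugation by a cycle shifts a generator inside its range by one. At the end of the range this is
  the braid relation; the other factors commute with the generator.
\<close>

lemma cycle_shift:
  assumes "i \<le> j" "j < i + r" "Suc (i + r) < n"
  shows "cycle n i (Suc r) \<otimes> S n (Suc j) = S n j \<otimes> cycle n i (Suc r)"
  using assms
proof (induction r)
  case (Suc r)
  show ?case
  proof (cases "j = i + r")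
    case True
    have "cycle n i (Suc (Suc r)) \<otimes> S n (Suc j) =
        S n (Suc j) \<otimes> (S n j \<otimes> (cycle n i r \<otimes> S n (Suc j)))"
      by (simp add: True m_assoc)
    also have "\<dots> = S n (Suc j) \<otimes> (S n j \<otimes> (S n (Suc j) \<otimes> cycle n i r))"
      using Suc True cycle_above[of i r "Suc j" n] by simp
    also have "\<dots> = (S n (Suc j) \<otimes> S n j \<otimes> S n (Suc j)) \<otimes> cycle n i r"
      by (simp add: m_assoc)
    also have "\<dots> = (S n j \<otimes> S n (Suc j) \<otimes> S n j) \<otimes> cycle n i r"
      using S_braid[of j n] Suc.prems True by simp
    also have "\<dots> = S n j \<otimes> cycle n i (Suc (Suc r))"
      by (simp add: True m_assoc)
    finally show ?thesis .
  next
    case False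
    have c: "S n (Suc (i + r)) \<otimes> S n j = S n j \<otimes> S n (Suc (i + r))"
      using S_far[of j "Suc (i + r)" n] Suc.prems False by simp
    have "cycle n i (Suc (Suc r)) \<otimes> S n (Suc j) =
        S n (Suc (i + r)) \<otimes> (cycle n i (Suc r) \<otimes> S n (Suc j))"
      using m_assoc[of "S n (Suc (i + r))" "cycle n i (Suc r)" "S n (Suc j)"] by simp
    also have "\<dots> = S n (Suc (i + r)) \<otimes> (S n j \<otimes> cycle n i (Suc r))"
      using Suc False by simp
    also have "\<dots> = (S n (Suc (i + r)) \<otimes> S n j) \<otimes> cycle n i (Suc r)"
      by (simp only: m_assoc S_closed cycle_closed)
    also have "\<dots> = S n j \<otimes> (S n (Suc (i + r)) \<otimes> cycle n i (Suc r))"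
      unfolding c by (simp only: m_assoc S_closed cycle_closed)
    also have "\<dots> = S n j \<otimes> cycle n i (Suc (Suc r))"
      by simp
    finally show ?thesis .
  qed
qed simp

text \<open>
  Both sides move the entries at the positions \<open>i + r + 1\<close> and \<open>i + a\<close> to
  the front. If the one further back is moved first, the other one is found one position later.
\<close>

lemma cycle_cycle:
  assumes "a \<le> r" "Suc (i + r) < n"
  shows "cycle n i (Suc r) \<otimes> cycle n (Suc i) a = cycle n i a \<otimes> cycle n i (Suc r)"
  using assms(1)
proof (induction a)
  case 0
  show ?case by (simp only: cycle.simps(1) r_one l_one cycle_closed)
next
  case (Suc a)
  have sh: "cycle n i (Suc r) \<otimes> S n (Suc (i + a)) = S n (i + a) \<otimes> cycle n i (Suc r)"
    using Suc assms by (intro cycle_shift) auto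
  have "cycle n i (Suc r) \<otimes> cycle n (Suc i) (Suc a) =
      (cycle n i (Suc r) \<otimes> S n (Suc (i + a))) \<otimes> cycle n (Suc i) a"
    unfolding cycle.simps(2)[of n "Suc i" a] by (simp only: m_assoc S_closed cycle_closed add_Suc)
  also have "\<dots> = S n (i + a) \<otimes> (cycle n i (Suc r) \<otimes> cycle n (Suc i) a)"
    unfolding sh by (simp only: m_assoc S_closed cycle_closed)
  also have "\<dots> = S n (i + a) \<otimes> (cycle n i a \<otimes> cycle n i (Suc r))"
    using Suc by simp
  also have "\<dots> = cycle n i (Suc a) \<otimes> cycle n i (Suc r)"
    unfolding cycle.simps(2)[of n i a] by (simp only: m_assoc S_closed cycle_closed)
  finally show ?case .
qed

lemma ordering_far:
  "Suc j < i \<Longrightarrow> i + length L \<le> n \<Longrightarrow> S n j \<otimes> ordering n i L = ordering n i L \<otimes> S n j"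
proof (induction L arbitrary: i)
  case (Cons x L)
  let ?r = "length (filter (\<lambda>y. to_nat y < to_nat x) L)"
  have r: "?r \<le> length L" by (rule length_filter_le)
  have "i + ?r < n" using r Cons.prems by (simp del: length_filter_le)
  then have "S n j \<otimes> cycle n i ?r = cycle n i ?r \<otimes> S n j"
    using Cons.prems by (intro cycle_far) auto
  with Cons show ?case
    by simp (metis (no_types, lifting) Suc_lessD Suc_less_eq less_SucI add_Suc_right S_closed
        cycle_closed m_assoc ordering_closed add_Suc)
qed simp

text \<open>
  If the first two entries are in ascending order, moving \<open>y\<close> in front of
  \<open>x\<close> takes one more step than before, and \<open>cycle_cycle\<close> turns this step
  into the factor \<open>S n i\<close>.
\<close>

lemma ordering_exchange_ascending:
  assumes xy: "to_nat x < to_nat y" and n: "i + length (x # y # L) \<le> n"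
  shows "ordering n i (y # x # L) = ordering n i (x # y # L) \<otimes> S n i"
proof -
  define a where "a = length (filter (\<lambda>z. to_nat z < to_nat x) L)"
  define b where "b = length (filter (\<lambda>z. to_nat z < to_nat y) L)"
  have ab: "a \<le> b"
    unfolding a_def b_def length_filter_conv_card
    using xy by (intro card_mono) auto
  have bL: "b \<le> length L" by (simp add: b_def)
  have far: "S n i \<otimes> ordering n (Suc (Suc i)) L = ordering n (Suc (Suc i)) L \<otimes> S n i"
    using n by (intro ordering_far) auto
  have "ordering n i (y # x # L) =
      (cycle n i (Suc b) \<otimes> cycle n (Suc i) a) \<otimes> ordering n (Suc (Suc i)) L"
    using xy by (simp add: a_def[symmetric] b_def[symmetric] m_assoc)
  also have "cycle n i (Suc b) \<otimes> cycle n (Suc i) a = cycle n i a \<otimes> cycle n i (Suc b)"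
    using ab bL n by (intro cycle_cycle) auto
  also have "cycle n i (Suc b) = cycle n (Suc i) b \<otimes> S n i"
    by (rule cycle_Suc_right)
  also have "cycle n i a \<otimes> (cycle n (Suc i) b \<otimes> S n i) \<otimes> ordering n (Suc (Suc i)) L =
      cycle n i a \<otimes> (cycle n (Suc i) b \<otimes> (ordering n (Suc (Suc i)) L \<otimes> S n i))"
    by (simp add: m_assoc far)
  also have "\<dots> = ordering n i (x # y # L) \<otimes> S n i"
    using xy by (simp add: a_def[symmetric] b_def[symmetric] m_assoc)
  finally show ?thesis .
qed

text \<open>
  This is the Coxeter presentation of the symmetric group in the form needed here: the element
  \<^const>\<open>ordering\<close> is a function of the arrangement, and the product along a
  sequence of exchanges is the quotient of its values at the two ends.
\<close>

lemma ordering_exchange: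
  assumes "distinct L" "Suc m < length L" "i + length L \<le> n"
  shows "ordering n i (exchange m L) = ordering n i L \<otimes> S n (i + m)"
  using assms
proof (induction m L arbitrary: i rule: exchange.induct)
  case (1 x y L)
  then have "to_nat x \<noteq> to_nat y" by auto
  then consider "to_nat x < to_nat y" | "to_nat y < to_nat x" by linarith
  then show ?case
  proof cases
    case 1
    then show ?thesis using ordering_exchange_ascending[of x y i L n] \<open>i + length _ \<le> n\<close> by simp
  next
    case 2
    have "ordering n i (x # y # L) = ordering n i (y # x # L) \<otimes> S n i"
      using 2 \<open>i + length _ \<le> n\<close> by (intro ordering_exchange_ascending) auto
    moreover have "S n i \<otimes> S n i = \<one>" using \<open>i + length _ \<le> n\<close> by (intro S_square) auto
    ultimately have "ordering n i (x # y # L) \<otimes> S n i = ordering n i (y # x # L)"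
      by (simp only: m_assoc S_closed ordering_closed r_one)
    then show ?thesis by (simp only: exchange.simps add_0_right)
  qed
next
  case (2 m r L)
  have "mset (filter (\<lambda>y. to_nat y < to_nat r) (exchange m L)) =
      mset (filter (\<lambda>y. to_nat y < to_nat r) L)"
    by (simp add: mset_filter)
  then have "length (filter (\<lambda>y. to_nat y < to_nat r) (exchange m L)) =
      length (filter (\<lambda>y. to_nat y < to_nat r) L)"
    by (rule mset_eq_length)
  with 2 show ?case by (simp add: m_assoc)
qed auto

section \<open>Coherence\<close>

definition ord :: "cell list \<Rightarrow> 'a" where
  "ord L = ordering (length L) 0 L"

text \<open>
  The generator of a cut, conjugated so that it leads from the sorted arrangement before the cut to
  the sorted arrangement afterwards. It therefore does not depend on the order of the list
  (\<open>cut_arrow_cong\<close>), which makes it an invariant \<open>set_arrow\<close> of a set of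
  cells.
\<close>

definition cut_arrow :: "cell list \<Rightarrow> nat \<Rightarrow> bool \<Rightarrow> 'a" where
  "cut_arrow L m c = ord L \<otimes> X (length L) c m \<otimes> inv ord (cut c m L)"

lemma ord_closed [simp]: "ord L \<in> carrier G"
  by (simp add: ord_def)

lemma cut_arrow_closed [simp]: "cut_arrow L m c \<in> carrier G"
  by (simp add: cut_arrow_def)

lemma ord_exchange:
  "distinct L \<Longrightarrow> Suc m < length L \<Longrightarrow> ord (exchange m L) = ord L \<otimes> S (length L) m"
  using ordering_exchange[of L m 0 "length L"] by (simp add: ord_def)

text \<open>
  The companion of \<open>S_X_same\<close> for a cut of the other exchanged entry, obtained by
  solving for it.
\<close>

lemma S_X_Suc:
  assumes "Suc q < n"
  shows "S n q \<otimes> X n c (Suc q) = X n c q \<otimes> (S (Suc n) (Suc q) \<otimes> S (Suc n) q)"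
proof -
  let ?u = "S (Suc n) q \<otimes> S (Suc n) (Suc q)" and ?v = "S (Suc n) (Suc q) \<otimes> S (Suc n) q"
  have "?u \<otimes> ?v = S (Suc n) q \<otimes> (S (Suc n) (Suc q) \<otimes> S (Suc n) (Suc q)) \<otimes> S (Suc n) q"
    by (simp add: m_assoc)
  also have "\<dots> = \<one>" using assms by (simp add: S_square)
  finally have uv: "?u \<otimes> ?v = \<one>" .
  have "S n q \<otimes> X n c (Suc q) = S n q \<otimes> (X n c (Suc q) \<otimes> (?u \<otimes> ?v))"
    unfolding uv by simp
  also have "\<dots> = S n q \<otimes> (X n c (Suc q) \<otimes> S (Suc n) q \<otimes> S (Suc n) (Suc q)) \<otimes> ?v"
    by (simp add: m_assoc)
  also have "\<dots> = S n q \<otimes> (S n q \<otimes> X n c q) \<otimes> ?v"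
    using S_X_same[OF assms] by simp
  also have "\<dots> = (S n q \<otimes> S n q) \<otimes> X n c q \<otimes> ?v"
    by (simp add: m_assoc)
  also have "\<dots> = X n c q \<otimes> ?v" using S_square[OF assms] by simp
  finally show ?thesis .
qed

lemma cancel_left:
  "x \<in> carrier G \<Longrightarrow> y \<in> carrier G \<Longrightarrow> inv x \<otimes> (x \<otimes> y) = y"
  "x \<in> carrier G \<Longrightarrow> y \<in> carrier G \<Longrightarrow> x \<otimes> (inv x \<otimes> y) = y"
  by (simp_all add: m_assoc[symmetric])

text \<open>
  If \<open>a\<close> passes \<open>x\<close> and becomes \<open>w\<close>, then changing the
  arrangement by \<open>a\<close> before a cut and by \<open>w\<close> afterwards does not affect
  the conjugated cut.
\<close>

lemma arrow_change:
  assumes "a \<otimes> x = y \<otimes> w" "{N, M, a, x, y, w} \<subseteq> carrier G"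
  shows "(N \<otimes> a) \<otimes> x \<otimes> inv (M \<otimes> w) = N \<otimes> y \<otimes> inv M"
proof -
  have "(N \<otimes> a) \<otimes> x \<otimes> inv (M \<otimes> w) = N \<otimes> (a \<otimes> x) \<otimes> (inv w \<otimes> inv M)"
    using assms(2) by (simp add: m_assoc inv_mult_group)
  also have "\<dots> = N \<otimes> y \<otimes> (w \<otimes> inv w) \<otimes> inv M"
    unfolding assms(1) using assms(2) by (simp add: m_assoc cancel_left)
  finally show ?thesis using assms(2) by simp
qed

text \<open>
  The four positions of the exchange relative to the cut correspond to the four relations between
  \<open>S\<close> and \<open>X\<close>.
\<close>

lemma cut_arrow_exchange:
  assumes L: "partition_list L" and j: "Suc j < length L" and i: "i < length L"
  shows "cut_arrow (exchange j L) i c =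
    cut_arrow L (if i = j then Suc j else if i = Suc j then j else i) c"
proof -
  let ?n = "length L"
  have d: "distinct L" using L by (simp add: partition_list_def)
  have dc: "distinct (cut c m L)" if "m < ?n" for m
    using partition_list_cut[OF L that] by (simp add: partition_list_def)
  have e: "ord (exchange j L) = ord L \<otimes> S ?n j" using d j by (rule ord_exchange)
  consider "i < j" | "i = j" | "i = Suc j" | "Suc j < i" by linarith
  then show ?thesis
  proof cases
    case 1
    have "ord (cut c i (exchange j L)) = ord (cut c i L) \<otimes> S (Suc ?n) (Suc j)"
      using 1 i j dc[OF i] by (simp add: cut_exchange_less ord_exchange)
    with 1 e j show ?thesis
      unfolding cut_arrow_def by (simp add: arrow_change[OF S_X_less])
  next
    case 2
    have "ord (cut c i (exchange j L)) =
        ord (cut c (Suc j) L) \<otimes> (S (Suc ?n) j \<otimes> S (Suc ?n) (Suc j))"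
      using 2 j dc[OF j] by (simp add: cut_exchange_same ord_exchange m_assoc)
    moreover have "S ?n j \<otimes> X ?n c j =
        X ?n c (Suc j) \<otimes> (S (Suc ?n) j \<otimes> S (Suc ?n) (Suc j))"
      using S_X_same[OF j] by (simp add: m_assoc)
    ultimately show ?thesis
      using 2 e unfolding cut_arrow_def by (simp add: arrow_change)
  next
    case 3
    have "ord (cut c i (exchange j L)) =
        ord (cut c j L) \<otimes> (S (Suc ?n) (Suc j) \<otimes> S (Suc ?n) j)"
      using 3 j dc[of j] by (simp add: cut_exchange_Suc ord_exchange m_assoc)
    then show ?thesis
      using 3 e S_X_Suc[OF j] unfolding cut_arrow_def by (simp add: arrow_change)
  next
    case 4
    have "ord (cut c i (exchange j L)) = ord (cut c i L) \<otimes> S (Suc ?n) j"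
      using 4 i j dc[OF i] by (simp add: cut_exchange_greater ord_exchange)
    with 4 e i show ?thesis
      unfolding cut_arrow_def by (simp add: arrow_change[OF S_X_greater])
  qed
qed

lemma cut_arrow_rearranges:
  assumes "rearrange\<^sup>*\<^sup>* L L'" "partition_list L"
    and "m < length L" "m' < length L'" "L ! m = L' ! m'"
  shows "partition_list L' \<and> length L' = length L \<and> cut_arrow L m c = cut_arrow L' m' c"
  using assms(1,4,5)
proof (induction arbitrary: m' rule: rtranclp_induct)
  case base
  then have "m = m'" using assms(2,3) by (simp add: partition_list_def nth_eq_iff_index_eq)
  then show ?case using assms(2) by simp
next
  case (step L' L'')
  from step(2) obtain j where j: "Suc j < length L'" "L'' = exchange j L'" by cases
  let ?i = "if m' = j then Suc j else if m' = Suc j then j else m'"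
  have "L ! m = L' ! ?i" using step.prems j by (simp add: nth_exchange)
  moreover have "?i < length L'" using step.prems j by auto
  ultimately have IH: "partition_list L'" "length L' = length L" "cut_arrow L m c = cut_arrow L' ?i c"
    using step.IH[of ?i] by auto
  have "cut_arrow L'' m' c = cut_arrow L' ?i c"
    unfolding j(2) using IH(1) j(1) step.prems by (intro cut_arrow_exchange) (simp_all add: j)
  with IH j show ?case by simp
qed

lemma cut_arrow_cong:
  assumes "partition_list L" "partition_list L'" "set L = set L'"
    and "m < length L" "m' < length L'" "L ! m = L' ! m'"
  shows "cut_arrow L m c = cut_arrow L' m' c"
proof -
  have "mset L = mset L'"
    using assms by (simp add: partition_list_def set_eq_iff_mset_eq_distinct)
  then show ?thesis
    using cut_arrow_rearranges[OF mset_eq_rearranges] assms by blast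
qed

definition set_arrow :: "cell set \<Rightarrow> cell \<Rightarrow> bool \<Rightarrow> 'a" where
  "set_arrow D r c =
     (let (L, m) = (SOME (L, m). partition_list L \<and> set L = D \<and> m < length L \<and> L ! m = r)
      in cut_arrow L m c)"

lemma set_arrow_eq:
  assumes "partition_list L" "m < length L"
  shows "set_arrow (set L) (L ! m) c = cut_arrow L m c"
proof -
  define P where
    "P = (\<lambda>(K, k). partition_list K \<and> set K = set L \<and> k < length K \<and> K ! k = L ! m)"
  obtain K k where Kk: "Eps P = (K, k)" by (rule prod.exhaust)
  have "P (L, m)" using assms by (simp add: P_def)
  then have "P (K, k)" unfolding Kk[symmetric] by (rule someI)
  then have "cut_arrow K k c = cut_arrow L m c"
    using assms unfolding P_def prod.case by (intro cut_arrow_cong) (elim conjE; assumption)+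
  then show ?thesis unfolding set_arrow_def P_def[symmetric] Kk by simp
qed

lemma set_arrow_closed [simp]: "set_arrow D r c \<in> carrier G"
  unfolding set_arrow_def Let_def by (rule prod.exhaust, erule ssubst) simp

lemma cut_arrows_commute:
  assumes "m < q" "q < length L"
  shows "cut_arrow L q c \<otimes> cut_arrow (cut c q L) m d =
    cut_arrow L m d \<otimes> cut_arrow (cut d m L) (Suc q) c"
proof -
  let ?n = "length L"
  have tele: "(a \<otimes> x \<otimes> inv b) \<otimes> (b \<otimes> y \<otimes> z) = a \<otimes> (x \<otimes> y) \<otimes> z"
    if "{a, x, b, y, z} \<subseteq> carrier G" for a x b y z
    using that by (simp add: m_assoc cancel_left)
  have lens: "length (cut c q L) = Suc ?n" "length (cut d m L) = Suc ?n" using assms by auto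
  show ?thesis
    unfolding cut_arrow_def lens cut_cut[OF assms(1)]
    by (simp add: tele X_X[OF assms])
qed

lemma cut_arrows_cross:
  assumes L: "partition_list L" and m: "m < length L"
  shows "cut_arrow L m False \<otimes> cut_arrow (cut False m L) (Suc m) True
      \<otimes> cut_arrow (cut True (Suc m) (cut False m L)) m True =
    cut_arrow L m True \<otimes> cut_arrow (cut True m L) (Suc m) False
      \<otimes> cut_arrow (cut False (Suc m) (cut True m L)) m False"
proof -
  let ?n = "length L"
  have tele: "(a \<otimes> x \<otimes> inv b) \<otimes> (b \<otimes> y \<otimes> inv e) \<otimes> (e \<otimes> w \<otimes> z) = a \<otimes> (x \<otimes> y \<otimes> w) \<otimes> z"
    if "{a, x, b, y, e, w, z} \<subseteq> carrier G" for a x b y e w z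
    using that by (simp add: m_assoc cancel_left)
  have lens: "length (cut c m L) = Suc ?n" "length (cut d (Suc m) (cut c m L)) = Suc (Suc ?n)"
    for c d using m by auto
  let ?K = "cut False m (cut False (Suc m) (cut True m L))"
  have pK: "partition_list ?K" using L m by (intro partition_list_cut) auto
  have lK: "length ?K = Suc (Suc (Suc ?n))" using m by simp
  have "ord (cut True m (cut True (Suc m) (cut False m L))) = ord ?K \<otimes> S (Suc (Suc (Suc ?n))) (Suc m)"
    unfolding cut_cross[OF m] using pK lK m ord_exchange[of ?K "Suc m"] by (simp add: partition_list_def)
  moreover have "\<one> \<otimes> (X ?n False m \<otimes> X (Suc ?n) True (Suc m) \<otimes> X (Suc (Suc ?n)) True m) =
      X ?n True m \<otimes> X (Suc ?n) False (Suc m) \<otimes> X (Suc (Suc ?n)) False m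
        \<otimes> S (Suc (Suc (Suc ?n))) (Suc m)"
    using X_cross[OF m] by simp
  note arrow_change[OF this, of "ord L" "ord ?K"]
  ultimately show ?thesis
    unfolding cut_arrow_def lens by (simp add: tele)
qed

inductive path :: "cell set \<Rightarrow> cell set \<Rightarrow> 'a \<Rightarrow> bool" where
  path_refl: "path D D \<one>"
| path_cut: "r \<in> D \<Longrightarrow> path (cut_set c r D) D' g \<Longrightarrow> path D D' (set_arrow D r c \<otimes> g)"

lemma path_closed: "path D D' g \<Longrightarrow> g \<in> carrier G"
  by (induction rule: path.induct) auto

lemma path_exists: "cut_step\<^sup>*\<^sup>* D D' \<Longrightarrow> \<exists>g. path D D' g"
  by (induction rule: converse_rtranclp_induct) (blast elim: cut_step.cases intro: path_refl path_cut)+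

lemma path_partition: "path D D' g \<Longrightarrow> partition_cells D \<Longrightarrow> partition_cells D' \<and> refines D' D"
  by (induction rule: path.induct)
    (auto intro: partition_cells_cut refines_trans refines_cut)

lemma path_append:
  "path D D' g \<Longrightarrow> r \<in> D' \<Longrightarrow> path D (cut_set c r D') (g \<otimes> set_arrow D' r c)"
proof (induction rule: path.induct)
  case (path_refl D)
  then show ?case using path_cut[of r D c _ \<one>] by (simp add: path.path_refl)
next
  case (path_cut s D d D' g)
  then show ?case using path.path_cut[of s D d _ "g \<otimes> set_arrow D' r c"]
    by (simp add: m_assoc path_closed)
qed

text \<open>
  The coherence theorem. Let two paths start with cuts of \<open>r\<close> and \<open>r'\<close>. If
  \<open>r\<close> and \<open>r'\<close> differ, let \<open>N\<close> be the partition in which both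
  have been cut; if \<open>r = r'\<close> is cut in both directions, let \<open>N\<close> be the
  partition with \<open>r\<close> replaced by its four quarters. The target refines
  \<open>N\<close>, so a path leads there from \<open>N\<close>. By induction both given paths may
  be replaced by paths through \<open>N\<close>, whose initial parts agree by
  \<open>cut_arrows_commute\<close> or \<open>cut_arrows_cross\<close>.
\<close>

lemma path_unique:
  assumes "path D D' g" "path D D' g'" "partition_cells D"
  shows "g = g'"
  using assms
proof (induction "card D' - card D" arbitrary: D g g' rule: less_induct)
  case less
  have smaller: "card D' - card (cut_set c r D) < card D' - card D"
    if "r \<in> D" "path (cut_set c r D) D' h" for r c h
  proof -
    have "partition_cells (cut_set c r D)" using less.prems(3) that(1) by (rule partition_cells_cut)
    with that(2) have "card (cut_set c r D) \<le> card D'" by (meson path_partition refines_card)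
    then show ?thesis using card_cut[OF less.prems(3) that(1), of c] by simp
  qed
  \<comment> \<open>different cells, with \<open>r\<close> at the later position of a list; the other order arises by exchanging the roles\<close>
  have commute: "set_arrow D r c \<otimes> h = set_arrow D r' c' \<otimes> h'"
    if m: "m < q" "q < length L" "partition_list L" "set L = D" "r = L ! q" "r' = L ! m"
      and h: "path (cut_set c r D) D' h" and h': "path (cut_set c' r' D) D' h'"
    for r c r' c' h h' m q L
  proof -
    have D: "partition_cells D" using less.prems by simp
    have r: "r \<in> D" "r' \<in> D" "r' \<noteq> r"
      using m by (auto simp: partition_list_def nth_eq_iff_index_eq)
    have pl: "partition_list (cut c q L)" "partition_list (cut c' m L)"
      using m by (auto intro: partition_list_cut)
    have s1: "set (cut c q L) = cut_set c r D" and s2: "set (cut c' m L) = cut_set c' r' D"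
      using m by (auto simp: set_cut partition_list_def)
    have n1: "cut c q L ! m = r'" and n2: "cut c' m L ! Suc q = r"
      using m by (auto simp: nth_cut_less nth_cut_Suc)
    let ?N = "set (cut c' m (cut c q L))"
    have N: "?N = cut_set c' r' (cut_set c r D)"
      using pl m by (subst set_cut) (auto simp: s1 n1 partition_list_def)
    have N': "?N = cut_set c r (cut_set c' r' D)"
      unfolding cut_cut[OF m(1), symmetric]
      using pl m by (subst set_cut) (auto simp: s2 n2 partition_list_def)
    have rin: "r' \<in> cut_set c r D" "r \<in> cut_set c' r' D" using r by (auto simp: cut_set_def)
    have pD': "partition_cells D'" "refines D' (cut_set c r D)" "refines D' (cut_set c' r' D)"
      using path_partition h h' partition_cells_cut[OF D] r by blast+
    have "partition_list (cut c' m (cut c q L))"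
      using pl(1) m by (intro partition_list_cut) auto
    then have "partition_cells ?N" by (simp add: partition_list_def)
    moreover have "refines D' ?N"
      unfolding N using D r pD' by (intro refines_cut_cut) auto
    ultimately obtain k where k: "path ?N D' k"
      using pD' path_exists refines_imp_cut_steps by blast
    have kc: "k \<in> carrier G" using k by (rule path_closed)
    have "h = set_arrow (cut_set c r D) r' c' \<otimes> k"
      using smaller[OF r(1) h] h path_cut[OF rin(1), of c' D' k] k partition_cells_cut[OF D r(1)]
      unfolding N by (intro less.hyps) auto
    moreover have "h' = set_arrow (cut_set c' r' D) r c \<otimes> k"
      using smaller[OF r(2) h'] h' path_cut[OF rin(2), of c D' k] k partition_cells_cut[OF D r(2)]
      unfolding N' by (intro less.hyps) auto
    moreover have "set_arrow D r c \<otimes> set_arrow (cut_set c r D) r' c' =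
        set_arrow D r' c' \<otimes> set_arrow (cut_set c' r' D) r c"
      using cut_arrows_commute[OF m(1,2), of c c'] set_arrow_eq[OF m(3), of q c]
        set_arrow_eq[OF m(3), of m c'] set_arrow_eq[OF pl(1), of m c'] set_arrow_eq[OF pl(2), of "Suc q" c]
        m n1 n2 s1 s2 by simp
    ultimately show ?thesis using kc by (simp add: m_assoc[symmetric])
  qed
  have cross: "set_arrow D r False \<otimes> h = set_arrow D r True \<otimes> h'"
    if r: "r \<in> D" and h: "path (cut_set False r D) D' h" and h': "path (cut_set True r D) D' h'"
    for r h h'
  proof -
    have D: "partition_cells D" using less.prems by simp
    obtain L where L: "partition_list L" "set L = D" using D by (rule partition_list_of_set)
    then obtain m where m: "m < length L" "L ! m = r" using r by (metis in_set_conv_nth)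
    let ?L1 = "\<lambda>c. cut c m L" and ?L2 = "\<lambda>c. cut (\<not> c) (Suc m) (cut c m L)"
    let ?L3 = "\<lambda>c. cut (\<not> c) m (cut (\<not> c) (Suc m) (cut c m L))"
    have len: "length (?L1 c) = Suc (length L)" "length (?L2 c) = Suc (Suc (length L))" for c
      using m by auto
    have pl: "partition_list (?L1 c)" "partition_list (?L2 c)" "partition_list (?L3 c)" for c
      using L m by (auto intro!: partition_list_cut)
    have n1: "?L1 c ! Suc m = child c False r" for c using m by (simp add: nth_cut_children)
    have n2: "?L2 c ! m = child c True r" for c using m by (simp add: nth_cut_less nth_cut_children)
    have s1: "set (?L1 c) = cut_set c r D" for c
      using m L by (simp add: set_cut partition_list_def)
    have s2: "set (?L2 c) = cut_set (\<not> c) (child c False r) (cut_set c r D)" for c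
      using pl[of c] m by (subst set_cut) (auto simp: s1 n1 partition_list_def)
    have s3: "set (?L3 c) = cut_set (\<not> c) (child c True r) (set (?L2 c))" for c
      using pl[of c] m by (subst set_cut) (auto simp: n2 partition_list_def)
    let ?N = "set (?L3 False)"
    have N': "?N = set (?L3 True)" using m by (simp add: cut_cross)
    have pD': "partition_cells D'" "refines D' (cut_set False r D)" "refines D' (cut_set True r D)"
      using path_partition h h' partition_cells_cut[OF D] r by blast+
    have "refines D' ?N"
      unfolding s3 s2 using refines_cut_cross[OF D r pD'(2,3)] by simp
    moreover have "partition_cells ?N" using pl(3)[of False] by (simp add: partition_list_def)
    ultimately obtain k where k: "path ?N D' k"
      using pD' path_exists refines_imp_cut_steps by blast
    have kc: "k \<in> carrier G" using k by (rule path_closed)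
    have in1: "child c False r \<in> cut_set c r D" for c by (simp add: cut_set_def)
    have in2: "child c True r \<in> set (?L2 c)" for c
      unfolding s2 by (cases c; cases r) (auto simp: cut_set_def)
    have p: "path (cut_set c r D) D' (cut_arrow (?L1 c) (Suc m) (\<not> c) \<otimes> (cut_arrow (?L2 c) m (\<not> c) \<otimes> k))"
      if "path (set (?L3 c)) D' k" for c
    proof -
      have "path (set (?L2 c)) D' (set_arrow (set (?L2 c)) (child c True r) (\<not> c) \<otimes> k)"
        using that unfolding s3 by (rule path_cut[OF in2])
      then have "path (cut_set c r D) D' (set_arrow (cut_set c r D) (child c False r) (\<not> c) \<otimes>
          (set_arrow (set (?L2 c)) (child c True r) (\<not> c) \<otimes> k))"
        unfolding s2 by (rule path_cut[OF in1])
      then show ?thesis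
        using set_arrow_eq[OF pl(1), of "Suc m" c "\<not> c"] set_arrow_eq[OF pl(2), of m c "\<not> c"] m
        by (simp only: s1 n1 n2 len)
    qed
    have "h = cut_arrow (?L1 False) (Suc m) True \<otimes> (cut_arrow (?L2 False) m True \<otimes> k)"
      using smaller[OF r h] h p[of False] k partition_cells_cut[OF D r]
      by (intro less.hyps) auto
    moreover have "h' = cut_arrow (?L1 True) (Suc m) False \<otimes> (cut_arrow (?L2 True) m False \<otimes> k)"
      using smaller[OF r h'] h' p[of True] k partition_cells_cut[OF D r]
      unfolding N' by (intro less.hyps) auto
    ultimately show ?thesis
      using cut_arrows_cross[OF L(1) m(1)] set_arrow_eq[OF L(1) m(1)] kc L(2) m(2)
      by (simp add: m_assoc[symmetric])
  qed
  have not_refl: False if "r \<in> D'" "path (cut_set c r D') D' h" "partition_cells D'" for r c h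
    using card_cut[OF that(3,1), of c] path_partition[OF that(2)] partition_cells_cut[OF that(3,1)]
    by (metis Suc_n_not_le_n refines_card that(3))
  from less.prems(1) show ?case
  proof cases
    case path_refl
    from less.prems(2) show ?thesis
      by cases (use path_refl not_refl less.prems in blast)+
  next
    case (path_cut r c h)
    note 1 = path_cut
    from less.prems(2) show ?thesis
    proof cases
      case path_refl
      then show ?thesis using 1 not_refl less.prems by blast
    next
      case (path_cut r' c' h')
      show ?thesis
      proof (cases "r = r'")
        case True
        show ?thesis
        proof (cases "c = c'")
          case True
          have "h = h'"
            using less.hyps[of "cut_set c r D" h h'] smaller[of r c h] 1 path_cut True \<open>r = r'\<close>
              partition_cells_cut[OF less.prems(3), of r c] by blast
          then show ?thesis using 1 path_cut True \<open>r = r'\<close> by simp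
        next
          case False
          then show ?thesis
            using cross[of r h h'] cross[of r h' h] 1 path_cut \<open>r = r'\<close> by (cases c) auto
        qed
      next
        case False
        obtain L where L: "partition_list L" "set L = D"
          using less.prems(3) by (rule partition_list_of_set)
        obtain m q where mq: "m < length L" "L ! m = r" "q < length L" "L ! q = r'"
          using 1 path_cut L by (metis in_set_conv_nth)
        then consider "m < q" | "q < m" using False by (metis nat_neq_iff)
        then show ?thesis
        proof cases
          case 1
          show ?thesis
            using commute[OF 1 mq(3) L mq(4)[symmetric] mq(2)[symmetric] path_cut(3) \<open>path (cut_set c r D) D' h\<close>]
              path_cut(1) \<open>g = _\<close> by simp
        next
          case 2
          show ?thesis
            using commute[OF 2 mq(1) L mq(2)[symmetric] mq(4)[symmetric] \<open>path (cut_set c r D) D' h\<close> path_cut(3)]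
              path_cut(1) \<open>g = _\<close> by simp
        qed
      qed
    qed
  qed
qed

definition value_set :: "cell set \<Rightarrow> 'a" where
  "value_set D = (THE g. path {whole} D g)"

text \<open>
  The value of a list: the path from the whole square to its set of cells, followed by the
  rearrangement of the sorted list.
\<close>

definition value_list :: "cell list \<Rightarrow> 'a" where
  "value_list L = value_set (set L) \<otimes> ord L"

lemma value_set_path:
  assumes "path {whole} D g" shows "value_set D = g"
  unfolding value_set_def
proof (rule the_equality)
  show "path {whole} D g" by (rule assms)
  show "h = g" if "path {whole} D h" for h
    using that assms partition_cells_whole by (rule path_unique)
qed

lemma path_from_whole:
  assumes "partition_cells D"
  shows "path {whole} D (value_set D)"
proof -
  have "refines D {whole}" by (auto simp: refines_def)
  then obtain g where "path {whole} D g"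
    using assms partition_cells_whole path_exists refines_imp_cut_steps by blast
  with value_set_path[OF this] show ?thesis by simp
qed

lemma value_list_closed [simp]: "partition_list L \<Longrightarrow> value_list L \<in> carrier G"
  unfolding value_list_def partition_list_def
  using path_closed[OF path_from_whole] by simp

lemma value_list_whole: "value_list [whole] = \<one>"
  using value_set_path[OF path_refl] by (simp add: value_list_def ord_def)

lemma value_list_cut:
  assumes L: "partition_list L" and m: "m < length L"
  shows "value_list (cut c m L) = value_list L \<otimes> X (length L) c m"
proof -
  have p: "path {whole} (set L) (value_set (set L))"
    using L by (intro path_from_whole) (simp add: partition_list_def)
  have "value_set (set (cut c m L)) = value_set (set L) \<otimes> cut_arrow L m c"
    using path_append[OF p, of "L ! m" c] L m set_arrow_eq[OF L m]
    by (intro value_set_path) (simp add: partition_list_def set_cut)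
  then show ?thesis
    using path_closed[OF p] by (simp add: value_list_def cut_arrow_def m_assoc)
qed

lemma value_list_exchange:
  assumes "partition_list L" "Suc m < length L"
  shows "value_list (exchange m L) = value_list L \<otimes> S (length L) m"
proof -
  have "value_set (set L) \<in> carrier G"
    using assms path_closed[OF path_from_whole] by (simp add: partition_list_def)
  then show ?thesis using assms by (simp add: value_list_def ord_exchange partition_list_def m_assoc)
qed

end

section \<open>Cells in the Cantor squares\<close>

text \<open>
  The Cantor set is the disjoint union of its images under the two contractions \<open>third
  False\<close> and \<open>third True\<close>. Iterating them along a word gives the affine map onto
  the part of the Cantor set with that address. Everything below uses only this self-similarity,
  never the digits of a point.
\<close>

definition third :: "bool \<Rightarrow> real \<Rightarrow> real" where
  "third b x = (if b then (x + 2) / 3 else x / 3)"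

primrec shrink :: "bool list \<Rightarrow> real \<Rightarrow> real" where
  "shrink [] x = x"
| "shrink (b # w) x = third b (shrink w x)"

declare cantor_stage.simps(2) [simp del]

lemma shrink_append: "shrink (u @ w) x = shrink u (shrink w x)"
  by (induction u) auto

lemma shrink_affine: "shrink w x = shrink w 0 + x / 3 ^ length w"
  by (induction w) (auto simp: third_def field_simps)

lemma third_unit: "third b x \<in> {0..1}" if "x \<in> {0..1}"
  using that by (auto simp: third_def)

lemma third_eq_iff:
  "x \<in> {0..1} \<Longrightarrow> y \<in> {0..1} \<Longrightarrow> third b x = third b' y \<longleftrightarrow> b = b' \<and> x = y"
  by (auto simp: third_def)

lemma shrink_unit: "x \<in> {0..1} \<Longrightarrow> shrink w x \<in> {0..1}"
proof (induction w)
  case (Cons b w)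
  then show ?case using third_unit[of "shrink w x" b] by simp
qed simp

lemma shrink_inj: "shrink w x = shrink w y \<Longrightarrow> x = y"
  using shrink_affine[of w x] shrink_affine[of w y] by simp

lemma shrink_eq_prefix:
  "x \<in> {0..1} \<Longrightarrow> y \<in> {0..1} \<Longrightarrow> shrink w x = shrink u y \<Longrightarrow> prefix w u \<or> prefix u w"
proof (induction w arbitrary: u)
  case (Cons b w)
  then show ?case
    by (cases u) (auto simp: third_eq_iff[OF shrink_unit shrink_unit])
qed simp

lemma cantor_stage_Suc_third:
  "cantor_stage (Suc n) = third False ` cantor_stage n \<union> third True ` cantor_stage n"
  by (simp add: third_def[abs_def] cantor_stage.simps(2))

lemma cantor_stage_unit: "cantor_stage n \<subseteq> {0..1}"
proof (induction n)
  case (Suc n)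
  then show ?case unfolding cantor_stage_Suc_third using third_unit by blast
qed simp

lemma cantor_set_unit: "x \<in> cantor_set \<Longrightarrow> x \<in> {0..1}"
  using cantor_stage_unit[of 0] unfolding cantor_set_def by blast

lemma third_stage_iff:
  assumes "x \<in> {0..1}" shows "third b x \<in> cantor_stage (Suc n) \<longleftrightarrow> x \<in> cantor_stage n"
proof
  assume "third b x \<in> cantor_stage (Suc n)"
  then obtain b' y where "y \<in> cantor_stage n" "third b x = third b' y"
    unfolding cantor_stage_Suc_third by blast
  with assms show "x \<in> cantor_stage n" using third_eq_iff cantor_stage_unit by (metis subsetD)
next
  assume "x \<in> cantor_stage n"
  then show "third b x \<in> cantor_stage (Suc n)"
    unfolding cantor_stage_Suc_third by (cases b) auto
qed

lemma third_cantor_iff: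
  assumes "x \<in> {0..1}" shows "third b x \<in> cantor_set \<longleftrightarrow> x \<in> cantor_set"
proof
  assume "third b x \<in> cantor_set"
  then have "third b x \<in> cantor_stage (Suc n)" for n unfolding cantor_set_def by blast
  then show "x \<in> cantor_set" using third_stage_iff[OF assms] by (auto simp: cantor_set_def)
next
  assume x: "x \<in> cantor_set"
  have "third b x \<in> cantor_stage n" for n
  proof (cases n)
    case 0
    then show ?thesis using third_unit[OF assms] by simp
  next
    case (Suc k)
    then show ?thesis using third_stage_iff[OF assms, of b k] x by (simp add: cantor_set_def)
  qed
  then show "third b x \<in> cantor_set" by (auto simp: cantor_set_def)
qed

lemma third_cantor_cases:
  assumes "x \<in> cantor_set" obtains b y where "y \<in> cantor_set" "x = third b y"
proof -
  have "x \<in> cantor_stage (Suc 0)" using assms unfolding cantor_set_def by blast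
  then obtain b y where y: "y \<in> {0..1}" "x = third b y"
    unfolding cantor_stage_Suc_third by auto
  then have "y \<in> cantor_set" using assms third_cantor_iff by blast
  with y that show thesis by blast
qed

lemma cantor_set_ends: "0 \<in> cantor_set" "1 \<in> cantor_set"
proof -
  have "0 \<in> cantor_stage n" "1 \<in> cantor_stage n" for n
  proof (induction n)
    case (Suc n)
    { case 1 then show ?case using third_stage_iff[of 0 False n] Suc by (simp add: third_def) }
    { case 2 then show ?case using third_stage_iff[of 1 True n] Suc by (simp add: third_def) }
  qed simp_all
  then show "0 \<in> cantor_set" "1 \<in> cantor_set" by (auto simp: cantor_set_def)
qed

lemma shrink_cantor_iff: "x \<in> {0..1} \<Longrightarrow> shrink w x \<in> cantor_set \<longleftrightarrow> x \<in> cantor_set"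
proof (induction w)
  case (Cons b w)
  then show ?case using third_cantor_iff[OF shrink_unit, of x b w] by simp
qed simp

lemma shrink_cantor: "x \<in> cantor_set \<Longrightarrow> shrink w x \<in> cantor_set"
  using shrink_cantor_iff cantor_set_unit by blast

lemma cantor_set_shrink:
  "x \<in> cantor_set \<Longrightarrow> \<exists>w y. length w = d \<and> y \<in> cantor_set \<and> x = shrink w y"
proof (induction d arbitrary: x)
  case (Suc d)
  from Suc.prems obtain b y where y: "y \<in> cantor_set" "x = third b y" by (rule third_cantor_cases)
  from Suc.IH[OF y(1)] obtain w z where "length w = d" "z \<in> cantor_set" "y = shrink w z" by blast
  with y show ?case by (intro exI[of _ "b # w"] exI[of _ z]) auto
qed simp

abbreviation cantor_square :: "(real \<times> real) set" where
  "cantor_square \<equiv> cantor_set \<times> cantor_set"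

abbreviation full_square :: "(real \<times> real) set" where
  "full_square \<equiv> {0..1} \<times> {0..1}"

fun place :: "nat \<times> cell \<Rightarrow> real \<times> real \<Rightarrow> real \<times> real" where
  "place (i, xs, ys) (x, y) = (2 * real i + shrink xs x, shrink ys y)"

definition rect :: "nat \<times> cell \<Rightarrow> (real \<times> real) set" where
  "rect a = place a ` full_square"

text \<open>
  The part of the Cantor squares inside \<open>rect a\<close> (\<open>cantor_squares_rect\<close>).
\<close>

definition cell_points :: "nat \<times> cell \<Rightarrow> (real \<times> real) set" where
  "cell_points a = place a ` cantor_square"

definition sends :: "(real \<times> real \<Rightarrow> real \<times> real) \<Rightarrow> nat \<times> cell \<Rightarrow> nat \<times> cell \<Rightarrow> bool" where
  "sends f a b \<longleftrightarrow> (\<forall>p\<in>cantor_square. f (place a p) = place b p)"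

lemma cantor_square_full: "p \<in> cantor_square \<Longrightarrow> p \<in> full_square"
  using cantor_set_unit by auto

lemma shrink_image: "shrink w ` {0..1} = {shrink w 0..shrink w 1}"
proof
  show "shrink w ` {0..1} \<subseteq> {shrink w 0..shrink w 1}"
  proof
    fix y assume "y \<in> shrink w ` {0..1}"
    then obtain x where x: "0 \<le> x" "x \<le> 1" "y = shrink w x" by auto
    then show "y \<in> {shrink w 0..shrink w 1}"
      using shrink_affine[of w x] shrink_affine[of w 1] by (auto simp: divide_right_mono)
  qed
  show "{shrink w 0..shrink w 1} \<subseteq> shrink w ` {0..1}"
  proof
    fix y assume y: "y \<in> {shrink w 0..shrink w 1}"
    let ?x = "(y - shrink w 0) * 3 ^ length w"
    have "y = shrink w ?x" using shrink_affine[of w ?x] by simp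
    moreover have "?x \<in> {0..1}"
      using y shrink_affine[of w 1] by (auto simp: field_simps)
    ultimately show "y \<in> shrink w ` {0..1}" by blast
  qed
qed

lemma shrink_0_less_1: "shrink w 0 < shrink w 1"
  using shrink_affine[of w 1] by simp

lemma rect_eq:
  "rect (i, xs, ys) =
   {2 * real i + shrink xs 0 .. 2 * real i + shrink xs 1} \<times> {shrink ys 0..shrink ys 1}"
proof -
  have "rect (i, xs, ys) = ((+) (2 * real i) ` shrink xs ` {0..1}) \<times> (shrink ys ` {0..1})"
  proof (intro equalityI subsetI)
    fix z assume "z \<in> rect (i, xs, ys)"
    then show "z \<in> ((+) (2 * real i) ` shrink xs ` {0..1}) \<times> (shrink ys ` {0..1})"
      by (auto simp: rect_def)
  next
    fix z assume "z \<in> ((+) (2 * real i) ` shrink xs ` {0..1}) \<times> (shrink ys ` {0..1})"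
    then obtain x y where "x \<in> {0..1}" "y \<in> {0..1}" "z = place (i, xs, ys) (x, y)"
      by auto
    then show "z \<in> rect (i, xs, ys)" unfolding rect_def by blast
  qed
  then show ?thesis by (simp add: shrink_image add.commute)
qed

lemma rect_whole: "rect (i, whole) = unit_square i"
  by (simp add: rect_eq unit_square_def)

lemma place_eq:
  assumes "place (i, r) p = place (j, s) q" "p \<in> full_square" "q \<in> full_square"
  shows "i = j \<and> meets r s"
proof -
  obtain xs ys us vs where rs: "r = (xs, ys)" "s = (us, vs)" by (cases r; cases s)
  obtain x y u v where pq: "p = (x, y)" "q = (u, v)" by (cases p; cases q)
  have xu: "x \<in> {0..1}" "u \<in> {0..1}" "y \<in> {0..1}" "v \<in> {0..1}" using assms pq by auto
  have e: "2 * real i + shrink xs x = 2 * real j + shrink us u" "shrink ys y = shrink vs v"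
    using assms rs pq by auto
  have "i = j" using e(1) shrink_unit[OF xu(1), of xs] shrink_unit[OF xu(2), of us] by auto
  with e show ?thesis
    using shrink_eq_prefix[OF xu(1,2), of xs us] shrink_eq_prefix[OF xu(3,4), of ys vs] rs by auto
qed

lemma place_inj: "place a p = place a q \<Longrightarrow> p = q"
  by (cases a; cases p; cases q) (auto dest: shrink_inj)

lemma place_append:
  "place (i, us @ xs, vs @ ys) (x, y) = place (i, us, vs) (shrink xs x, shrink ys y)"
  by (simp add: shrink_append)

lemma cantor_squares_eq: "cantor_squares = (\<Union>i. cell_points (i, whole))"
  by (auto simp: cantor_squares_def cell_points_def image_iff)

lemma cell_points_subset: "cell_points a \<subseteq> cantor_squares"
proof
  fix z assume "z \<in> cell_points a"
  then obtain p where p: "p \<in> cantor_square" "z = place a p" by (auto simp: cell_points_def)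
  obtain i xs ys x y where "a = (i, xs, ys)" "p = (x, y)" by (cases a; cases p)
  with p have "z = place (i, whole) (shrink xs x, shrink ys y)"
    "(shrink xs x, shrink ys y) \<in> cantor_square" by (auto simp: shrink_cantor)
  then show "z \<in> cantor_squares" unfolding cantor_squares_eq cell_points_def by blast
qed

lemma place_in: "p \<in> cantor_square \<Longrightarrow> place a p \<in> cantor_squares"
  using cell_points_subset unfolding cell_points_def by blast

text \<open>
  A point of the Cantor squares in the rectangle with address \<open>w\<close> has the form
  \<open>shrink w x\<close> in each coordinate with \<open>x\<close> in the unit interval; since it
  lies in the Cantor set, so does \<open>x\<close>.
\<close>

lemma cantor_squares_rect: "cantor_squares \<inter> rect a = cell_points a"
proof
  show "cell_points a \<subseteq> cantor_squares \<inter> rect a"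
  proof -
    have "cantor_square \<subseteq> full_square" using cantor_square_full by blast
    then have "cell_points a \<subseteq> rect a" unfolding cell_points_def rect_def by (rule image_mono)
    then show ?thesis using cell_points_subset by blast
  qed
  show "cantor_squares \<inter> rect a \<subseteq> cell_points a"
  proof
    fix z assume z: "z \<in> cantor_squares \<inter> rect a"
    obtain i xs ys where a: "a = (i, xs, ys)" by (cases a)
    from z obtain j p where p: "p \<in> cantor_square" "z = place (j, whole) p"
      by (auto simp: cantor_squares_eq cell_points_def)
    from z obtain q where q: "q \<in> full_square" "z = place a q" by (auto simp: rect_def)
    have "j = i" using place_eq[of j whole p i "(xs, ys)" q] p q a cantor_square_full by auto
    with p q a have "q \<in> cantor_square"
      by (cases p; cases q) (auto simp: shrink_cantor_iff)
    with q show "z \<in> cell_points a" by (auto simp: cell_points_def)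
  qed
qed

lemma cell_points_disjoint:
  "z \<in> cell_points (i, r) \<Longrightarrow> z \<in> cell_points (j, s) \<Longrightarrow> i = j \<and> meets r s"
proof -
  assume "z \<in> cell_points (i, r)" "z \<in> cell_points (j, s)"
  then obtain p q where "p \<in> cantor_square" "q \<in> cantor_square" "place (i, r) p = place (j, s) q"
    unfolding cell_points_def by blast
  then show ?thesis using cantor_square_full by (intro place_eq) auto
qed

lemma meets_cell_points:
  assumes "meets r s" shows "\<exists>z. z \<in> cell_points (i, r) \<and> z \<in> cell_points (i, s)"
proof -
  have *: "\<exists>x\<in>cantor_set. \<exists>u\<in>cantor_set. shrink xs x = shrink us u"
    if "prefix xs us \<or> prefix us xs" for xs us
    using that
  proof
    assume "prefix xs us"
    then obtain ws where ws: "us = xs @ ws" by (rule prefixE)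
    have "shrink ws 0 \<in> cantor_set" "shrink xs (shrink ws 0) = shrink us 0"
      using cantor_set_ends(1) shrink_cantor by (simp_all add: ws shrink_append)
    then show ?thesis using cantor_set_ends(1) by blast
  next
    assume "prefix us xs"
    then obtain ws where ws: "xs = us @ ws" by (rule prefixE)
    have "shrink ws 0 \<in> cantor_set" "shrink xs 0 = shrink us (shrink ws 0)"
      using cantor_set_ends(1) shrink_cantor by (simp_all add: ws shrink_append)
    then show ?thesis using cantor_set_ends(1) by blast
  qed
  obtain xs ys us vs where rs: "r = (xs, ys)" "s = (us, vs)" by (cases r; cases s)
  with assms *[of xs us] *[of ys vs] obtain x u y v where
    "x \<in> cantor_set" "u \<in> cantor_set" "y \<in> cantor_set" "v \<in> cantor_set"
    "shrink xs x = shrink us u" "shrink ys y = shrink vs v" by auto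
  then have "place (i, r) (x, y) = place (i, s) (u, v)" "(x, y) \<in> cantor_square" "(u, v) \<in> cantor_square"
    by (auto simp: rs)
  then show ?thesis unfolding cell_points_def by blast
qed

lemma cantor_squares_grid:
  assumes "z \<in> cantor_squares"
  obtains i r p where "r \<in> grid d" "p \<in> cantor_square" "z = place (i, r) p"
proof -
  from assms obtain i x y where xy: "x \<in> cantor_set" "y \<in> cantor_set" "z = (2 * real i + x, y)"
    by (auto simp: cantor_squares_def)
  obtain xs x' ys y' where "length xs = d" "x' \<in> cantor_set" "x = shrink xs x'"
    "length ys = d" "y' \<in> cantor_set" "y = shrink ys y'"
    using cantor_set_shrink[OF xy(1), of d] cantor_set_shrink[OF xy(2), of d] by blast
  with xy that[of "(xs, ys)" "(x', y')" i] show thesis by (auto simp: grid_def)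
qed

lemma rect_inj: "rect a = rect b \<Longrightarrow> a = b"
proof -
  assume ab: "rect a = rect b"
  obtain i xs ys j us vs where a: "a = (i, xs, ys)" and b: "b = (j, us, vs)"
    by (cases a; cases b) auto
  have "{2 * real i + shrink xs 0 .. 2 * real i + shrink xs 1} =
      {2 * real j + shrink us 0 .. 2 * real j + shrink us 1}"
    "{shrink ys 0..shrink ys 1} = {shrink vs 0..shrink vs 1}"
    using ab shrink_0_less_1[of xs] shrink_0_less_1[of ys] unfolding a b rect_eq
    by (auto simp: times_eq_iff)
  then have e: "2 * real i + shrink xs 0 = 2 * real j + shrink us 0"
    "2 * real i + shrink xs 1 = 2 * real j + shrink us 1"
    "shrink ys 0 = shrink vs 0" "shrink ys 1 = shrink vs 1"
    using shrink_0_less_1[of xs] shrink_0_less_1[of ys] by (auto simp: Icc_eq_Icc)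
  have len: "length w = length u" if "shrink w 1 - shrink w 0 = shrink u 1 - shrink u 0" for w u
    using that shrink_affine[of w 1] shrink_affine[of u 1] by (simp add: power_inject_exp')
  have ij: "i = j \<and> meets (xs, ys) (us, vs)"
    using e by (intro place_eq[of i _ "(0, 0)" j _ "(0, 0)"]) auto
  have "length xs = length us" "length ys = length vs"
    using len[of xs us] len[of ys vs] e by auto
  with ij show "a = b" unfolding a b by (auto dest: prefix_length_eq)
qed

lemma sends_extend:
  assumes "sends f (i, us, vs) (j, us', vs')"
  shows "sends f (i, us @ xs, vs @ ys) (j, us' @ xs, vs' @ ys)"
  using assms unfolding sends_def by (auto simp del: place.simps simp: place_append shrink_cantor)

lemma sends_child: "sends f (i, r) (j, s) \<Longrightarrow> sends f (i, child c b r) (j, child c b s)"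
  using sends_extend[of f i "fst r" "snd r" j "fst s" "snd s" "[b]" "[]"]
    sends_extend[of f i "fst r" "snd r" j "fst s" "snd s" "[]" "[b]"]
  by (cases r; cases s; cases c) auto

lemma sends_inside:
  assumes "sends f (i, s) b" "inside r s" obtains b' where "sends f (i, r) b'"
proof -
  obtain us vs where s: "s = (us, vs)" by (cases s)
  obtain j us' vs' where b: "b = (j, us', vs')" by (cases b)
  from assms(2) obtain xs ys where r: "r = (us @ xs, vs @ ys)"
    unfolding s by (cases r) (auto elim!: prefixE)
  show thesis using sends_extend assms(1) that unfolding s b r by blast
qed

lemma sends_unique:
  assumes "sends f a b" "sends f a b'" shows "b = b'"
proof -
  have e: "place b p = place b' p" if "p \<in> cantor_square" for p using assms that unfolding sends_def by metis
  obtain i xs ys j us vs where b: "b = (i, xs, ys)" "b' = (j, us, vs)" by (cases b; cases b') auto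
  have "place b (0, 0) = place b' (0, 0)" "place b (1, 1) = place b' (1, 1)"
    using e cantor_set_ends by auto
  moreover have "i = j \<and> meets (xs, ys) (us, vs)"
    using calculation(1) unfolding b by (rule place_eq) auto
  ultimately have "rect b = rect b'" unfolding b by (auto simp: rect_eq)
  then show ?thesis by (rule rect_inj)
qed

section \<open>Numberings and patterns\<close>

lemma meets_whole [simp]: "meets r whole" "meets whole r"
  by (cases r; simp)+

lemma sendsD: "sends f a b \<Longrightarrow> p \<in> cantor_square \<Longrightarrow> f (place a p) = place b p"
  unfolding sends_def by (rule bspec)

lemma sendsI: "(\<And>p. p \<in> cantor_square \<Longrightarrow> f (place a p) = place b p) \<Longrightarrow> sends f a b"
  unfolding sends_def by (rule ballI)

lemma inside_cell_points: "inside s r \<Longrightarrow> cell_points (i, s) \<subseteq> cell_points (i, r)"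
proof
  fix z assume sr: "inside s r" and z: "z \<in> cell_points (i, s)"
  obtain us vs where r: "r = (us, vs)" by (cases r)
  from sr obtain xs ys where s: "s = (us @ xs, vs @ ys)"
    unfolding r by (cases s) (auto elim!: prefixE)
  from z obtain x y where xy: "x \<in> cantor_set" "y \<in> cantor_set" "z = place (i, s) (x, y)"
    by (auto simp: cell_points_def simp del: place.simps)
  have "z = place (i, r) (shrink xs x, shrink ys y)"
    unfolding xy(3) s r by (rule place_append)
  moreover have "(shrink xs x, shrink ys y) \<in> cantor_square" using xy by (simp add: shrink_cantor)
  ultimately show "z \<in> cell_points (i, r)" unfolding cell_points_def by blast
qed

lemma meets_inside: 
  "meets (xs, ys) (us, vs) \<Longrightarrow> length us \<le> length xs \<Longrightarrow> length vs \<le> length ys \<Longrightarrow>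
   inside (xs, ys) (us, vs)"
proof -
  have "prefix us xs" if "prefix xs us \<or> prefix us xs" "length us \<le> length xs" for xs us :: "bool list"
    using that prefix_length_eq[of xs us] prefix_length_le[of xs us] by auto
  from this[of xs us] this[of ys vs]
  show "meets (xs, ys) (us, vs) \<Longrightarrow> length us \<le> length xs \<Longrightarrow> length vs \<le> length ys \<Longrightarrow>
   inside (xs, ys) (us, vs)" by simp
qed

lemma partition_cells_points:
  assumes D: "partition_cells D" and z: "z \<in> cell_points (i, whole)"
  shows "\<exists>r\<in>D. z \<in> cell_points (i, r)"
proof -
  obtain d where d: "\<And>xs ys. (xs, ys) \<in> D \<Longrightarrow> length xs \<le> d \<and> length ys \<le> d"
    using bounded_lengths[OF partition_cells_finite[OF D]] by blast
  have "z \<in> cantor_squares" using z cell_points_subset by blast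
  then obtain j s p where s: "s \<in> grid d" "p \<in> cantor_square" "z = place (j, s) p"
    by (rule cantor_squares_grid)
  then have zs: "z \<in> cell_points (j, s)" by (simp add: cell_points_def)
  then have "j = i" using z cell_points_disjoint by blast
  obtain r where "r \<in> D" "inside s r" using grid_refines[OF D d] s by (auto simp: refines_def)
  then show ?thesis using zs inside_cell_points \<open>j = i\<close> by blast
qed

text \<open>
  The addresses of the rectangles of a numbered pattern. The last condition says that from some
  point on the squares are undivided and numbered in order.
\<close>

definition numbering :: "(nat \<Rightarrow> nat \<times> cell) \<Rightarrow> bool" where
  "numbering p \<longleftrightarrow>
     (\<forall>m n. fst (p m) = fst (p n) \<and> meets (snd (p m)) (snd (p n)) \<longrightarrow> m = n) \<and>
     (\<forall>z\<in>cantor_squares. \<exists>n. z \<in> cell_points (p n)) \<and>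
     (\<exists>K M. \<forall>j. p (K + j) = (M + j, whole))"

lemma numbering_unique:
  assumes "numbering p" "z \<in> cell_points (p m)" "z \<in> cell_points (p n)" shows "m = n"
  using assms cell_points_disjoint[of z "fst (p m)" "snd (p m)" "fst (p n)" "snd (p n)"]
  by (simp add: numbering_def)

lemma numbering_cover:
  assumes "numbering p" "z \<in> cantor_squares"
  obtains n u where "u \<in> cantor_square" "z = place (p n) u"
  using assms unfolding numbering_def cell_points_def by (metis imageE)

lemma numbering_tail:
  assumes "numbering p" obtains K M where "\<forall>j. p (K + j) = (M + j, whole)"
proof -
  from assms obtain K M where "\<forall>j. p (K + j) = (M + j, whole)" unfolding numbering_def by blast
  then show thesis by (rule that)
qed

text \<open>
  Compare the lower left and upper right corners of the two images. This is why a pattern map is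
  unique among all maps of the required form.
\<close>

lemma affine_image_unique:
  fixes a b a' b' \<alpha> \<beta> \<alpha>' \<beta>' :: real
  assumes im: "(\<lambda>(x, y). (a + \<alpha> * x, b + \<beta> * y)) ` cantor_square =
      (\<lambda>(x, y). (a' + \<alpha>' * x, b' + \<beta>' * y)) ` cantor_square"
    and pos: "\<alpha> > 0" "\<beta> > 0" "\<alpha>' > 0" "\<beta>' > 0"
  shows "a = a' \<and> \<alpha> = \<alpha>' \<and> b = b' \<and> \<beta> = \<beta>'"
proof -
  have half: "a' \<le> a \<and> b' \<le> b \<and> a + \<alpha> \<le> a' + \<alpha>' \<and> b + \<beta> \<le> b' + \<beta>'"
    if im: "(\<lambda>(x, y). (a + \<alpha> * x, b + \<beta> * y)) ` cantor_square \<subseteq>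
      (\<lambda>(x, y). (a' + \<alpha>' * x, b' + \<beta>' * y)) ` cantor_square" and pos: "\<alpha>' > 0" "\<beta>' > 0"
    for a b a' b' \<alpha> \<beta> \<alpha>' \<beta>' :: real
  proof -
    have "(\<lambda>(x, y). (a + \<alpha> * x, b + \<beta> * y)) (0, 0) \<in> (\<lambda>(x, y). (a' + \<alpha>' * x, b' + \<beta>' * y)) ` cantor_square"
      using im cantor_set_ends by blast
    then obtain x y where xy: "(x, y) \<in> cantor_square" "a = a' + \<alpha>' * x" "b = b' + \<beta>' * y" by auto
    have "(\<lambda>(x, y). (a + \<alpha> * x, b + \<beta> * y)) (1, 1) \<in> (\<lambda>(x, y). (a' + \<alpha>' * x, b' + \<beta>' * y)) ` cantor_square"
      using im cantor_set_ends by blast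
    then obtain u v where uv: "(u, v) \<in> cantor_square" "a + \<alpha> = a' + \<alpha>' * u" "b + \<beta> = b' + \<beta>' * v"
      by auto
    have "0 \<le> x" "0 \<le> y" "u \<le> 1" "v \<le> 1"
      using xy(1) uv(1) cantor_square_full by auto
    then have "0 \<le> \<alpha>' * x" "0 \<le> \<beta>' * y" "\<alpha>' * u \<le> \<alpha>'" "\<beta>' * v \<le> \<beta>'"
      using pos by (simp_all add: mult_left_le)
    then show ?thesis using xy uv by linarith
  qed
  show ?thesis
    using half[OF equalityD1[OF im] pos(3,4)] half[OF equalityD2[OF im] pos(1,2)] by linarith
qed

lemma place_affine:
  "place (i, xs, ys) (x, y) =
   ((2 * real i + shrink xs 0) + (1 / 3 ^ length xs) * x, shrink ys 0 + (1 / 3 ^ length ys) * y)"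
  using shrink_affine[of xs x] shrink_affine[of ys y] by simp

lemma sends_image: "sends f a b \<Longrightarrow> f ` cell_points a = cell_points b"
  unfolding sends_def cell_points_def image_image by (rule image_cong) (rule refl, erule bspec)

text \<open>
  The description by \<^const>\<open>sends\<close> pins down the map chosen by the definite
  description in \<^const>\<open>pattern_map\<close>.
\<close>

lemma pattern_map_eq:
  assumes ext: "f \<in> extensional cantor_squares"
    and f: "\<And>n. sends f (q n) (p n)"
    and cover: "\<And>z. z \<in> cantor_squares \<Longrightarrow> \<exists>n. z \<in> cell_points (q n)"
  shows "pattern_map (\<lambda>n. rect (p n)) (\<lambda>n. rect (q n)) = f"
  unfolding pattern_map_def cantor_squares_rect
proof (rule the_equality, intro conjI allI)
  show "f \<in> extensional cantor_squares" by (rule ext)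
  fix n
  show "f ` cell_points (q n) = cell_points (p n)" using f by (rule sends_image)
  obtain i xs ys i' us vs where q: "q n = (i, xs, ys)" and p: "p n = (i', us, vs)"
    by (cases "q n"; cases "p n") auto
  define j where "j = int (length xs) - int (length us)"
  define k where "k = int (length ys) - int (length vs)"
  have jk: "3 powi j = (3::real) ^ length xs / 3 ^ length us" "3 powi k = (3::real) ^ length ys / 3 ^ length vs"
    by (simp_all add: j_def k_def power_int_diff)
  show "\<exists>a b j k. \<forall>(x, y)\<in>cell_points (q n). f (x, y) = (a + 3 powi j * x, b + 3 powi k * y)"
  proof (intro exI ballI)
    fix z assume "z \<in> cell_points (q n)"
    then obtain x y where xy: "(x, y) \<in> cantor_square" "z = place (q n) (x, y)"
      by (auto simp: cell_points_def simp del: place.simps)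
    then have fz: "f z = place (p n) (x, y)" using sendsD[OF f] by simp
    show "case z of (x, y) \<Rightarrow> f (x, y) =
      ((2 * real i' + shrink us 0 - 3 powi j * (2 * real i + shrink xs 0)) + 3 powi j * x,
       (shrink vs 0 - 3 powi k * shrink ys 0) + 3 powi k * y)"
      using fz unfolding xy(2) q p place_affine prod.case
      by (simp add: jk field_simps)
  qed
next
  fix g assume g: "g \<in> extensional cantor_squares \<and>
    (\<forall>n. g ` cell_points (q n) = cell_points (p n) \<and>
      (\<exists>a b j k. \<forall>(x, y)\<in>cell_points (q n). g (x, y) = (a + 3 powi j * x, b + 3 powi k * y)))"
  show "g = f"
  proof (rule extensionalityI)
    show "g \<in> extensional cantor_squares" "f \<in> extensional cantor_squares" using g ext by auto
    fix z assume "z \<in> cantor_squares"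
    then obtain n w where w: "w \<in> cantor_square" "z = place (q n) w"
      using cover unfolding cell_points_def by blast
    obtain i xs ys i' us vs where q: "q n = (i, xs, ys)" and p: "p n = (i', us, vs)"
      by (cases "q n"; cases "p n") auto
    from g have "\<exists>a b j k. \<forall>(x, y)\<in>cell_points (q n). g (x, y) = (a + 3 powi j * x, b + 3 powi k * y)"
      by blast
    then obtain a b and j k :: int where
      "\<forall>(x, y)\<in>cell_points (q n). g (x, y) = (a + 3 powi j * x, b + 3 powi k * y)"
      by (elim exE)
    then have gab: "g (x, y) = (a + 3 powi j * x, b + 3 powi k * y)" if "(x, y) \<in> cell_points (q n)" for x y
      using that by blast
    define A where "A = a + 3 powi j * (2 * real i + shrink xs 0)"
    define B where "B = b + 3 powi k * shrink ys 0"
    define \<alpha> where "\<alpha> = 3 powi j * (1 / (3::real) ^ length xs)"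
    define \<beta> where "\<beta> = 3 powi k * (1 / (3::real) ^ length ys)"
    have gp: "g (place (q n) (x, y)) = (A + \<alpha> * x, B + \<beta> * y)" if "(x, y) \<in> cantor_square" for x y
    proof -
      have "place (q n) (x, y) \<in> cell_points (q n)" using that by (simp add: cell_points_def)
      then show ?thesis
        using gab unfolding q place_affine A_def B_def \<alpha>_def \<beta>_def by (simp add: algebra_simps)
    qed
    have "(\<lambda>(x, y). (A + \<alpha> * x, B + \<beta> * y)) ` cantor_square = g ` place (q n) ` cantor_square"
      unfolding image_image using gp by (intro image_cong) auto
    also have "\<dots> = cell_points (p n)" using g by (simp add: cell_points_def)
    also have "\<dots> = (\<lambda>(x, y). ((2 * real i' + shrink us 0) + (1 / 3 ^ length us) * x,
        shrink vs 0 + (1 / 3 ^ length vs) * y)) ` cantor_square"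
      unfolding cell_points_def p by (intro image_cong) (auto simp: place_affine simp del: place.simps)
    finally have "A = 2 * real i' + shrink us 0 \<and> \<alpha> = 1 / 3 ^ length us \<and>
        B = shrink vs 0 \<and> \<beta> = 1 / 3 ^ length vs"
      by (rule affine_image_unique) (simp_all add: \<alpha>_def \<beta>_def)
    then have "g z = place (p n) w"
      using gp w unfolding w(2) p by (cases w) (simp add: place_affine del: place.simps)
    also have "\<dots> = f z" using sendsD[OF f w(1)] w(2) by simp
    finally show "g z = f z" .
  qed
qed

text \<open>
  A point lies in exactly one cell of \<open>q\<close>, and its image is the point with the same
  relative position in the corresponding cell of \<open>p\<close>.
\<close>

lemma numbering_map_exists:
  assumes p: "numbering p" and q: "numbering q"
  shows "\<exists>f\<in>Bij cantor_squares. \<forall>n. sends f (q n) (p n)"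
proof -
  define f where "f = (\<lambda>z\<in>cantor_squares.
    (THE w. \<exists>n u. u \<in> cantor_square \<and> z = place (q n) u \<and> w = place (p n) u))"
  have same: "n = n' \<and> u = u'"
    if "numbering r" "place (r n) u = place (r n') u'" "u \<in> cantor_square" "u' \<in> cantor_square" for r n n' u u'
  proof -
    have "n = n'"
      using that numbering_unique[OF that(1), of "place (r n) u" n n'] unfolding cell_points_def by blast
    then show ?thesis using that place_inj by blast
  qed
  have f: "f (place (q n) u) = place (p n) u" if "u \<in> cantor_square" for n u
  proof -
    have "(THE w. \<exists>n' u'. u' \<in> cantor_square \<and> place (q n) u = place (q n') u' \<and> w = place (p n') u') = place (p n) u"
    proof (rule the_equality)
      show "\<exists>n' u'. u' \<in> cantor_square \<and> place (q n) u = place (q n') u' \<and> place (p n) u = place (p n') u'"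
        using that by blast
      fix w assume "\<exists>n' u'. u' \<in> cantor_square \<and> place (q n) u = place (q n') u' \<and> w = place (p n') u'"
      then show "w = place (p n) u" using same[OF q] that by blast
    qed
    then show ?thesis using place_in[OF that] by (simp add: f_def)
  qed
  have "bij_betw f cantor_squares cantor_squares"
    unfolding bij_betw_def
  proof
    show "inj_on f cantor_squares"
    proof (rule inj_onI)
      fix z z' assume z: "z \<in> cantor_squares" "z' \<in> cantor_squares" "f z = f z'"
      obtain n u where u: "u \<in> cantor_square" "z = place (q n) u" using q z(1) by (rule numbering_cover)
      obtain n' u' where u': "u' \<in> cantor_square" "z' = place (q n') u'" using q z(2) by (rule numbering_cover)
      have "place (p n) u = place (p n') u'" using z(3) u u' f by simp
      then have "n = n' \<and> u = u'" using same[OF p] u u' by blast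
      then show "z = z'" using u u' by simp
    qed
    show "f ` cantor_squares = cantor_squares"
    proof (intro equalityI subsetI)
      fix z assume "z \<in> f ` cantor_squares"
      then obtain y where y: "y \<in> cantor_squares" "z = f y" by blast
      obtain n u where u: "u \<in> cantor_square" "y = place (q n) u" using q y(1) by (rule numbering_cover)
      then show "z \<in> cantor_squares" using y f place_in by simp
    next
      fix z assume "z \<in> cantor_squares"
      with p obtain n u where "u \<in> cantor_square" "z = place (p n) u" by (rule numbering_cover)
      then have "z = f (place (q n) u)" "place (q n) u \<in> cantor_squares" using f place_in by simp_all
      then show "z \<in> f ` cantor_squares" by blast
    qed
  qed
  then have "f \<in> Bij cantor_squares" by (simp add: Bij_def f_def)
  moreover have "sends f (q n) (p n)" for n using f by (rule sendsI)
  ultimately show ?thesis by blast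
qed

text \<open>
  The sets of addresses of patterns: a partition in each square, and only finitely many squares are
  divided.
\<close>

definition pattern_cells :: "(nat \<times> cell) set \<Rightarrow> bool" where
  "pattern_cells A \<longleftrightarrow>
     (\<forall>i. partition_cells {r. (i, r) \<in> A}) \<and> (\<exists>M. \<forall>i\<ge>M. {r. (i, r) \<in> A} = {whole})"

definition cut_at :: "bool \<Rightarrow> nat \<Rightarrow> cell \<Rightarrow> (nat \<times> cell) set \<Rightarrow> (nat \<times> cell) set" where
  "cut_at c i r A = (A - {(i, r)}) \<union> {(i, child c False r), (i, child c True r)}"

lemma shrink_snoc:
  "shrink (w @ [False]) 0 = shrink w 0"
  "shrink (w @ [False]) 1 = shrink w 0 + (shrink w 1 - shrink w 0) / 3"
  "shrink (w @ [True]) 0 = shrink w 1 - (shrink w 1 - shrink w 0) / 3"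
  "shrink (w @ [True]) 1 = shrink w 1"
proof -
  have "shrink w x = shrink w 0 + x * (shrink w 1 - shrink w 0)" for x
    using shrink_affine[of w x] shrink_affine[of w 1] by simp
  from this[of "1/3"] this[of "2/3"] show
    "shrink (w @ [False]) 0 = shrink w 0"
    "shrink (w @ [False]) 1 = shrink w 0 + (shrink w 1 - shrink w 0) / 3"
    "shrink (w @ [True]) 0 = shrink w 1 - (shrink w 1 - shrink w 0) / 3"
    "shrink (w @ [True]) 1 = shrink w 1"
    by (simp_all add: shrink_append third_def diff_divide_distrib)
qed

lemma rect_cut_at:
  assumes "(i, xs, ys) \<in> A"
  defines "a \<equiv> 2 * real i + shrink xs 0" and "b \<equiv> 2 * real i + shrink xs 1"
    and "s \<equiv> shrink ys 0" and "t \<equiv> shrink ys 1"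
  shows "rect ` cut_at False i (xs, ys) A = (rect ` A - {{a..b} \<times> {s..t}}) \<union>
        {{a .. a + (b - a) / 3} \<times> {s..t}, {b - (b - a) / 3 .. b} \<times> {s..t}}"
    and "rect ` cut_at True i (xs, ys) A = (rect ` A - {{a..b} \<times> {s..t}}) \<union>
        {{a..b} \<times> {s .. s + (t - s) / 3}, {a..b} \<times> {t - (t - s) / 3 .. t}}"
proof -
  have inj: "inj rect" by (rule injI) (rule rect_inj)
  have r: "rect (i, xs, ys) = {a..b} \<times> {s..t}" by (simp add: rect_eq a_def b_def s_def t_def)
  have *: "rect ` (A - {(i, xs, ys)}) = rect ` A - {{a..b} \<times> {s..t}}"
    unfolding image_set_diff[OF inj] using r by simp
  show "rect ` cut_at False i (xs, ys) A = (rect ` A - {{a..b} \<times> {s..t}}) \<union>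
        {{a .. a + (b - a) / 3} \<times> {s..t}, {b - (b - a) / 3 .. b} \<times> {s..t}}"
    unfolding cut_at_def image_Un * image_insert image_empty child.simps rect_eq shrink_snoc
    by (simp add: a_def b_def s_def t_def add_diff_eq add.assoc)
  show "rect ` cut_at True i (xs, ys) A = (rect ` A - {{a..b} \<times> {s..t}}) \<union>
        {{a..b} \<times> {s .. s + (t - s) / 3}, {a..b} \<times> {t - (t - s) / 3 .. t}}"
    unfolding cut_at_def image_Un * image_insert image_empty child.simps rect_eq shrink_snoc
    by (simp add: a_def b_def s_def t_def)
qed

lemma simple_increment_cut_at:
  assumes "(i, r) \<in> A" shows "simple_increment (rect ` A) (rect ` cut_at c i r A)"
proof -
  obtain xs ys where r: "r = (xs, ys)" by (cases r)
  have m: "{2 * real i + shrink xs 0 .. 2 * real i + shrink xs 1} \<times> {shrink ys 0..shrink ys 1} \<in> rect ` A"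
    using assms unfolding r rect_eq[symmetric] by (rule imageI)
  have lt: "2 * real i + shrink xs 0 < 2 * real i + shrink xs 1" "shrink ys 0 < shrink ys 1"
    using shrink_0_less_1 by auto
  show ?thesis
    using simple_increment.vertical[OF lt m] simple_increment.horizontal[OF lt m]
      rect_cut_at[of i xs ys A] assms unfolding r by (cases c) simp_all
qed

lemma simple_increment_is_cut_at:
  assumes "simple_increment (rect ` A) P"
  obtains c i r where "(i, r) \<in> A" "P = rect ` cut_at c i r A"
proof -
  have corners: "\<exists>i xs ys. (i, xs, ys) \<in> A \<and> a = 2 * real i + shrink xs 0 \<and> b = 2 * real i + shrink xs 1 \<and>
      c = shrink ys 0 \<and> d = shrink ys 1"
    if "a < b" "c < d" "{a..b} \<times> {c..d} \<in> rect ` A" for a b c d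
  proof -
    from that(3) obtain i xs ys where x: "(i, xs, ys) \<in> A" "{a..b} \<times> {c..d} = rect (i, xs, ys)" by auto
    have "{a..b} = {2 * real i + shrink xs 0 .. 2 * real i + shrink xs 1}"
      "{c..d} = {shrink ys 0..shrink ys 1}"
      using x(2) that(1,2) shrink_0_less_1[of xs] shrink_0_less_1[of ys] unfolding rect_eq
      by (auto simp: times_eq_iff)
    then show ?thesis using x(1) that(1,2) by (auto simp: Icc_eq_Icc)
  qed
  from assms show thesis
  proof cases
    case (vertical a b c d)
    then obtain i xs ys where x: "(i, xs, ys) \<in> A" "a = 2 * real i + shrink xs 0"
      "b = 2 * real i + shrink xs 1" "c = shrink ys 0" "d = shrink ys 1" using corners by blast
    show thesis using that[OF x(1), of False] rect_cut_at(1)[OF x(1)] vertical(1) unfolding x by simp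
  next
    case (horizontal a b c d)
    then obtain i xs ys where x: "(i, xs, ys) \<in> A" "a = 2 * real i + shrink xs 0"
      "b = 2 * real i + shrink xs 1" "c = shrink ys 0" "d = shrink ys 1" using corners by blast
    show thesis using that[OF x(1), of True] rect_cut_at(2)[OF x(1)] horizontal(1) unfolding x by simp
  qed
qed

lemma cut_at_slice:
  "{s. (j, s) \<in> cut_at c i r A} = (if j = i then cut_set c r {s. (i, s) \<in> A} else {s. (j, s) \<in> A})"
proof (cases "j = i")
  case True
  then show ?thesis unfolding cut_at_def cut_set_def by auto
next
  case False
  then show ?thesis unfolding cut_at_def by simp
qed

lemma pattern_cells_cut_at:
  assumes A: "pattern_cells A" and r: "(i, r) \<in> A" shows "pattern_cells (cut_at c i r A)"
proof -
  from A obtain M where M: "\<And>i. M \<le> i \<Longrightarrow> {r. (i, r) \<in> A} = {whole}"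
    unfolding pattern_cells_def by blast
  have "partition_cells {s. (j, s) \<in> cut_at c i r A}" for j
    unfolding cut_at_slice using A r by (simp add: pattern_cells_def partition_cells_cut)
  moreover have "{s. (j, s) \<in> cut_at c i r A} = {whole}" if "max M (Suc i) \<le> j" for j
    unfolding cut_at_slice using M[of j] that by simp
  ultimately show ?thesis unfolding pattern_cells_def by blast
qed

lemma trivial_pattern_rect: "trivial_pattern = rect ` (UNIV \<times> {whole})"
  unfolding trivial_pattern_def rect_whole[symmetric] by auto

lemma pattern_cells_trivial: "pattern_cells (UNIV \<times> {whole})"
  by (simp add: pattern_cells_def partition_cells_whole)

lemma is_pattern_imp_cells:
  assumes "is_pattern P" obtains A where "pattern_cells A" "P = rect ` A"
proof -
  have "\<exists>A. pattern_cells A \<and> P = rect ` A"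
    using assms unfolding is_pattern_def
  proof (induction rule: rtranclp_induct)
    case base
    then show ?case using trivial_pattern_rect pattern_cells_trivial by blast
  next
    case (step P Q)
    then obtain A where A: "pattern_cells A" "P = rect ` A" by blast
    with step(2) have "simple_increment (rect ` A) Q" by simp
    then obtain c i r where "(i, r) \<in> A" "Q = rect ` cut_at c i r A" by (rule simple_increment_is_cut_at)
    then show ?case using pattern_cells_cut_at[OF A(1)] by blast
  qed
  then show thesis using that by blast
qed

lemma cut_steps_increments:
  assumes "cut_step\<^sup>*\<^sup>* D D'" "\<And>r. (i, r) \<notin> B"
  shows "simple_increment\<^sup>*\<^sup>* (rect ` (B \<union> {i} \<times> D)) (rect ` (B \<union> {i} \<times> D'))"
  using assms(1)
proof (induction rule: rtranclp_induct)
  case (step D' D'')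
  from step(2) obtain r c where r: "r \<in> D'" "D'' = cut_set c r D'" by cases
  have "cut_at c i r (B \<union> {i} \<times> D') = B \<union> {i} \<times> D''"
    unfolding cut_at_def r(2) cut_set_def using assms(2) by auto
  then have "simple_increment (rect ` (B \<union> {i} \<times> D')) (rect ` (B \<union> {i} \<times> D''))"
    using simple_increment_cut_at[of i r "B \<union> {i} \<times> D'" c] r(1) by simp
  with step(3) show ?case by simp
qed simp

text \<open>
  The partition of each divided square is obtained from the undivided square by cuts, so the squares
  can be treated one after another.
\<close>

lemma pattern_cells_is_pattern:
  assumes A: "pattern_cells A" shows "is_pattern (rect ` A)"
proof -
  \<comment> \<open>the pattern in which the squares before \<open>m\<close> are already divided\<close>
  define B where "B m = {(i, r). if i < m then (i, r) \<in> A else r = whole}" for m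
  from A obtain M where M: "\<And>i. M \<le> i \<Longrightarrow> {r. (i, r) \<in> A} = {whole}"
    unfolding pattern_cells_def by blast
  have "is_pattern (rect ` B m)" for m
  proof (induction m)
    case 0
    have "B 0 = UNIV \<times> {whole}" by (auto simp: B_def)
    then show ?case by (simp add: is_pattern_def trivial_pattern_rect)
  next
    case (Suc m)
    define C where "C = {(i, r) \<in> B m. i \<noteq> m}"
    have D: "partition_cells {r. (m, r) \<in> A}" using A by (simp add: pattern_cells_def)
    have "cut_step\<^sup>*\<^sup>* {whole} {r. (m, r) \<in> A}"
      using D by (intro refines_imp_cut_steps partition_cells_whole) (auto simp: refines_def)
    then have "simple_increment\<^sup>*\<^sup>* (rect ` (C \<union> {m} \<times> {whole})) (rect ` (C \<union> {m} \<times> {r. (m, r) \<in> A}))"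
      by (rule cut_steps_increments) (simp add: C_def)
    moreover have "C \<union> {m} \<times> {whole} = B m" by (auto simp: C_def B_def)
    moreover have "C \<union> {m} \<times> {r. (m, r) \<in> A} = B (Suc m)"
      by (auto simp: C_def B_def less_Suc_eq split: if_splits)
    ultimately have "simple_increment\<^sup>*\<^sup>* (rect ` B m) (rect ` B (Suc m))" by (simp only:)
    with Suc show ?case unfolding is_pattern_def by (rule rtranclp_trans)
  qed
  moreover have "B M = A"
  proof (rule Set.set_eqI)
    fix z :: "nat \<times> cell"
    obtain i r where z: "z = (i, r)" by (cases z)
    show "z \<in> B M \<longleftrightarrow> z \<in> A"
    proof (cases "i < M")
      case False
      then have "(i, r) \<in> A \<longleftrightarrow> r = whole" using M[of i] by (metis leI mem_Collect_eq singletonD singletonI)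
      then show ?thesis using False by (simp add: z B_def)
    qed (simp add: z B_def)
  qed
  ultimately show ?thesis by metis
qed

lemma numbered_pattern_imp_numbering:
  assumes P: "numbered_pattern P"
  obtains p where "numbering p" "P = (\<lambda>n. rect (p n))"
proof -
  from P have inj: "inj P" and "is_pattern (range P)" by (auto simp: numbered_pattern_def)
  then obtain A where A: "pattern_cells A" "range P = rect ` A" by (auto elim: is_pattern_imp_cells)
  have "\<exists>a\<in>A. P n = rect a" for n using A(2) by blast
  then obtain p where p: "\<And>n. p n \<in> A" "\<And>n. P n = rect (p n)" by metis
  have surj: "\<exists>n. p n = a" if a: "a \<in> A" for a
  proof -
    from a A(2) obtain n where "P n = rect a" by (metis imageE imageI)
    then show ?thesis using p(2) rect_inj by metis
  qed
  from P obtain j k where jk: "\<And>i n. k < i \<Longrightarrow> P n \<subseteq> unit_square i \<longleftrightarrow> n = i + j"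
    unfolding numbered_pattern_def by blast
  from A obtain M where M: "\<And>i. M \<le> i \<Longrightarrow> {r. (i, r) \<in> A} = {whole}"
    unfolding pattern_cells_def by blast
  have "numbering p"
    unfolding numbering_def
  proof (intro conjI)
    show "\<forall>m n. fst (p m) = fst (p n) \<and> meets (snd (p m)) (snd (p n)) \<longrightarrow> m = n"
    proof (intro allI impI, elim conjE)
      fix m n assume mn: "fst (p m) = fst (p n)" "meets (snd (p m)) (snd (p n))"
      have part: "partition_cells {r. (fst (p n), r) \<in> A}" using A(1) by (simp add: pattern_cells_def)
      have "(fst (p n), snd (p m)) = p m" by (simp add: prod_eq_iff mn(1))
      then have "(fst (p n), snd (p m)) \<in> A" "(fst (p n), snd (p n)) \<in> A"
        using p(1)[of n] p(1)[of m] by simp_all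
      then have "snd (p m) = snd (p n)" using partition_cells_meets[OF part] mn by blast
      with mn have "p m = p n" by (simp add: prod_eq_iff)
      then show "m = n" using inj p(2) by (metis injD)
    qed
    show "\<forall>z\<in>cantor_squares. \<exists>n. z \<in> cell_points (p n)"
    proof
      fix z assume "z \<in> cantor_squares"
      then obtain i where "z \<in> cell_points (i, whole)" by (auto simp: cantor_squares_eq)
      moreover have "partition_cells {r. (i, r) \<in> A}" using A(1) by (simp add: pattern_cells_def)
      ultimately obtain r where r: "(i, r) \<in> A" "z \<in> cell_points (i, r)"
        using partition_cells_points[of "{r. (i, r) \<in> A}" z i] by auto
      obtain n where "p n = (i, r)" using surj[OF r(1)] by blast
      then show "\<exists>n. z \<in> cell_points (p n)" using r(2) by (intro exI[of _ n]) simp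
    qed
    \<comment> \<open>beyond both bounds a square is undivided, and the shift \<open>j\<close> determines its number\<close>
    have "p ((M + k + 1 + j) + t) = (M + k + 1 + t, whole)" for t
    proof -
      have "(M + k + 1 + t, whole) \<in> A" using M[of "M + k + 1 + t"] by auto
      then obtain n where n: "p n = (M + k + 1 + t, whole)" using surj by blast
      then have "P n \<subseteq> unit_square (M + k + 1 + t)" by (simp add: p(2) rect_whole)
      then have "n = M + k + 1 + t + j" using jk by simp
      then show ?thesis using n by (simp add: algebra_simps)
    qed
    then show "\<exists>K M. \<forall>j. p (K + j) = (M + j, whole)" by blast
  qed
  then show thesis using that p(2) by blast
qed

text \<open>
  The only arithmetic point is that the shift between numbers and squares must be a natural number:
  each of the first \<open>M\<close> squares contains one of the first \<open>K\<close> cells, so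
  that \<open>M\<close> is at most \<open>K\<close>.
\<close>

lemma numbering_imp_numbered_pattern:
  assumes p: "numbering p" shows "numbered_pattern (\<lambda>n. rect (p n))"
proof -
  obtain K M where "\<forall>j. p (K + j) = (M + j, whole)" using p by (rule numbering_tail)
  then have tail: "p (K + j) = (M + j, whole)" for j by blast
  have uniq: "m = n" if "fst (p m) = fst (p n)" "meets (snd (p m)) (snd (p n))" for m n
    using p that by (simp add: numbering_def)
  have cov: "\<exists>n. fst (p n) = i \<and> meets (snd (p n)) s" for i s
  proof -
    have "place (i, s) (0, 0) \<in> cell_points (i, s)"
      using cantor_set_ends by (simp add: cell_points_def del: place.simps)
    moreover obtain n where "place (i, s) (0, 0) \<in> cell_points (p n)"
      using calculation p cell_points_subset unfolding numbering_def by blast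
    ultimately show ?thesis
      using cell_points_disjoint[of "place (i, s) (0, 0)" "fst (p n)" "snd (p n)" i s]
      by (intro exI[of _ n]) (simp del: place.simps)
  qed
  have late: "p n = (M + (n - K), whole)" if "K \<le> n" for n using tail[of "n - K"] that by simp
  have "M \<le> K"
  proof -
    have "{..<M} \<subseteq> (\<lambda>n. fst (p n)) ` {..<K}"
    proof
      fix i assume i: "i \<in> {..<M}"
      obtain n where n: "fst (p n) = i" using cov by blast
      have "n < K" using late[of n] n i by (cases "K \<le> n") auto
      then show "i \<in> (\<lambda>n. fst (p n)) ` {..<K}" using n by blast
    qed
    then show ?thesis using surj_card_le[of "{..<K}" "{..<M}" "\<lambda>n. fst (p n)"] by simp
  qed
  have slice: "r = whole" if "(i, r) \<in> range p" "M \<le> i" for i r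
  proof -
    from that(1) obtain n where n: "(i, r) = p n" by blast
    have pn: "fst (p n) = i" "snd (p n) = r" by (simp_all add: n[symmetric])
    have tl: "fst (p (K + (i - M))) = i" "snd (p (K + (i - M))) = whole" using tail[of "i - M"] that(2) by simp_all
    have "n = K + (i - M)" by (rule uniq) (simp_all add: pn tl)
    then show ?thesis using pn tl by simp
  qed
  have "partition_cells {r. (i, r) \<in> range p}" for i
    unfolding partition_cells_def
  proof (intro conjI ballI allI impI)
    have "{r. (i, r) \<in> range p} \<subseteq> (\<lambda>n. snd (p n)) ` {..<K} \<union> {whole}"
    proof
      fix r assume "r \<in> {r. (i, r) \<in> range p}"
      then obtain n where "(i, r) = p n" by blast
      then have n: "p n = (i, r)" by (rule sym)
      show "r \<in> (\<lambda>n. snd (p n)) ` {..<K} \<union> {whole}"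
      proof (cases "n < K")
        case True
        then have "r = snd (p n)" "n \<in> {..<K}" using n by auto
        then show ?thesis by blast
      next
        case False
        then show ?thesis using late[of n] n by simp
      qed
    qed
    then show "finite {r. (i, r) \<in> range p}" by (rule finite_subset) simp
  next
    fix r s assume "r \<in> {r. (i, r) \<in> range p}" "s \<in> {r. (i, r) \<in> range p}" "meets r s"
    then obtain m n where "(i, r) = p m" "(i, s) = p n" by blast
    then have mn: "p m = (i, r)" "p n = (i, s)" by simp_all
    then have "m = n" using \<open>meets r s\<close> by - (rule uniq, simp_all)
    then show "r = s" using mn by simp
  next
    fix s
    obtain n where "fst (p n) = i \<and> meets (snd (p n)) s" using cov by blast
    then have "p n = (i, snd (p n))" "meets (snd (p n)) s" by (auto simp: prod_eq_iff)
    then show "\<exists>r\<in>{r. (i, r) \<in> range p}. meets r s" by (metis (no_types) mem_Collect_eq rangeI)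
  qed
  moreover have "{r. (i, r) \<in> range p} = {whole}" if "M \<le> i" for i
  proof -
    have "(i, whole) = p (K + (i - M))" using tail[of "i - M"] that by simp
    then show ?thesis using slice[OF _ that] by blast
  qed
  ultimately have "pattern_cells (range p)" unfolding pattern_cells_def by blast
  then have "is_pattern (rect ` range p)" by (rule pattern_cells_is_pattern)
  moreover have "inj (\<lambda>n. rect (p n))"
  proof (rule injI)
    fix m n assume "rect (p m) = rect (p n)"
    then have "p m = p n" by (rule rect_inj)
    then show "m = n" by - (rule uniq, simp_all)
  qed
  moreover have "rect (p n) \<subseteq> unit_square i \<longleftrightarrow> n = i + (K - M)" if "M < i" for i n
  proof
    assume "n = i + (K - M)"
    then have "n = K + (i - M)" using \<open>M \<le> K\<close> that by simp
    then have "p n = (i, whole)" using tail[of "i - M"] that by simp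
    then show "rect (p n) \<subseteq> unit_square i" by (simp add: rect_whole)
  next
    assume sub: "rect (p n) \<subseteq> unit_square i"
    have o: "(0, 0) \<in> full_square" by simp
    then have "place (p n) (0, 0) \<in> rect (p n)" unfolding rect_def by (rule imageI)
    with sub have "place (p n) (0, 0) \<in> rect (i, whole)" unfolding rect_whole by (rule subsetD)
    then obtain q where q: "place (p n) (0, 0) = place (i, whole) q" "q \<in> full_square"
      unfolding rect_def by (rule imageE)
    have "place (fst (p n), snd (p n)) (0, 0) = place (i, whole) q" using q(1) by (simp only: prod.collapse)
    from place_eq[OF this o q(2)] have "fst (p n) = i" by (rule conjunct1)
    then have "n = K + (i - M)"
      using tail[of "i - M"] that by - (rule uniq, simp_all)
    then show "n = i + (K - M)" using \<open>M \<le> K\<close> that by simp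
  qed
  ultimately show ?thesis
    unfolding numbered_pattern_def image_image by blast
qed

section \<open>The groups of pattern maps\<close>

text \<open>
  An intrinsic description of pattern maps: eventually the squares are only shifted, and all cells
  of sufficient depth are mapped onto cells by replacing addresses. It mentions no particular pair
  of patterns, so maps can be composed without first matching their patterns.
\<close>

definition hat_map :: "(real \<times> real \<Rightarrow> real \<times> real) \<Rightarrow> bool" where
  "hat_map f \<longleftrightarrow> f \<in> Bij cantor_squares \<and>
     (\<exists>N M. \<forall>j. sends f (N + j, whole) (M + j, whole)) \<and>
     (\<exists>d. \<forall>i xs ys. d \<le> length xs \<longrightarrow> d \<le> length ys \<longrightarrow> (\<exists>b. sends f (i, xs, ys) b))"

lemma hat_map_Bij: "hat_map f \<Longrightarrow> f \<in> Bij cantor_squares"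
  by (simp add: hat_map_def)

lemma hat_map_tail:
  assumes "hat_map f" obtains N M where "\<forall>j. sends f (N + j, whole) (M + j, whole)"
  using assms unfolding hat_map_def by blast

lemma hat_map_depth:
  assumes "hat_map f"
  obtains d where "\<forall>i xs ys. d \<le> length xs \<longrightarrow> d \<le> length ys \<longrightarrow> (\<exists>b. sends f (i, xs, ys) b)"
  using assms unfolding hat_map_def by blast

lemma Bij_image:
  assumes "f \<in> Bij A"
  shows "inj_on f A" "f ` A = A"
  using assms by (auto simp: Bij_def bij_betw_def)

lemma sends_compose:
  assumes "sends f a b" "sends g b c" shows "sends (compose cantor_squares g f) a c"
proof (rule sendsI)
  fix p assume p: "p \<in> cantor_square"
  have "compose cantor_squares g f (place a p) = g (f (place a p))"
    using place_in[OF p] by (simp add: compose_def)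
  also have "\<dots> = place c p" by (simp add: sendsD[OF assms(1) p] sendsD[OF assms(2) p])
  finally show "compose cantor_squares g f (place a p) = place c p" .
qed

abbreviation inverse_map :: "(real \<times> real \<Rightarrow> real \<times> real) \<Rightarrow> real \<times> real \<Rightarrow> real \<times> real" where
  "inverse_map f \<equiv> restrict (inv_into cantor_squares f) cantor_squares"

lemma sends_inverse:
  assumes "f \<in> Bij cantor_squares" "sends f a b" shows "sends (inverse_map f) b a"
proof (rule sendsI)
  fix p assume p: "p \<in> cantor_square"
  have "inverse_map f (place b p) = inv_into cantor_squares f (f (place a p))"
    using place_in[OF p] sendsD[OF assms(2) p] by simp
  also have "\<dots> = place a p" using Bij_image(1)[OF assms(1)] place_in[OF p] by (rule inv_into_f_f)
  finally show "inverse_map f (place b p) = place a p" .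
qed

lemma sends_id: "sends (\<lambda>z\<in>cantor_squares. z) a a"
  using place_in by (intro sendsI) simp

lemma sends_below_whole:
  assumes "sends f (i, whole) (j, whole)" shows "sends f (i, r) (j, r)"
  using sends_extend[of f i "[]" "[]" j "[]" "[]" "fst r" "snd r"] assms by simp

lemma hat_map_id: "hat_map (\<lambda>z\<in>cantor_squares. z)"
proof -
  have "(\<lambda>z\<in>cantor_squares. z) \<in> Bij cantor_squares" by (rule id_Bij)
  moreover have "\<forall>j. sends (\<lambda>z\<in>cantor_squares. z) (0 + j, whole) (0 + j, whole)" using sends_id by blast
  moreover have "\<forall>i xs ys. 0 \<le> length xs \<longrightarrow> 0 \<le> length ys \<longrightarrow> (\<exists>b. sends (\<lambda>z\<in>cantor_squares. z) (i, xs, ys) b)"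
    using sends_id by blast
  ultimately show ?thesis unfolding hat_map_def by blast
qed

text \<open>
  At depth \<open>d + d'\<close> the first map still leaves the images at depth at least
  \<open>d'\<close>, where the second one replaces addresses.
\<close>

lemma hat_map_compose:
  assumes f: "hat_map f" and g: "hat_map g" shows "hat_map (compose cantor_squares g f)"
proof -
  have "compose cantor_squares g f \<in> Bij cantor_squares"
    using assms by (intro compose_Bij) (auto simp: hat_map_def)
  moreover have "\<exists>N M. \<forall>j. sends (compose cantor_squares g f) (N + j, whole) (M + j, whole)"
  proof -
    obtain N M where 1: "\<forall>j. sends f (N + j, whole) (M + j, whole)" using f by (rule hat_map_tail)
    obtain N' M' where 2: "\<forall>j. sends g (N' + j, whole) (M' + j, whole)" using g by (rule hat_map_tail)
    have "sends (compose cantor_squares g f) ((N + N') + j, whole) ((M' + M) + j, whole)" for j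
    proof (rule sends_compose)
      show "sends f ((N + N') + j, whole) (N' + (M + j), whole)"
        using 1[rule_format, of "N' + j"] by (simp add: ac_simps)
      show "sends g (N' + (M + j), whole) ((M' + M) + j, whole)"
        using 2[rule_format, of "M + j"] by (simp add: ac_simps)
    qed
    then show ?thesis by blast
  qed
  moreover have "\<exists>d. \<forall>i xs ys. d \<le> length xs \<longrightarrow> d \<le> length ys \<longrightarrow>
      (\<exists>b. sends (compose cantor_squares g f) (i, xs, ys) b)"
  proof -
    obtain d where 1: "\<forall>i xs ys. d \<le> length xs \<longrightarrow> d \<le> length ys \<longrightarrow> (\<exists>b. sends f (i, xs, ys) b)"
      using f by (rule hat_map_depth)
    obtain d' where 2: "\<forall>i xs ys. d' \<le> length xs \<longrightarrow> d' \<le> length ys \<longrightarrow> (\<exists>b. sends g (i, xs, ys) b)"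
      using g by (rule hat_map_depth)
    have "\<exists>b. sends (compose cantor_squares g f) (i, xs, ys) b"
      if len: "d + d' \<le> length xs" "d + d' \<le> length ys" for i xs ys
    proof -
      obtain j us vs where "sends f (i, take d xs, take d ys) (j, us, vs)"
        using 1[rule_format, of "take d xs" "take d ys" i] len by auto
      from sends_extend[OF this, of "drop d xs" "drop d ys"]
      have s: "sends f (i, xs, ys) (j, us @ drop d xs, vs @ drop d ys)" by simp
      have "d' \<le> length (us @ drop d xs)" "d' \<le> length (vs @ drop d ys)" using len by simp_all
      then obtain b where "sends g (j, us @ drop d xs, vs @ drop d ys) b" using 2 by blast
      with s have "sends (compose cantor_squares g f) (i, xs, ys) b" by (rule sends_compose)
      then show ?thesis by blast
    qed
    then show ?thesis by blast
  qed
  ultimately show ?thesis unfolding hat_map_def by blast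
qed

lemma finite_grid: "finite (grid d)"
  using partition_cells_grid by (rule partition_cells_finite)

text \<open>
  Only finitely many cells of depth \<open>d\<close> lie in squares that are not merely shifted, so
  the addresses of the images of cells of depth \<open>d\<close> have bounded length. A cell that is
  deeper than this bound lies inside one of the images.
\<close>

lemma hat_map_inverse:
  assumes f: "hat_map f" shows "hat_map (inverse_map f)"
proof -
  have B: "f \<in> Bij cantor_squares" using f by (rule hat_map_Bij)
  obtain N M where tail: "\<forall>j. sends f (N + j, whole) (M + j, whole)" using f by (rule hat_map_tail)
  obtain d where depth: "\<forall>i xs ys. d \<le> length xs \<longrightarrow> d \<le> length ys \<longrightarrow> (\<exists>b. sends f (i, xs, ys) b)"
    using f by (rule hat_map_depth)
  define h where "h a = (SOME b. sends f a b)" for a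
  have h: "sends f (i, r) (h (i, r))" if "r \<in> grid d" for i r
  proof -
    obtain xs ys where r: "r = (xs, ys)" by (cases r)
    have "\<exists>b. sends f (i, r) b" using depth that unfolding r grid_def by simp
    then show ?thesis unfolding h_def by (rule someI_ex)
  qed
  have "finite (snd ` h ` ({..<N} \<times> grid d))" using finite_grid by simp
  then obtain e where e: "\<And>xs ys. (xs, ys) \<in> snd ` h ` ({..<N} \<times> grid d) \<Longrightarrow> length xs \<le> e \<and> length ys \<le> e"
    by (rule bounded_lengths) blast
  have "\<exists>b. sends (inverse_map f) (i, xs, ys) b"
    if len: "max d e \<le> length xs" "max d e \<le> length ys" for i xs ys
  proof -
    let ?z = "place (i, xs, ys) (0, 0)"
    have o: "(0, 0) \<in> cantor_square" using cantor_set_ends by simp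
    then have zc: "?z \<in> cell_points (i, xs, ys)" unfolding cell_points_def by (rule imageI)
    have "?z \<in> cantor_squares" using o by (rule place_in)
    then have "?z \<in> f ` cantor_squares" unfolding Bij_image(2)[OF B] .
    then obtain z' where z': "?z = f z'" "z' \<in> cantor_squares" by (rule imageE)
    obtain i' r p where r: "r \<in> grid d" "p \<in> cantor_square" "z' = place (i', r) p"
      using z'(2) by (rule cantor_squares_grid)
    obtain j us vs where s: "sends f (i', r) (j, us, vs)" "length us \<le> max d e" "length vs \<le> max d e"
    proof (cases "i' < N")
      case True
      obtain j us vs where b: "h (i', r) = (j, us, vs)" by (cases "h (i', r)")
      have "h (i', r) \<in> h ` ({..<N} \<times> grid d)" using True r(1) by blast
      then have "snd (h (i', r)) \<in> snd ` h ` ({..<N} \<times> grid d)" by (rule imageI)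
      then have "(us, vs) \<in> snd ` h ` ({..<N} \<times> grid d)" by (simp only: b snd_conv)
      then have "length us \<le> max d e" "length vs \<le> max d e" using e[of us vs] by auto
      then show thesis using that[of j us vs] h[OF r(1), of i'] b by simp
    next
      case False
      have "sends f (i', r) (M + (i' - N), r)"
        using tail[rule_format, of "i' - N"] False by - (rule sends_below_whole, simp)
      moreover obtain us vs where r': "r = (us, vs)" by (cases r)
      moreover have "length us \<le> max d e" "length vs \<le> max d e"
        using r(1) unfolding r' grid_def by simp_all
      ultimately show thesis using that[of "M + (i' - N)" us vs] by simp
    qed
    have "?z = place (j, us, vs) p" using z'(1) sendsD[OF s(1) r(2)] r(3) by simp
    then have "?z \<in> cell_points (j, us, vs)" using r(2) unfolding cell_points_def by (rule image_eqI)
    then have "j = i \<and> meets (xs, ys) (us, vs)"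
      using cell_points_disjoint[OF zc, of j "(us, vs)"] by simp
    then have "j = i" "inside (xs, ys) (us, vs)" using meets_inside[of xs ys us vs] s(2,3) len by auto
    then show ?thesis using sends_inside[OF sends_inverse[OF B s(1)]] by blast
  qed
  moreover have "sends (inverse_map f) (M + j, whole) (N + j, whole)" for j
    using tail by (intro sends_inverse[OF B]) blast
  moreover have "inverse_map f \<in> Bij cantor_squares" using B by (rule restrict_inv_into_Bij)
  ultimately show ?thesis unfolding hat_map_def by blast
qed

lemma numbering_hat_map:
  assumes p: "numbering p" and q: "numbering q" and f: "f \<in> Bij cantor_squares"
    and s: "\<And>n. sends f (q n) (p n)"
  shows "hat_map f"
proof -
  obtain K M where 1: "\<forall>j. q (K + j) = (M + j, whole)" using q by (rule numbering_tail)
  obtain K' M' where 2: "\<forall>j. p (K' + j) = (M' + j, whole)" using p by (rule numbering_tail)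
  have "sends f ((M + K') + j, whole) ((M' + K) + j, whole)" for j
    using s[of "K + (K' + j)"] 1[rule_format, of "K' + j"] 2[rule_format, of "K + j"]
    by (simp add: ac_simps)
  moreover
  obtain e where e: "\<And>xs ys. (xs, ys) \<in> snd ` q ` {..<K} \<Longrightarrow> length xs \<le> e \<and> length ys \<le> e"
    using bounded_lengths[of "snd ` q ` {..<K}"] by blast
  have "\<exists>b. sends f (i, xs, ys) b" if len: "e \<le> length xs" "e \<le> length ys" for i xs ys
  proof -
    let ?z = "place (i, xs, ys) (0, 0)"
    have o: "(0, 0) \<in> cantor_square" using cantor_set_ends by simp
    then have zc: "?z \<in> cell_points (i, xs, ys)" unfolding cell_points_def by (rule imageI)
    have "?z \<in> cantor_squares" using o by (rule place_in)
    with q obtain n u where n: "u \<in> cantor_square" "?z = place (q n) u" by (rule numbering_cover)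
    obtain j us vs where qn: "q n = (j, us, vs)" by (cases "q n")
    have "?z \<in> cell_points (j, us, vs)" using n unfolding cell_points_def qn by (intro image_eqI)
    then have "j = i \<and> meets (xs, ys) (us, vs)"
      using cell_points_disjoint[OF zc, of j "(us, vs)"] by simp
    moreover have "length us \<le> e \<and> length vs \<le> e"
    proof (cases "n < K")
      case True
      then have "snd (q n) \<in> snd ` q ` {..<K}" by blast
      then show ?thesis using e[of us vs] qn by simp
    next
      case False
      then show ?thesis using 1[rule_format, of "n - K"] qn by simp
    qed
    ultimately have "j = i" "inside (xs, ys) (us, vs)" using meets_inside[of xs ys us vs] len by auto
    then show ?thesis using sends_inside[of f i "(us, vs)" "p n" "(xs, ys)"] s[of n] qn by metis
  qed
  ultimately show ?thesis unfolding hat_map_def using f by blast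
qed

text \<open>
  Number the cells of a sufficiently fine grid in the first squares, followed by the remaining
  squares, and transport this numbering by \<open>f\<close>. The images again form a pattern because
  every partition into cells is one.
\<close>

lemma hat_map_numberings:
  assumes f: "hat_map f"
  obtains p q where "numbering p" "numbering q" "\<And>n. sends f (q n) (p n)"
proof -
  have B: "f \<in> Bij cantor_squares" using f by (rule hat_map_Bij)
  obtain N M where tail: "\<forall>j. sends f (N + j, whole) (M + j, whole)" using f by (rule hat_map_tail)
  obtain d where depth: "\<forall>i xs ys. d \<le> length xs \<longrightarrow> d \<le> length ys \<longrightarrow> (\<exists>b. sends f (i, xs, ys) b)"
    using f by (rule hat_map_depth)
  obtain Z where Z: "set Z = {..<N} \<times> grid d" "distinct Z"
    using finite_distinct_list[of "{..<N} \<times> grid d"] finite_grid by blast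
  define K where "K = length Z"
  define q where "q n = (if n < K then Z ! n else (N + (n - K), whole))" for n
  have qZ: "q n \<in> {..<N} \<times> grid d" if "n < K" for n
    using that nth_mem[of n Z] Z(1) by (simp add: q_def K_def)
  have "\<exists>b. sends f (q n) b" for n
  proof (cases "n < K")
    case True
    with qZ[OF True] show ?thesis using depth by (cases "q n") (auto simp: grid_def)
  next
    case False
    then have "q n = (N + (n - K), whole)" by (simp add: q_def)
    then show ?thesis using tail[rule_format, of "n - K"] by (intro exI) (simp only:)
  qed
  then obtain p where s: "\<And>n. sends f (q n) (p n)" by metis
  have q: "numbering q"
    unfolding numbering_def
  proof (intro conjI)
    show "\<forall>m n. fst (q m) = fst (q n) \<and> meets (snd (q m)) (snd (q n)) \<longrightarrow> m = n"
    proof (intro allI impI, elim conjE)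
      fix m n assume mn: "fst (q m) = fst (q n)" "meets (snd (q m)) (snd (q n))"
      have early: "fst (q n) < N \<longleftrightarrow> n < K" for n
        using qZ[of n] by (cases "n < K") (auto simp: q_def)
      show "m = n"
      proof (cases "n < K")
        case True
        then have m: "m < K" using early[of m] early[of n] mn by simp
        have "snd (q m) \<in> grid d" "snd (q n) \<in> grid d" using qZ m True by (auto simp: mem_Times_iff)
        then have "snd (q m) = snd (q n)" using partition_cells_meets[OF partition_cells_grid] mn by blast
        then have "q m = q n" using mn by (simp add: prod_eq_iff)
        then show ?thesis using Z(2) m True by (simp add: q_def K_def nth_eq_iff_index_eq)
      next
        case False
        then have "\<not> m < K" using early[of m] early[of n] mn by simp
        then show ?thesis using False mn by (simp add: q_def)
      qed
    qed
    show "\<forall>z\<in>cantor_squares. \<exists>n. z \<in> cell_points (q n)"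
    proof
      fix z assume "z \<in> cantor_squares"
      then obtain i r u where r: "r \<in> grid d" "u \<in> cantor_square" "z = place (i, r) u"
        by (rule cantor_squares_grid)
      then have z: "z \<in> cell_points (i, r)" by (simp add: cell_points_def)
      show "\<exists>n. z \<in> cell_points (q n)"
      proof (cases "i < N")
        case True
        then have "(i, r) \<in> set Z" using r Z by simp
        then obtain n where "n < K" "Z ! n = (i, r)" unfolding K_def by (metis in_set_conv_nth)
        then show ?thesis using z by (intro exI[of _ n]) (simp add: q_def)
      next
        case False
        have "cell_points (i, r) \<subseteq> cell_points (i, whole)" by (rule inside_cell_points) (cases r, simp)
        then show ?thesis using z False by (intro exI[of _ "K + (i - N)"]) (auto simp: q_def)
      qed
    qed
    have "\<forall>j. q (K + j) = (N + j, whole)" by (simp add: q_def)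
    then show "\<exists>K M. \<forall>j. q (K + j) = (M + j, whole)" by blast
  qed
  have "numbering p"
    unfolding numbering_def
  proof (intro conjI)
    show "\<forall>m n. fst (p m) = fst (p n) \<and> meets (snd (p m)) (snd (p n)) \<longrightarrow> m = n"
    proof (intro allI impI, elim conjE)
      fix m n assume mn: "fst (p m) = fst (p n)" "meets (snd (p m)) (snd (p n))"
      obtain z where z: "z \<in> cell_points (fst (p m), snd (p m))" "z \<in> cell_points (fst (p m), snd (p n))"
        using meets_cell_points[OF mn(2)] by blast
      have "z \<in> f ` cell_points (q m)" using z(1) unfolding sends_image[OF s] by simp
      then obtain u where u: "z = f u" "u \<in> cell_points (q m)" by (rule imageE)
      have "z \<in> f ` cell_points (q n)" using z(2) unfolding sends_image[OF s] mn(1) by simp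
      then obtain v where v: "z = f v" "v \<in> cell_points (q n)" by (rule imageE)
      have "u \<in> cantor_squares" "v \<in> cantor_squares" using u v cell_points_subset by blast+
      then have "u = v" using Bij_image(1)[OF B] u(1) v(1) by (simp add: inj_on_def)
      then show "m = n" using numbering_unique[OF q] u(2) v(2) by blast
    qed
    show "\<forall>z\<in>cantor_squares. \<exists>n. z \<in> cell_points (p n)"
    proof
      fix z assume "z \<in> cantor_squares"
      then have "z \<in> f ` cantor_squares" unfolding Bij_image(2)[OF B] .
      then obtain y where y: "z = f y" "y \<in> cantor_squares" by (rule imageE)
      obtain n where "y \<in> cell_points (q n)" using q y(2) unfolding numbering_def by blast
      then have "f y \<in> f ` cell_points (q n)" by (rule imageI)
      then have "z \<in> cell_points (p n)" unfolding sends_image[OF s] y(1) .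
      then show "\<exists>n. z \<in> cell_points (p n)" ..
    qed
    have "p (K + j) = (M + j, whole)" for j
    proof -
      have "q (K + j) = (N + j, whole)" by (simp add: q_def)
      then show ?thesis using s[of "K + j"] tail sends_unique by metis
    qed
    then show "\<exists>K M. \<forall>j. p (K + j) = (M + j, whole)" by blast
  qed
  then show thesis using that q s by blast
qed

lemma pattern_map_sends:
  assumes "numbering p" "numbering q"
  shows "hat_map (pattern_map (\<lambda>n. rect (p n)) (\<lambda>n. rect (q n)))"
    and "sends (pattern_map (\<lambda>n. rect (p n)) (\<lambda>n. rect (q n))) (q n) (p n)"
proof -
  obtain f where f: "f \<in> Bij cantor_squares" "\<forall>n. sends f (q n) (p n)"
    using numbering_map_exists[OF assms] by blast
  have "pattern_map (\<lambda>n. rect (p n)) (\<lambda>n. rect (q n)) = f"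
  proof (rule pattern_map_eq)
    show "f \<in> extensional cantor_squares" using f(1) by (simp add: Bij_def)
    show "sends f (q n) (p n)" for n using f(2) by blast
    show "\<exists>n. z \<in> cell_points (q n)" if "z \<in> cantor_squares" for z
      using assms(2) that unfolding numbering_def by blast
  qed
  then show "hat_map (pattern_map (\<lambda>n. rect (p n)) (\<lambda>n. rect (q n)))"
    and "sends (pattern_map (\<lambda>n. rect (p n)) (\<lambda>n. rect (q n))) (q n) (p n)"
    using f numbering_hat_map[OF assms f(1)] by simp_all
qed

lemma carrier_hat_2V: "carrier hat_2V = {f. hat_map f}"
proof (rule Set.set_eqI)
  fix f
  have "f \<in> carrier hat_2V \<longleftrightarrow> (\<exists>P Q. f = pattern_map P Q \<and> numbered_pattern P \<and> numbered_pattern Q)"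
    by (auto simp: hat_2V_def)
  also have "\<dots> \<longleftrightarrow> hat_map f"
  proof
    assume "\<exists>P Q. f = pattern_map P Q \<and> numbered_pattern P \<and> numbered_pattern Q"
    then obtain P Q where f: "f = pattern_map P Q" and PQ: "numbered_pattern P" "numbered_pattern Q" by blast
    obtain p where "numbering p" "P = (\<lambda>n. rect (p n))"
      using PQ(1) by (rule numbered_pattern_imp_numbering)
    moreover obtain q where "numbering q" "Q = (\<lambda>n. rect (q n))"
      using PQ(2) by (rule numbered_pattern_imp_numbering)
    ultimately show "hat_map f" using pattern_map_sends(1) unfolding f by simp
  next
    assume f: "hat_map f"
    then obtain p q where pq: "numbering p" "numbering q" "\<And>n. sends f (q n) (p n)"
      by (rule hat_map_numberings) blast
    have "pattern_map (\<lambda>n. rect (p n)) (\<lambda>n. rect (q n)) = f"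
    proof (rule pattern_map_eq)
      show "f \<in> extensional cantor_squares" using hat_map_Bij[OF f] by (simp add: Bij_def)
      show "sends f (q n) (p n)" for n by (rule pq)
      show "\<exists>n. z \<in> cell_points (q n)" if "z \<in> cantor_squares" for z
        using pq(2) that unfolding numbering_def by blast
    qed
    then show "\<exists>P Q. f = pattern_map P Q \<and> numbered_pattern P \<and> numbered_pattern Q"
      using numbering_imp_numbered_pattern pq(1,2) by metis
  qed
  finally show "f \<in> carrier hat_2V \<longleftrightarrow> f \<in> {f. hat_map f}" by simp
qed

lemma subgroup_hat_map: "subgroup {f. hat_map f} (BijGroup cantor_squares)"
proof (rule subgroup.intro)
  show "{f. hat_map f} \<subseteq> carrier (BijGroup cantor_squares)"
    using hat_map_Bij by (auto simp: BijGroup_def)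
  show "\<one>\<^bsub>BijGroup cantor_squares\<^esub> \<in> {f. hat_map f}"
    using hat_map_id by (simp add: BijGroup_def)
  fix f g assume fg: "f \<in> {f. hat_map f}" "g \<in> {f. hat_map f}"
  then show "f \<otimes>\<^bsub>BijGroup cantor_squares\<^esub> g \<in> {f. hat_map f}"
    using hat_map_compose[of g f] hat_map_Bij by (simp add: BijGroup_def)
  show "inv\<^bsub>BijGroup cantor_squares\<^esub> f \<in> {f. hat_map f}"
    using fg(1) inv_BijGroup[OF hat_map_Bij, of f] hat_map_inverse[of f] by simp
qed

lemma hat_2V_eq: "hat_2V = (BijGroup cantor_squares)\<lparr>carrier := {f. hat_map f}\<rparr>"
  using carrier_hat_2V by (simp add: hat_2V_def)

lemma group_hat_2V: "group hat_2V"
  unfolding hat_2V_eq using subgroup_hat_map group_BijGroup by (rule subgroup.subgroup_is_group)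

lemma hat_2V_mult: "hat_map f \<Longrightarrow> hat_map g \<Longrightarrow> f \<otimes>\<^bsub>hat_2V\<^esub> g = compose cantor_squares f g"
  using hat_map_Bij by (simp add: hat_2V_eq BijGroup_def)

lemma hat_2V_one: "\<one>\<^bsub>hat_2V\<^esub> = (\<lambda>z\<in>cantor_squares. z)"
  by (simp add: hat_2V_eq BijGroup_def)

lemma hat_2V_inv: "hat_map f \<Longrightarrow> inv\<^bsub>hat_2V\<^esub> f = inverse_map f"
  unfolding hat_2V_eq
  using group.m_inv_consistent[OF group_BijGroup subgroup_hat_map, of f] inv_BijGroup[OF hat_map_Bij, of f]
  by simp

lemma hat_2V_sends_mult:
  assumes "hat_map f" "hat_map g" "sends g a b" "sends f b c"
  shows "sends (f \<otimes>\<^bsub>hat_2V\<^esub> g) a c"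
  using assms sends_compose by (simp add: hat_2V_mult)

lemma hat_2V_sends_inv: "hat_map f \<Longrightarrow> sends f a b \<Longrightarrow> sends (inv\<^bsub>hat_2V\<^esub> f) b a"
  using sends_inverse hat_map_Bij by (simp add: hat_2V_inv)

definition fixes_others :: "(real \<times> real \<Rightarrow> real \<times> real) \<Rightarrow> bool" where
  "fixes_others f \<longleftrightarrow> (\<forall>i. sends f (Suc i, whole) (Suc i, whole))"

lemma fixes_others_iff:
  "fixes_others f \<longleftrightarrow> (\<forall>p\<in>cantor_squares - unit_square 0. f p = p)"
proof -
  have "cantor_squares - unit_square 0 = (\<Union>i. cell_points (Suc i, whole))"
  proof (intro equalityI subsetI)
    fix z assume z: "z \<in> cantor_squares - unit_square 0"
    then obtain i where i: "z \<in> cell_points (i, whole)" by (auto simp: cantor_squares_eq)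
    have "i \<noteq> 0"
    proof
      assume "i = 0"
      then have "z \<in> unit_square 0" using i cantor_squares_rect[of "(0, whole)"] by (auto simp: rect_whole)
      then show False using z by simp
    qed
    then obtain j where "i = Suc j" by (cases i) auto
    with i show "z \<in> (\<Union>i. cell_points (Suc i, whole))" by blast
  next
    fix z assume "z \<in> (\<Union>i. cell_points (Suc i, whole))"
    then obtain i where i: "z \<in> cell_points (Suc i, whole)" by blast
    have zc: "z \<in> cantor_squares" using i cell_points_subset by blast
    have "z \<notin> unit_square 0"
    proof
      assume "z \<in> unit_square 0"
      then have "z \<in> cell_points (0, whole)" using cantor_squares_rect[of "(0, whole)"] zc by (auto simp: rect_whole)
      then show False using cell_points_disjoint[OF i] by blast
    qed
    with zc show "z \<in> cantor_squares - unit_square 0" by blast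
  qed
  then show ?thesis
    unfolding fixes_others_def sends_def cell_points_def by (simp add: ball_UN del: place.simps) 
qed

lemma carrier_group_2V: "carrier group_2V = {f. hat_map f \<and> fixes_others f}"
  unfolding group_2V_def fixes_others_iff using carrier_hat_2V by auto

lemma subgroup_group_2V: "subgroup {f. hat_map f \<and> fixes_others f} hat_2V"
proof (rule subgroup.intro)
  show "{f. hat_map f \<and> fixes_others f} \<subseteq> carrier hat_2V" using carrier_hat_2V by auto
  show "\<one>\<^bsub>hat_2V\<^esub> \<in> {f. hat_map f \<and> fixes_others f}"
    using hat_map_id sends_id by (simp add: hat_2V_one fixes_others_def)
  fix f g assume fg: "f \<in> {f. hat_map f \<and> fixes_others f}" "g \<in> {f. hat_map f \<and> fixes_others f}"
  have "hat_map (f \<otimes>\<^bsub>hat_2V\<^esub> g)" using fg hat_map_compose by (simp add: hat_2V_mult)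
  moreover have "fixes_others (f \<otimes>\<^bsub>hat_2V\<^esub> g)"
    using fg hat_2V_sends_mult unfolding fixes_others_def by blast
  ultimately show "f \<otimes>\<^bsub>hat_2V\<^esub> g \<in> {f. hat_map f \<and> fixes_others f}" by simp
  have "hat_map (inv\<^bsub>hat_2V\<^esub> f)" using fg hat_map_inverse by (simp add: hat_2V_inv)
  moreover have "fixes_others (inv\<^bsub>hat_2V\<^esub> f)"
    using fg hat_2V_sends_inv unfolding fixes_others_def by blast
  ultimately show "inv\<^bsub>hat_2V\<^esub> f \<in> {f. hat_map f \<and> fixes_others f}" by simp
qed

lemma group_2V_eq: "group_2V = hat_2V\<lparr>carrier := {f. hat_map f \<and> fixes_others f}\<rparr>"
  using carrier_group_2V by (simp add: group_2V_def)

lemma group_group_2V: "group group_2V"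
  unfolding group_2V_eq using subgroup_group_2V group_hat_2V by (rule subgroup.subgroup_is_group)

lemma group_2V_mult [simp]: "f \<otimes>\<^bsub>group_2V\<^esub> g = f \<otimes>\<^bsub>hat_2V\<^esub> g"
  by (simp add: group_2V_eq)

lemma group_2V_one [simp]: "\<one>\<^bsub>group_2V\<^esub> = \<one>\<^bsub>hat_2V\<^esub>"
  by (simp add: group_2V_eq)

lemma group_2V_inv: "f \<in> carrier group_2V \<Longrightarrow> inv\<^bsub>group_2V\<^esub> f = inv\<^bsub>hat_2V\<^esub> f"
  using group.m_inv_consistent[OF group_hat_2V subgroup_group_2V, of f]
  by (simp add: carrier_group_2V) (simp add: group_2V_eq)

section \<open>The generators as maps of lists\<close>

definition sends_list :: "(real \<times> real \<Rightarrow> real \<times> real) \<Rightarrow> cell list \<Rightarrow> cell list \<Rightarrow> bool" where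
  "sends_list f = list_all2 (\<lambda>r s. sends f (0, r) (0, s))"

lemma sends_list_length: "sends_list f V U \<Longrightarrow> length V = length U"
  unfolding sends_list_def by (rule list_all2_lengthD)

lemma sends_list_cut: "sends_list f V U \<Longrightarrow> sends_list f (cut c m V) (cut c m U)"
proof (induction c m V arbitrary: U rule: cut.induct)
  case (2 c r L)
  then show ?case by (cases U) (simp_all add: sends_list_def sends_child)
next
  case (3 c m r L)
  then show ?case by (cases U) (simp_all add: sends_list_def)
qed (simp add: sends_list_def)

lemma sends_list_exchange: "sends_list f V U \<Longrightarrow> sends_list f (exchange m V) (exchange m U)"
proof (induction m V arbitrary: U rule: exchange.induct)
  case (1 r s L)
  then obtain r' s' L' where "U = r' # s' # L'"
    by (auto simp: sends_list_def list_all2_Cons1)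
  with 1 show ?case by (simp add: sends_list_def)
next
  case (2 m r L)
  then show ?case by (cases U) (simp_all add: sends_list_def)
qed (auto simp: sends_list_def list_all2_Cons1)

lemma sends_list_mult:
  assumes "hat_map f" "hat_map g" "sends_list g V U" "sends_list f U W"
  shows "sends_list (f \<otimes>\<^bsub>hat_2V\<^esub> g) V W"
  unfolding sends_list_def
  by (rule list_all2_trans[OF _ assms(3)[unfolded sends_list_def] assms(4)[unfolded sends_list_def]])
    (rule hat_2V_sends_mult[OF assms(1,2)])

lemma sends_list_inv:
  assumes "hat_map f" "sends_list f V U" shows "sends_list (inv\<^bsub>hat_2V\<^esub> f) U V"
  using assms(2) unfolding sends_list_def list_all2_conv_all_nth
  using hat_2V_sends_inv[OF assms(1)] by simp

lemma sends_list_one: "sends_list \<one>\<^bsub>hat_2V\<^esub> V V"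
  unfolding sends_list_def hat_2V_one by (rule list_all2_refl) (rule sends_id)

lemma sends_list_unique: "sends_list f V U \<Longrightarrow> sends_list f V U' \<Longrightarrow> U = U'"
proof (rule nth_equalityI)
  assume f: "sends_list f V U" "sends_list f V U'"
  then show "length U = length U'" using sends_list_length by metis
  fix i assume "i < length U"
  then have "sends f (0, V ! i) (0, U ! i)" "sends f (0, V ! i) (0, U' ! i)"
    using f unfolding sends_list_def by (simp_all add: list_all2_conv_all_nth)
  then have "(0 :: nat, U ! i) = (0, U' ! i)" by (rule sends_unique)
  then show "U ! i = U' ! i" by simp
qed

lemma sends_list_determines:
  assumes f: "f \<in> carrier group_2V" and g: "g \<in> carrier group_2V"
    and V: "partition_list V" and s: "sends_list f V U" "sends_list g V U"
  shows "f = g"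
proof (rule extensionalityI)
  show "f \<in> extensional cantor_squares" "g \<in> extensional cantor_squares"
    using f g hat_map_Bij unfolding carrier_group_2V by (auto simp: Bij_def)
  fix z assume "z \<in> cantor_squares"
  then obtain i where i: "z \<in> cell_points (i, whole)" by (auto simp: cantor_squares_eq)
  have same: "f z = g z" if "z \<in> cell_points a" "sends f a b" "sends g a b" for a b
  proof -
    from that(1) obtain p where "z = place a p" "p \<in> cantor_square"
      unfolding cell_points_def by (rule imageE)
    then show ?thesis using sendsD[OF that(2)] sendsD[OF that(3)] by simp
  qed
  show "f z = g z"
  proof (cases i)
    case 0
    then obtain r where r: "r \<in> set V" "z \<in> cell_points (0, r)"
      using partition_cells_points[of "set V" z 0] V i by (auto simp: partition_list_def)
    then obtain k where k: "k < length V" "V ! k = r" by (metis in_set_conv_nth)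
    then have "sends f (0, r) (0, U ! k)" "sends g (0, r) (0, U ! k)"
      using s unfolding sends_list_def by (auto simp: list_all2_conv_all_nth)
    with r(2) show ?thesis by (rule same)
  next
    case (Suc j)
    then show ?thesis using same[of "(i, whole)" "(i, whole)"] i f g
      unfolding carrier_group_2V fixes_others_def by simp
  qed
qed

text \<open>
  The addresses of the patterns \<open>v_i\<close> and \<open>h_i\<close>.
\<close>

definition cut_numbering :: "bool \<Rightarrow> nat \<Rightarrow> nat \<Rightarrow> nat \<times> cell" where
  "cut_numbering c i n =
     (if n < i then (n, whole) else if n = i then (i, child c False whole)
      else if n = Suc i then (i, child c True whole) else (n - 1, whole))"

definition swap_numbering :: "nat \<Rightarrow> nat \<Rightarrow> nat \<times> cell" where
  "swap_numbering i n = (if n = i then (Suc i, whole) else if n = Suc i then (i, whole) else (n, whole))"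

lemma numbering_trivial: "numbering (\<lambda>n. (n, whole))"
  unfolding numbering_def
proof (intro conjI)
  show "\<exists>K M. \<forall>j. (K + j, whole) = (M + j, whole)" by blast
qed (auto simp: cantor_squares_eq)

lemma numbering_swap: "numbering (swap_numbering i)"
  unfolding numbering_def
proof (intro conjI)
  show "\<forall>m n. fst (swap_numbering i m) = fst (swap_numbering i n) \<and>
      meets (snd (swap_numbering i m)) (snd (swap_numbering i n)) \<longrightarrow> m = n"
    by (simp add: swap_numbering_def)
  show "\<forall>z\<in>cantor_squares. \<exists>n. z \<in> cell_points (swap_numbering i n)"
  proof
    fix z assume "z \<in> cantor_squares"
    then obtain j where j: "z \<in> cell_points (j, whole)" by (auto simp: cantor_squares_eq)
    have "swap_numbering i (if j = i then Suc i else if j = Suc i then i else j) = (j, whole)"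
      by (simp add: swap_numbering_def)
    then show "\<exists>n. z \<in> cell_points (swap_numbering i n)" using j by metis
  qed
  have "\<forall>j. swap_numbering i (Suc (Suc i) + j) = (Suc (Suc i) + j, whole)"
    by (simp add: swap_numbering_def)
  then show "\<exists>K M. \<forall>j. swap_numbering i (K + j) = (M + j, whole)" by blast
qed

lemma numbering_cut: "numbering (cut_numbering c i)"
  unfolding numbering_def
proof (intro conjI)
  have m: "\<not> meets (child c True whole) (child c False whole)" "\<not> meets (child c False whole) (child c True whole)"
    by (cases c; simp)+
  show "\<forall>m n. fst (cut_numbering c i m) = fst (cut_numbering c i n) \<and>
      meets (snd (cut_numbering c i m)) (snd (cut_numbering c i n)) \<longrightarrow> m = n"
    using m unfolding cut_numbering_def by (auto simp del: child.simps)
  show "\<forall>z\<in>cantor_squares. \<exists>n. z \<in> cell_points (cut_numbering c i n)"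
  proof
    fix z assume "z \<in> cantor_squares"
    then obtain j where j: "z \<in> cell_points (j, whole)" by (auto simp: cantor_squares_eq)
    consider "j < i" | "j = i" | "i < j" by linarith
    then show "\<exists>n. z \<in> cell_points (cut_numbering c i n)"
    proof cases
      case 1
      then have "cut_numbering c i j = (j, whole)" by (simp add: cut_numbering_def)
      then show ?thesis using j by metis
    next
      case 2
      have "partition_cells (cut_set c whole {whole})"
        using partition_cells_whole by (rule partition_cells_cut) simp
      then obtain b where b: "z \<in> cell_points (i, child c b whole)"
        using partition_cells_points j 2 unfolding cut_set_def by blast
      have "cut_numbering c i (if b then Suc i else i) = (i, child c b whole)"
        by (simp add: cut_numbering_def)
      then show ?thesis using b by metis
    next
      case 3
      then have "cut_numbering c i (Suc j) = (j, whole)" by (simp add: cut_numbering_def)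
      then show ?thesis using j by metis
    qed
  qed
  have "\<forall>j. cut_numbering c i (Suc (Suc i) + j) = (Suc i + j, whole)"
    by (simp add: cut_numbering_def)
  then show "\<exists>K M. \<forall>j. cut_numbering c i (K + j) = (M + j, whole)" by blast
qed

lemma unit_square_rect: "unit_square = (\<lambda>n. rect (n, whole))"
  by (simp add: rect_whole)

lemma rect_whole_children:
  "rect (i, child False False whole) = {2 * real i .. 2 * real i + 1 / 3} \<times> {0..1}"
  "rect (i, child False True whole) = {2 * real i + 2 / 3 .. 2 * real i + 1} \<times> {0..1}"
  "rect (i, child True False whole) = {2 * real i .. 2 * real i + 1} \<times> {0 .. 1 / 3}"
  "rect (i, child True True whole) = {2 * real i .. 2 * real i + 1} \<times> {2 / 3 .. 1}"
  by (simp_all add: rect_eq third_def)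

lemma v_pattern_rect: "v_pattern i = (\<lambda>n. rect (cut_numbering False i n))"
  by (rule ext)
    (simp add: v_pattern_def cut_numbering_def rect_whole rect_whole_children del: child.simps)

lemma h_pattern_rect: "h_pattern i = (\<lambda>n. rect (cut_numbering True i n))"
  by (rule ext)
    (simp add: h_pattern_def cut_numbering_def rect_whole rect_whole_children del: child.simps)

lemma sigma_pattern_rect: "sigma_pattern i = (\<lambda>n. rect (swap_numbering i n))"
  by (rule ext) (simp add: sigma_pattern_def swap_numbering_def rect_whole)

lemma v_elt_sends: "hat_map (v_elt i)" "sends (v_elt i) (n, whole) (cut_numbering False i n)"
  unfolding pattern_elt_def unit_square_rect v_pattern_rect
  using pattern_map_sends[OF numbering_cut numbering_trivial] by simp_all

lemma h_elt_sends: "hat_map (h_elt i)" "sends (h_elt i) (n, whole) (cut_numbering True i n)"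
  unfolding pattern_elt_def unit_square_rect h_pattern_rect
  using pattern_map_sends[OF numbering_cut numbering_trivial] by simp_all

lemma sigma_elt_sends: "hat_map (sigma_elt i)" "sends (sigma_elt i) (n, whole) (swap_numbering i n)"
  unfolding pattern_elt_def unit_square_rect sigma_pattern_rect
  using pattern_map_sends[OF numbering_swap numbering_trivial] by simp_all

text \<open>
  \<open>f\<close> is the element given by the numbered pattern that divides
  \<^term>\<open>unit_square 0\<close> into the cells of \<open>L\<close>, in reversed order, and no
  other square.
\<close>

definition places :: "(real \<times> real \<Rightarrow> real \<times> real) \<Rightarrow> cell list \<Rightarrow> bool" where
  "places f L \<longleftrightarrow> hat_map f \<and>
     (\<forall>n<length L. sends f (n, whole) (0, L ! (length L - Suc n))) \<and>
     (\<forall>n. sends f (length L + n, whole) (Suc n, whole))"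

text \<open>
  Number \<open>i\<close> has position \<open>length L - Suc i\<close> in the list; the numbers
  above \<open>i\<close> grow by one, and the positions of the smaller numbers do.
\<close>

lemma places_cut:
  assumes f: "places f L" and i: "i < length L"
    and g: "hat_map g" "\<And>n. sends g (n, whole) (cut_numbering c i n)"
  shows "places (f \<otimes>\<^bsub>hat_2V\<^esub> g) (cut c (length L - Suc i) L)"
proof -
  let ?l = "length L"
  define m where "m = ?l - Suc i"
  have m: "m < ?l" "Suc m = ?l - i" using i by (auto simp: m_def)
  have hf: "hat_map f" using f by (simp add: places_def)
  have fL: "sends f (n, whole) (0, L ! (?l - Suc n))" if "n < ?l" for n
    using f that by (simp add: places_def)
  have ft: "sends f (?l + n, whole) (Suc n, whole)" for n using f by (simp add: places_def)
  have *: "sends (f \<otimes>\<^bsub>hat_2V\<^esub> g) (n, whole) b" if "sends f (cut_numbering c i n) b" for n b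
    using hat_2V_sends_mult[OF hf g(1) g(2) that] .
  have "sends (f \<otimes>\<^bsub>hat_2V\<^esub> g) (n, whole) (0, cut c m L ! (?l - n))" if n: "n < Suc ?l" for n
  proof (rule *)
    consider "n < i" | "n = i" | "n = Suc i" | "Suc i < n" by linarith
    then show "sends f (cut_numbering c i n) (0, cut c m L ! (?l - n))"
    proof cases
      case 1
      then have "?l - n = Suc (?l - Suc n)" "m < ?l - Suc n" "?l - Suc n < ?l" using i by (auto simp: m_def)
      then have "cut c m L ! (?l - n) = L ! (?l - Suc n)" by (simp add: nth_cut_Suc)
      then show ?thesis using 1 i fL[of n] by (simp add: cut_numbering_def)
    next
      case 2
      then have "cut c m L ! (?l - n) = child c False (L ! m)"
        using m nth_cut_children(2)[of m L c] by simp
      then show ?thesis using 2 i sends_child[OF fL[of i], of c False] by (simp add: cut_numbering_def m_def)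
    next
      case 3
      then have "cut c m L ! (?l - n) = child c True (L ! m)"
        using m nth_cut_children(1)[of m L c] by (simp add: m_def)
      then show ?thesis using 3 i sends_child[OF fL[of i], of c True] by (simp add: cut_numbering_def m_def)
    next
      case 4
      then have "cut c m L ! (?l - n) = L ! (?l - n)" using n by (intro nth_cut_less) (auto simp: m_def)
      then show ?thesis using 4 n fL[of "n - 1"] by (simp add: cut_numbering_def)
    qed
  qed
  moreover have "sends (f \<otimes>\<^bsub>hat_2V\<^esub> g) (Suc ?l + n, whole) (Suc n, whole)" for n
    using ft[of n] i by (intro *) (simp add: cut_numbering_def)
  moreover have "hat_map (f \<otimes>\<^bsub>hat_2V\<^esub> g)"
    using hf g(1) by (simp add: hat_2V_mult hat_map_compose)
  ultimately show ?thesis using m(1) unfolding places_def m_def[symmetric] by simp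
qed

lemma places_exchange:
  assumes f: "places f L" and i: "Suc i < length L"
  shows "places (f \<otimes>\<^bsub>hat_2V\<^esub> sigma_elt i) (exchange (length L - Suc (Suc i)) L)"
proof -
  let ?l = "length L"
  define m where "m = ?l - Suc (Suc i)"
  have m: "Suc m < ?l" "Suc m = ?l - Suc i" using i by (auto simp: m_def)
  have hf: "hat_map f" using f by (simp add: places_def)
  have fL: "sends f (n, whole) (0, L ! (?l - Suc n))" if "n < ?l" for n
    using f that by (simp add: places_def)
  have ft: "sends f (?l + n, whole) (Suc n, whole)" for n using f by (simp add: places_def)
  have *: "sends (f \<otimes>\<^bsub>hat_2V\<^esub> sigma_elt i) (n, whole) b" if "sends f (swap_numbering i n) b" for n b
    using hat_2V_sends_mult[OF hf sigma_elt_sends(1) sigma_elt_sends(2) that] .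
  have "sends (f \<otimes>\<^bsub>hat_2V\<^esub> sigma_elt i) (n, whole) (0, exchange m L ! (?l - Suc n))" if n: "n < ?l" for n
  proof (rule *)
    consider "n = i" | "n = Suc i" | "n \<noteq> i" "n \<noteq> Suc i" by blast
    then show "sends f (swap_numbering i n) (0, exchange m L ! (?l - Suc n))"
    proof cases
      case 1
      then show ?thesis using m i fL[of "Suc i"] by (simp add: swap_numbering_def nth_exchange m_def)
    next
      case 2
      then show ?thesis using m i fL[of i] by (simp add: swap_numbering_def nth_exchange m_def)
    next
      case 3
      then have "?l - Suc n \<noteq> m" "?l - Suc n \<noteq> Suc m" using i n by (auto simp: m_def)
      then show ?thesis using 3 n m fL[of n] by (simp add: swap_numbering_def nth_exchange)
    qed
  qed
  moreover have "sends (f \<otimes>\<^bsub>hat_2V\<^esub> sigma_elt i) (?l + n, whole) (Suc n, whole)" for n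
    using ft[of n] i by (intro *) (simp add: swap_numbering_def)
  moreover have "hat_map (f \<otimes>\<^bsub>hat_2V\<^esub> sigma_elt i)"
    using hf sigma_elt_sends(1) by (simp add: hat_2V_mult hat_map_compose)
  ultimately show ?thesis unfolding places_def m_def[symmetric] by simp
qed

text \<open>
  The pattern of the \<open>k\<close>-th power of \<open>v_0\<close>, which always divides the cell
  with number 0.
\<close>

primrec comb :: "nat \<Rightarrow> cell list" where
  "comb 0 = [whole]"
| "comb (Suc k) = cut False k (comb k)"

lemma length_comb [simp]: "length (comb k) = Suc k"
  by (induction k) auto

lemma partition_list_comb: "partition_list (comb k)"
  by (induction k) (auto simp: partition_list_def[of "[whole]"] partition_cells_whole intro: partition_list_cut)

lemma places_v_power: "places (v_elt 0 [^]\<^bsub>hat_2V\<^esub> k) (comb k)"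
proof (induction k)
  case 0
  interpret group hat_2V by (rule group_hat_2V)
  have "sends \<one>\<^bsub>hat_2V\<^esub> a a" for a unfolding hat_2V_one by (rule sends_id)
  moreover have "hat_map \<one>\<^bsub>hat_2V\<^esub>" unfolding hat_2V_one by (rule hat_map_id)
  ultimately show ?case by (simp add: places_def)
next
  case (Suc k)
  interpret group hat_2V by (rule group_hat_2V)
  show ?case using places_cut[OF Suc, of 0, OF _ v_elt_sends] by simp
qed

lemma places_quotient:
  assumes f: "places f U" and g: "places g V" and l: "length V = length U"
  shows "f \<otimes>\<^bsub>hat_2V\<^esub> inv\<^bsub>hat_2V\<^esub> g \<in> carrier group_2V \<and> sends_list (f \<otimes>\<^bsub>hat_2V\<^esub> inv\<^bsub>hat_2V\<^esub> g) V U"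
proof -
  have hf: "hat_map f" and hg: "hat_map g" using f g by (simp_all add: places_def)
  have hi: "hat_map (inv\<^bsub>hat_2V\<^esub> g)" using hg by (simp add: hat_2V_inv hat_map_inverse)
  have *: "sends (f \<otimes>\<^bsub>hat_2V\<^esub> inv\<^bsub>hat_2V\<^esub> g) a b" if "sends g (n, whole) a" "sends f (n, whole) b" for n a b
    using hat_2V_sends_mult[OF hf hi hat_2V_sends_inv[OF hg that(1)] that(2)] .
  have "sends (f \<otimes>\<^bsub>hat_2V\<^esub> inv\<^bsub>hat_2V\<^esub> g) (0, V ! m) (0, U ! m)" if "m < length U" for m
  proof (rule *)
    have e: "length U - Suc (length U - Suc m) = m" "length U - Suc m < length U"
      using that by arith+
    have "\<forall>n<length V. sends g (n, whole) (0, V ! (length V - Suc n))"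
      "\<forall>n<length U. sends f (n, whole) (0, U ! (length U - Suc n))"
      using f g by (simp_all add: places_def)
    from this[rule_format, of "length U - Suc m"]
    show "sends g (length U - Suc m, whole) (0, V ! m)" "sends f (length U - Suc m, whole) (0, U ! m)"
      using e l by simp_all
  qed
  then have "sends_list (f \<otimes>\<^bsub>hat_2V\<^esub> inv\<^bsub>hat_2V\<^esub> g) V U"
    using l by (simp add: sends_list_def list_all2_conv_all_nth)
  moreover have "fixes_others (f \<otimes>\<^bsub>hat_2V\<^esub> inv\<^bsub>hat_2V\<^esub> g)"
    unfolding fixes_others_def
  proof
    fix i show "sends (f \<otimes>\<^bsub>hat_2V\<^esub> inv\<^bsub>hat_2V\<^esub> g) (Suc i, whole) (Suc i, whole)"
      using f g l by (intro *[of "length U + i"]) (simp_all add: places_def)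
  qed
  moreover have "hat_map (f \<otimes>\<^bsub>hat_2V\<^esub> inv\<^bsub>hat_2V\<^esub> g)"
    using hf hi by (simp add: hat_2V_mult[OF hf hi] hat_map_compose)
  ultimately show ?thesis by (simp add: carrier_group_2V)
qed

lemma elt_A_B_sends:
  shows "elt_2V (gA i) \<in> carrier group_2V \<and> sends_list (elt_2V (gA i)) (comb (Suc (Suc i))) (cut False i (comb (Suc i)))"
    and "elt_2V (gB i) \<in> carrier group_2V \<and> sends_list (elt_2V (gB i)) (comb (Suc (Suc i))) (cut True i (comb (Suc i)))"
proof -
  have "places (v_elt 0 [^]\<^bsub>hat_2V\<^esub> (i + 1) \<otimes>\<^bsub>hat_2V\<^esub> v_elt 1) (cut False i (comb (Suc i)))"
    using places_cut[OF places_v_power[of "i + 1"], of 1, OF _ v_elt_sends] by simp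
  from places_quotient[OF this places_v_power[of "i + 2"]]
  show "elt_2V (gA i) \<in> carrier group_2V \<and> sends_list (elt_2V (gA i)) (comb (Suc (Suc i))) (cut False i (comb (Suc i)))"
    by (simp add: v0_quotient_def)
  have "places (v_elt 0 [^]\<^bsub>hat_2V\<^esub> (i + 1) \<otimes>\<^bsub>hat_2V\<^esub> h_elt 1) (cut True i (comb (Suc i)))"
    using places_cut[OF places_v_power[of "i + 1"], of 1, OF _ h_elt_sends] by simp
  from places_quotient[OF this places_v_power[of "i + 2"]]
  show "elt_2V (gB i) \<in> carrier group_2V \<and> sends_list (elt_2V (gB i)) (comb (Suc (Suc i))) (cut True i (comb (Suc i)))"
    by (simp add: v0_quotient_def)
qed

lemma elt_C_sends:
  "elt_2V (gC i) \<in> carrier group_2V \<and> sends_list (elt_2V (gC i)) (comb (Suc i)) (cut True i (comb i))"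
proof -
  have "places (v_elt 0 [^]\<^bsub>hat_2V\<^esub> i \<otimes>\<^bsub>hat_2V\<^esub> h_elt 0) (cut True i (comb i))"
    using places_cut[OF places_v_power[of i], of 0, OF _ h_elt_sends] by simp
  from places_quotient[OF this places_v_power[of "i + 1"]] show ?thesis by (simp add: v0_quotient_def)
qed

lemma elt_Pi_sends:
  "elt_2V (gPi i) \<in> carrier group_2V \<and>
   sends_list (elt_2V (gPi i)) (comb (Suc (Suc i))) (exchange i (comb (Suc (Suc i))))"
proof -
  have "places (v_elt 0 [^]\<^bsub>hat_2V\<^esub> (i + 2) \<otimes>\<^bsub>hat_2V\<^esub> sigma_elt 1) (exchange i (comb (Suc (Suc i))))"
    using places_exchange[OF places_v_power[of "i + 2"], of 1] by simp
  from places_quotient[OF this places_v_power[of "i + 2"]] show ?thesis by (simp add: v0_quotient_def)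
qed

lemma elt_Pibar_sends:
  "elt_2V (gPibar i) \<in> carrier group_2V \<and>
   sends_list (elt_2V (gPibar i)) (comb (Suc i)) (exchange i (comb (Suc i)))"
proof -
  have "places (v_elt 0 [^]\<^bsub>hat_2V\<^esub> (i + 1) \<otimes>\<^bsub>hat_2V\<^esub> sigma_elt 0) (exchange i (comb (Suc i)))"
    using places_exchange[OF places_v_power[of "i + 1"], of 0] by simp
  from places_quotient[OF this places_v_power[of "i + 1"]] show ?thesis by (simp add: v0_quotient_def)
qed

lemma elt_2V_carrier: "elt_2V x \<in> carrier group_2V"
  using elt_A_B_sends elt_C_sends elt_Pi_sends elt_Pibar_sends by (cases x) blast+

text \<open>
  By definition \<open>A_i\<close> and \<open>B_i\<close> are given at level \<open>i + 1\<close>. A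
  vertical cut of the last entries of both lists gives the next level, since it commutes with the
  cut at the earlier position \<open>i\<close>.
\<close>

lemma elt_A_B_level:
  assumes "i < k"
  shows "sends_list (elt_2V (if c then gB i else gA i)) (comb (Suc k)) (cut c i (comb k))"
  using assms
proof (induction k)
  case (Suc k)
  show ?case
  proof (cases "i = k")
    case True
    then show ?thesis using elt_A_B_sends[of i] by simp
  next
    case False
    then have ik: "i < k" using Suc.prems by simp
    have "sends_list (elt_2V (if c then gB i else gA i)) (cut False (Suc k) (comb (Suc k)))
        (cut False (Suc k) (cut c i (comb k)))"
      using Suc.IH[OF ik] by (rule sends_list_cut)
    then show ?thesis using cut_cut[OF ik, of False c "comb k"] by simp
  qed
qed simp

lemma elt_Pi_level:
  assumes "Suc i < k"
  shows "sends_list (elt_2V (gPi i)) (comb k) (exchange i (comb k))"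
  using assms
proof (induction k)
  case (Suc k)
  show ?case
  proof (cases "Suc i = k")
    case True
    then show ?thesis using elt_Pi_sends[of i] by simp
  next
    case False
    then have ik: "Suc i < k" using Suc.prems by simp
    have "sends_list (elt_2V (gPi i)) (cut False k (comb k)) (cut False k (exchange i (comb k)))"
      using Suc.IH[OF ik] by (rule sends_list_cut)
    then show ?thesis using cut_exchange_greater[OF ik, of False "comb k"] by simp
  qed
qed simp

section \<open>The relations\<close>

primrec positive_product :: "('g, 'b) monoid_scheme \<Rightarrow> ('a \<Rightarrow> 'g) \<Rightarrow> 'a list \<Rightarrow> 'g" where
  "positive_product G e [] = \<one>\<^bsub>G\<^esub>"
| "positive_product G e (x # xs) = e x \<otimes>\<^bsub>G\<^esub> positive_product G e xs"

datatype list_op = Cut bool nat | Swap nat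

primrec apply_op :: "list_op \<Rightarrow> cell list \<Rightarrow> cell list" where
  "apply_op (Cut c m) = cut c m"
| "apply_op (Swap m) = exchange m"

lemma sends_list_fold:
  "sends_list f V U \<Longrightarrow> sends_list f (fold apply_op ops V) (fold apply_op ops U)"
proof (induction ops arbitrary: V U)
  case (Cons x ops)
  then have "sends_list f (apply_op x V) (apply_op x U)"
    by (cases x) (simp_all add: sends_list_cut sends_list_exchange)
  then show ?case using Cons.IH by simp
qed simp

text \<open>
  \<open>realizes w k ops k'\<close>: reading the word \<open>w\<close> as a sequence of cuts and
  exchanges, applied to a list with \<open>k + 1\<close> entries, gives \<open>ops\<close> and a
  list with \<open>k' + 1\<close> entries. A vertical cut of the last position may be inserted
  anywhere, because it corresponds to the factor 1.
\<close>

inductive realizes :: "gen_2V list \<Rightarrow> nat \<Rightarrow> list_op list \<Rightarrow> nat \<Rightarrow> bool" where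
  realizes_Nil: "realizes [] k [] k"
| realizes_last: "realizes w (Suc k) ops k' \<Longrightarrow> realizes w k (Cut False k # ops) k'"
| realizes_A: "i < k \<Longrightarrow> realizes w (Suc k) ops k' \<Longrightarrow> realizes (gA i # w) k (Cut False i # ops) k'"
| realizes_B: "i < k \<Longrightarrow> realizes w (Suc k) ops k' \<Longrightarrow> realizes (gB i # w) k (Cut True i # ops) k'"
| realizes_C: "realizes w (Suc k) ops k' \<Longrightarrow> realizes (gC k # w) k (Cut True k # ops) k'"
| realizes_Pi: "Suc i < k \<Longrightarrow> realizes w k ops k' \<Longrightarrow> realizes (gPi i # w) k (Swap i # ops) k'"
| realizes_Pibar: "realizes w (Suc i) ops k' \<Longrightarrow> realizes (gPibar i # w) (Suc i) (Swap i # ops) k'"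

lemma positive_product_2V: "positive_product group_2V elt_2V w \<in> carrier group_2V"
proof -
  interpret group group_2V by (rule group_group_2V)
  show ?thesis by (induction w) (use elt_2V_carrier in \<open>auto simp del: group_2V_mult group_2V_one\<close>)
qed

text \<open>
  Each factor carries a standard list to a standard list changed by one operation, and later
  operations commute with maps, so the product carries the final standard list to the initial one
  changed by all operations.
\<close>

lemma realizes_sends:
  "realizes w k ops k' \<Longrightarrow>
   sends_list (positive_product group_2V elt_2V w) (comb k') (fold apply_op ops (comb k))"
proof (induction rule: realizes.induct)
  case (realizes_Nil k)
  then show ?case by (simp add: sends_list_one)
next
  case (realizes_last w k ops k')
  then show ?case by simp
next
  have step: "sends_list (positive_product group_2V elt_2V (x # w)) (comb k'') (fold apply_op (a # ops) (comb k))"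
    if "sends_list (elt_2V x) (comb k') (apply_op a (comb k))"
      "sends_list (positive_product group_2V elt_2V w) (comb k'') (fold apply_op ops (comb k'))"
    for x a k k' k'' w ops
  proof -
    have "sends_list (elt_2V x) (fold apply_op ops (comb k')) (fold apply_op (a # ops) (comb k))"
      using sends_list_fold[OF that(1), of ops] by simp
    with that(2) show ?thesis
      using elt_2V_carrier[of x] positive_product_2V[of w]
      by (auto simp: carrier_group_2V intro!: sends_list_mult)
  qed
  { case (realizes_A i k w ops k')
    then show ?case using elt_A_B_level[of i k False] by (intro step[of _ "Suc k"]) simp_all }
  { case (realizes_B i k w ops k')
    then show ?case using elt_A_B_level[of i k True] by (intro step[of _ "Suc k"]) simp_all }
  { case (realizes_C w k ops k')
    then show ?case using elt_C_sends[of k] by (intro step[of _ "Suc k"]) simp_all }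
  { case (realizes_Pi i k w ops k')
    then show ?case using elt_Pi_level[of i k] by (intro step[of _ k]) simp_all }
  { case (realizes_Pibar w i ops k')
    then show ?case using elt_Pibar_sends[of i] by (intro step[of _ "Suc i"]) simp_all }
qed

lemma realizes_eq:
  assumes "realizes u k ops k'" "realizes w k ops' k'"
    and "fold apply_op ops (comb k) = fold apply_op ops' (comb k)"
  shows "positive_product group_2V elt_2V u = positive_product group_2V elt_2V w"
  using realizes_sends[OF assms(1)] realizes_sends[OF assms(2)] assms(3)
  by (intro sends_list_determines[OF positive_product_2V positive_product_2V partition_list_comb[of k']])
    simp_all

lemmas realizes_intros = realizes_Nil realizes_A realizes_B realizes_C realizes_Pi realizes_Pibar

lemma realizes_AB:
  "X \<in> {gA, gB} \<Longrightarrow> i < k \<Longrightarrow> realizes w (Suc k) ops k' \<Longrightarrow>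
   realizes (X i # w) k (Cut (X \<noteq> gA) i # ops) k'"
  by (metis realizes_A realizes_B insert_iff singletonD)

text \<open>
  For each relation choose a level at which both sides are sequences of operations; they agree by an
  identity for \<^const>\<open>cut\<close> and \<^const>\<open>exchange\<close>.
\<close>

lemma relations_2V_hold:
  assumes "(u, w) \<in> relations_2V"
  shows "positive_product group_2V elt_2V u = positive_product group_2V elt_2V w"
  using assms
proof cases
  case (r1 X Y m q)
  have "realizes u (Suc q) [Cut (X \<noteq> gA) q, Cut (Y \<noteq> gA) m] (Suc (Suc (Suc q)))"
    unfolding r1(1) using r1 by (intro realizes_AB realizes_Nil) auto
  moreover have "realizes w (Suc q) [Cut (Y \<noteq> gA) m, Cut (X \<noteq> gA) (Suc q)] (Suc (Suc (Suc q)))"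
    unfolding r1(2) Suc_eq_plus1[symmetric] using r1 by (intro realizes_AB realizes_Nil) auto
  ultimately show ?thesis by (rule realizes_eq) (simp add: cut_cut[OF r1(5)])
next
  case (r2 X m q)
  have "realizes u (Suc (Suc q)) [Swap q, Cut (X \<noteq> gA) m] (Suc (Suc (Suc q)))"
    unfolding r2(1) using r2 by (intro realizes_AB realizes_Nil realizes_Pi) auto
  moreover have "realizes w (Suc (Suc q)) [Cut (X \<noteq> gA) m, Swap (Suc q)] (Suc (Suc (Suc q)))"
    unfolding r2(2) Suc_eq_plus1[symmetric] using r2 by (intro realizes_AB realizes_Nil realizes_Pi) auto
  ultimately show ?thesis by (rule realizes_eq) (simp add: cut_exchange_less[OF r2(4)] del: comb.simps)
next
  case (r3 X q)
  have "realizes u (Suc (Suc q)) [Swap q, Cut (X \<noteq> gA) q] (Suc (Suc (Suc q)))"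
    unfolding r3(1) using r3 by (intro realizes_AB realizes_Nil realizes_Pi) auto
  moreover have "realizes w (Suc (Suc q)) [Cut (X \<noteq> gA) (Suc q), Swap q, Swap (Suc q)] (Suc (Suc (Suc q)))"
    unfolding r3(2) Suc_eq_plus1[symmetric] using r3 by (intro realizes_AB realizes_Nil realizes_Pi) auto
  ultimately show ?thesis by (rule realizes_eq) (simp add: cut_exchange_same del: comb.simps)
next
  case (r4 X m q)
  have "realizes u (Suc m) [Swap q, Cut (X \<noteq> gA) m] (Suc (Suc m))"
    unfolding r4(1) using r4 by (intro realizes_AB realizes_Nil realizes_Pi) auto
  moreover have "realizes w (Suc m) [Cut (X \<noteq> gA) m, Swap q] (Suc (Suc m))"
    unfolding r4(2) using r4 by (intro realizes_AB realizes_Nil realizes_Pi) auto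
  ultimately show ?thesis using r4 by - (rule realizes_eq, assumption+, simp add: cut_exchange_greater del: comb.simps)
next
  case (r5 X m q)
  have "realizes u (Suc q) [Swap q, Cut (X \<noteq> gA) m] (Suc (Suc q))"
    unfolding r5(1) using r5 by (intro realizes_AB realizes_Nil realizes_Pibar) auto
  moreover have "realizes w (Suc q) [Cut (X \<noteq> gA) m, Swap (Suc q)] (Suc (Suc q))"
    unfolding r5(2) Suc_eq_plus1[symmetric] using r5 by (intro realizes_AB realizes_Nil realizes_Pibar) auto
  ultimately show ?thesis by (rule realizes_eq) (simp add: cut_exchange_less[OF r5(4)] del: comb.simps)
next
  case (r6 m)
  have "realizes u (Suc m) [Swap m, Cut False m] (Suc (Suc m))"
    unfolding r6(1) by (intro realizes_intros) auto
  moreover have "realizes w (Suc m) [Cut False (Suc m), Swap m, Swap (Suc m)] (Suc (Suc m))"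
    unfolding r6(2) Suc_eq_plus1[symmetric] by (rule realizes_last) (intro realizes_intros, auto)
  ultimately show ?thesis by (rule realizes_eq) (simp add: cut_exchange_same del: comb.simps)
next
  case (r7 m)
  have "realizes u (Suc m) [Swap m, Cut True m] (Suc (Suc m))"
    unfolding r7(1) by (intro realizes_intros) auto
  moreover have "realizes w (Suc m) [Cut True (Suc m), Swap m, Swap (Suc m)] (Suc (Suc m))"
    unfolding r7(2) Suc_eq_plus1[symmetric] by (intro realizes_intros) auto
  ultimately show ?thesis by (rule realizes_eq) (simp add: cut_exchange_same del: comb.simps)
next
  case (r8 X m q)
  have "realizes u q [Cut True q, Cut (X \<noteq> gA) m] (Suc (Suc q))"
    unfolding r8(1) using r8 by (intro realizes_AB realizes_Nil realizes_C) auto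
  moreover have "realizes w q [Cut (X \<noteq> gA) m, Cut True (Suc q)] (Suc (Suc q))"
    unfolding r8(2) Suc_eq_plus1[symmetric] using r8 by (intro realizes_AB realizes_Nil realizes_C) auto
  ultimately show ?thesis by (rule realizes_eq) (simp add: cut_cut[OF r8(4)])
next
  case (r9 m)
  have "realizes u m [Cut True m, Cut False (Suc m), Cut False m] (Suc (Suc (Suc m)))"
    unfolding r9(1) by (rule realizes_C, rule realizes_last) (intro realizes_intros, auto)
  moreover have "realizes w m [Cut False m, Cut True m, Cut True (Suc (Suc m)), Swap (Suc m)] (Suc (Suc (Suc m)))"
    unfolding r9(2) Suc_eq_plus1[symmetric] add_2_eq_Suc'
    by (rule realizes_last) (intro realizes_intros, auto)
  ultimately show ?thesis
    by (rule realizes_eq) (simp add: cut_cut[of m "Suc m" True True] cut_cross del: comb.simps)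
next
  case (r10 m q)
  have "realizes u m [Swap q, Cut True m] (Suc m)"
    unfolding r10(1) using r10 by (intro realizes_intros) auto
  moreover have "realizes w m [Cut True m, Swap q] (Suc m)"
    unfolding r10(2) using r10 by (intro realizes_intros) auto
  ultimately show ?thesis using r10 by - (rule realizes_eq, assumption+, simp add: cut_exchange_greater del: comb.simps)
next
  case (r11 m)
  have "realizes u (Suc m) [Cut False m, Cut True (Suc m), Cut True m] (Suc (Suc (Suc (Suc m))))"
    unfolding r11(1) Suc_eq_plus1[symmetric] by (intro realizes_intros) auto
  moreover have "realizes w (Suc m) [Cut True m, Cut False (Suc m), Cut False m, Swap (Suc m)] (Suc (Suc (Suc (Suc m))))"
    unfolding r11(2) Suc_eq_plus1[symmetric] by (intro realizes_intros) auto
  ultimately show ?thesis by (rule realizes_eq) (simp add: cut_cross del: comb.simps)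
next
  case (r12 m q)
  have "realizes u (Suc (Suc (q + m))) [Swap q, Swap m] (Suc (Suc (q + m)))"
    unfolding r12(1) by (intro realizes_intros) auto
  moreover have "realizes w (Suc (Suc (q + m))) [Swap m, Swap q] (Suc (Suc (q + m)))"
    unfolding r12(2) by (intro realizes_intros) auto
  moreover have "exchange m (exchange q L) = exchange q (exchange m L)" for L :: "cell list"
  proof -
    have "Suc m < q \<or> Suc q < m" using r12(3) by linarith
    then show ?thesis using exchange_swap_far[of m q L] exchange_swap_far[of q m L] by auto
  qed
  ultimately show ?thesis by (intro realizes_eq[of u _ _ _ w]) (assumption | simp del: comb.simps)+
next
  case (r13 m)
  have "realizes u (Suc (Suc (Suc m))) [Swap m, Swap (Suc m), Swap m] (Suc (Suc (Suc m)))"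
    unfolding r13(1) Suc_eq_plus1[symmetric] by (intro realizes_intros) auto
  moreover have "realizes w (Suc (Suc (Suc m))) [Swap (Suc m), Swap m, Swap (Suc m)] (Suc (Suc (Suc m)))"
    unfolding r13(2) Suc_eq_plus1[symmetric] by (intro realizes_intros) auto
  ultimately show ?thesis by (rule realizes_eq) (simp add: exchange_braid del: comb.simps)
next
  case (r14 q m)
  have "realizes u (Suc q) [Swap q, Swap m] (Suc q)"
    unfolding r14(1) using r14 by (intro realizes_intros) auto
  moreover have "realizes w (Suc q) [Swap m, Swap q] (Suc q)"
    unfolding r14(2) using r14 by (intro realizes_intros) auto
  ultimately show ?thesis
    using exchange_swap_far[of m q "comb (Suc q)"] r14(3)
    by - (rule realizes_eq, assumption+, simp del: comb.simps)
next
  case (r15 m)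
  have "realizes u (Suc (Suc m)) [Swap m, Swap (Suc m), Swap m] (Suc (Suc m))"
    unfolding r15(1) Suc_eq_plus1[symmetric] by (intro realizes_intros) auto
  moreover have "realizes w (Suc (Suc m)) [Swap (Suc m), Swap m, Swap (Suc m)] (Suc (Suc m))"
    unfolding r15(2) Suc_eq_plus1[symmetric] by (intro realizes_intros) auto
  ultimately show ?thesis by (rule realizes_eq) (simp add: exchange_braid del: comb.simps)
next
  case (r16 m)
  have "realizes u (Suc (Suc m)) [Swap m, Swap m] (Suc (Suc m))"
    unfolding r16(1) by (intro realizes_intros) auto
  moreover have "realizes w (Suc (Suc m)) [] (Suc (Suc m))"
    unfolding r16(2) by (rule realizes_Nil)
  ultimately show ?thesis by (rule realizes_eq) (simp del: comb.simps)
next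
  case (r17 m)
  have "realizes u (Suc m) [Swap m, Swap m] (Suc m)"
    unfolding r17(1) by (intro realizes_intros)
  moreover have "realizes w (Suc m) [] (Suc m)"
    unfolding r17(2) by (rule realizes_Nil)
  ultimately show ?thesis by (rule realizes_eq) (simp del: comb.simps)
qed

text \<open>
  Conversely, in any group the given relations imply the level relations; \<open>X\<close> and
  \<open>S\<close> encode the exceptional role of the last position.
\<close>

locale relations_group = group G for G (structure) +
  fixes e :: "gen_2V \<Rightarrow> 'a"
  assumes e_closed [simp]: "e x \<in> carrier G"
    and e_relations: "(u, w) \<in> relations_2V \<Longrightarrow> positive_product G e u = positive_product G e w"
begin

definition X :: "nat \<Rightarrow> bool \<Rightarrow> nat \<Rightarrow> 'a" where
  "X n c m = (if Suc m < n then e (if c then gB m else gA m) else if c then e (gC m) else \<one>)"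

definition S :: "nat \<Rightarrow> nat \<Rightarrow> 'a" where
  "S n m = (if Suc (Suc m) < n then e (gPi m) else e (gPibar m))"

sublocale level_group G X S
proof
  let ?AB = "\<lambda>c. if c then gB else gA"
  have AB: "?AB c \<in> {gA, gB}" for c by simp
  have if_AB: "e (if c then gB m else gA m) = e (?AB c m)" for c m by simp
  show "X n c m \<in> carrier G" "S n j \<in> carrier G" for n c m j by (simp_all add: X_def S_def)
  show "S n j \<otimes> S n j = \<one>" for j n
    using e_relations[OF r16[of j]] e_relations[OF r17[of j]] by (simp add: S_def)
  show "S n i \<otimes> S n j = S n j \<otimes> S n i" if "Suc j < i" "Suc i < n" for i j n
  proof (cases "Suc (Suc i) < n")
    case True
    have "([gPi i, gPi j], [gPi j, gPi i]) \<in> relations_2V" using that by (intro r12) auto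
    from e_relations[OF this] show ?thesis using True that by (simp add: S_def)
  next
    case False
    have "([gPibar i, gPi j], [gPi j, gPibar i]) \<in> relations_2V" using that by (intro r14) auto
    from e_relations[OF this] show ?thesis using False that by (simp add: S_def)
  qed
  show "S n j \<otimes> S n (Suc j) \<otimes> S n j = S n (Suc j) \<otimes> S n j \<otimes> S n (Suc j)"
    if "Suc (Suc j) < n" for j n
    using e_relations[OF r13[of j]] e_relations[OF r15[of j]] that by (simp add: S_def m_assoc)
  show "X n c q \<otimes> X (Suc n) d m = X n d m \<otimes> X (Suc n) c (Suc q)" if "m < q" "q < n" for m q n c d
  proof (cases "Suc q < n")
    case True
    show ?thesis using e_relations[OF r1[OF AB[of c] AB[of d] that(1)]] that True by (simp add: X_def if_AB)
  next
    case False
    show ?thesis using e_relations[OF r8[OF AB[of d] that(1)]] that False by (simp add: X_def if_AB)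
  qed
  show "S n q \<otimes> X n c m = X n c m \<otimes> S (Suc n) (Suc q)" if "m < q" "Suc q < n" for m q n c
    using e_relations[OF r2[OF AB[of c] that(1)]] e_relations[OF r5[OF AB[of c] that(1)]] that
    by (simp add: X_def S_def if_AB)
  show "S n q \<otimes> X n c m = X n c m \<otimes> S (Suc n) q" if "Suc q < m" "m < n" for q m n c
  proof -
    have qm: "q + 1 < m" using that by simp
    show ?thesis
      using e_relations[OF r4[OF AB[of c] qm]] e_relations[OF r10[OF qm]] that
      by (auto simp add: X_def S_def if_AB)
  qed
  show "S n q \<otimes> X n c q = X n c (Suc q) \<otimes> S (Suc n) q \<otimes> S (Suc n) (Suc q)" if "Suc q < n" for q n c
    using e_relations[OF r3[OF AB[of c], of q]] e_relations[OF r6[of q]] e_relations[OF r7[of q]] that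
    by (cases c) (auto simp: X_def S_def if_AB m_assoc)
  show "X n False m \<otimes> X (Suc n) True (Suc m) \<otimes> X (Suc (Suc n)) True m =
      X n True m \<otimes> X (Suc n) False (Suc m) \<otimes> X (Suc (Suc n)) False m \<otimes> S (Suc (Suc (Suc n))) (Suc m)"
    if "m < n" for m n
  proof (cases "Suc m < n")
    case True
    show ?thesis using e_relations[OF r11[of m]] True by (simp add: X_def S_def m_assoc)
  next
    case False
    \<comment> \<open>at the last position the cross relation reads \<open>C_{m+1} B_m = C_m A_m \<pi>_{m+1}\<close>\<close>
    have "e (gC (Suc m)) \<otimes> e (gB m) = e (gB m) \<otimes> e (gC (Suc (Suc m)))"
      using e_relations[OF r8[of gB m "Suc m"]] by simp
    moreover have "e (gC m) \<otimes> e (gA m) = e (gB m) \<otimes> (e (gC (Suc (Suc m))) \<otimes> e (gPi (Suc m)))"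
      using e_relations[OF r9[of m]] by simp
    moreover have "e (gPi (Suc m)) \<otimes> e (gPi (Suc m)) = \<one>"
      using e_relations[OF r16[of "Suc m"]] by simp
    ultimately show ?thesis using False that by (simp add: X_def S_def m_assoc)
  qed
qed

lemma X_values:
  "Suc m < n \<Longrightarrow> X n False m = e (gA m)" "Suc m < n \<Longrightarrow> X n True m = e (gB m)"
  "X (Suc m) False m = \<one>" "X (Suc m) True m = e (gC m)"
  by (simp_all add: X_def)

lemma S_values:
  "Suc (Suc m) < n \<Longrightarrow> S n m = e (gPi m)" "S (Suc (Suc m)) m = e (gPibar m)"
  by (simp_all add: S_def)

lemma value_list_comb: "value_list (comb k) = \<one>"
proof (induction k)
  case 0
  then show ?case by (simp add: value_list_whole)
next
  case (Suc k)
  then show ?case by (simp add: value_list_cut partition_list_comb X_values)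
qed

text \<open>
  The candidate for the inverse of the evaluation map, as a relation. It is compatible with products
  and inverses, and the identity represents only 1; this is all that the determination of the kernel
  requires.
\<close>

definition represents :: "(real \<times> real \<Rightarrow> real \<times> real) \<Rightarrow> 'a \<Rightarrow> bool" where
  "represents f q \<longleftrightarrow> (\<exists>U V. partition_list U \<and> partition_list V \<and> sends_list f V U \<and>
     q = value_list U \<otimes> inv value_list V)"

lemma representsI:
  "partition_list U \<Longrightarrow> partition_list V \<Longrightarrow> sends_list f V U \<Longrightarrow>
   q = value_list U \<otimes> inv value_list V \<Longrightarrow> represents f q"
  unfolding represents_def by blast

lemma represents_gen: "represents (elt_2V x) (e x)"
proof (cases x)
  case (gA i)
  show ?thesis unfolding gA
    by (rule representsI[OF partition_list_cut[OF partition_list_comb, of i "Suc i" False] partition_list_comb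
        elt_A_B_sends(1)[THEN conjunct2]])
      (simp_all add: value_list_cut[OF partition_list_comb] value_list_comb X_values del: comb.simps elt_2V.simps)
next
  case (gB i)
  show ?thesis unfolding gB
    by (rule representsI[OF partition_list_cut[OF partition_list_comb, of i "Suc i" True] partition_list_comb
        elt_A_B_sends(2)[THEN conjunct2]])
      (simp_all add: value_list_cut[OF partition_list_comb] value_list_comb X_values del: comb.simps elt_2V.simps)
next
  case (gC i)
  show ?thesis unfolding gC
    by (rule representsI[OF partition_list_cut[OF partition_list_comb, of i i True] partition_list_comb
        elt_C_sends[THEN conjunct2]])
      (simp_all add: value_list_cut[OF partition_list_comb] value_list_comb X_values del: comb.simps elt_2V.simps)
next
  case (gPi i)
  show ?thesis unfolding gPi
    by (rule representsI[OF _ partition_list_comb elt_Pi_sends[THEN conjunct2]])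
      (simp_all add: partition_list_comb value_list_exchange[OF partition_list_comb] value_list_comb S_values
        del: comb.simps elt_2V.simps)
next
  case (gPibar i)
  show ?thesis unfolding gPibar
    by (rule representsI[OF _ partition_list_comb elt_Pibar_sends[THEN conjunct2]])
      (simp_all add: partition_list_comb value_list_exchange[OF partition_list_comb] value_list_comb S_values
        del: comb.simps elt_2V.simps)
qed

text \<open>
  Both lists are changed by the same operations, so the quotient of the values gains a cancelling
  factor.
\<close>

lemma refine_representation:
  assumes V: "partition_list V" and U: "partition_list U" and f: "sends_list f V U"
    and Z: "partition_list Z" and ref: "refines (set Z) (set V)"
  obtains W where "partition_list W" "sends_list f Z W"
    "value_list W \<otimes> inv value_list Z = value_list U \<otimes> inv value_list V"
proof -
  let ?P = "\<lambda>Z. \<exists>W. partition_list W \<and> sends_list f Z W \<and>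
    value_list W \<otimes> inv value_list Z = value_list U \<otimes> inv value_list V"
  have cancel: "(a \<otimes> x) \<otimes> inv (b \<otimes> x) = a \<otimes> inv b"
    if "a \<in> carrier G" "b \<in> carrier G" "x \<in> carrier G" for a b x
    using that by (simp add: inv_mult_group m_assoc cancel_left)
  have "?P Z"
  proof (rule refinement_induct[OF V Z ref])
    show "?P V" using U f by blast
  next
    fix L c m assume L: "partition_list L" "?P L" "m < length L"
    then obtain W where W: "partition_list W" "sends_list f L W"
      "value_list W \<otimes> inv value_list L = value_list U \<otimes> inv value_list V" by blast
    have l: "length W = length L" using sends_list_length[OF W(2)] by simp
    have "value_list (cut c m W) \<otimes> inv value_list (cut c m L) = value_list W \<otimes> inv value_list L"
      using L(1,3) W(1) l by (simp add: value_list_cut cancel)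
    then show "?P (cut c m L)"
      using partition_list_cut[OF W(1), of m c] sends_list_cut[OF W(2), of c m] L(3) l W(3) by metis
  next
    fix L m assume L: "partition_list L" "?P L" "Suc m < length L"
    then obtain W where W: "partition_list W" "sends_list f L W"
      "value_list W \<otimes> inv value_list L = value_list U \<otimes> inv value_list V" by blast
    have l: "length W = length L" using sends_list_length[OF W(2)] by simp
    have "value_list (exchange m W) \<otimes> inv value_list (exchange m L) = value_list W \<otimes> inv value_list L"
      using L(1,3) W(1) l by (simp add: value_list_exchange cancel)
    then show "?P (exchange m L)"
      using partition_list_exchange[of m W] sends_list_exchange[OF W(2), of m] W(1,3) by metis
  qed
  then show thesis using that by blast
qed

lemma represents_inv:
  assumes "hat_map f" "represents f q" shows "represents (inv\<^bsub>hat_2V\<^esub> f) (inv q)"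
proof -
  from assms(2) obtain U V where UV: "partition_list U" "partition_list V" "sends_list f V U"
    "q = value_list U \<otimes> inv value_list V" unfolding represents_def by blast
  have "inv q = value_list V \<otimes> inv value_list U"
    using UV by (simp add: inv_mult_group)
  with UV show ?thesis by (intro representsI[OF UV(2,1)] sends_list_inv[OF assms(1)])
qed

text \<open>
  Refine the source of \<open>f\<close> and the target of \<open>g\<close> to a common list
  \<open>Z\<close>, the latter by refining the inverse of \<open>g\<close>; then the values of
  \<open>Z\<close> cancel.
\<close>

lemma represents_mult:
  assumes f: "hat_map f" and g: "hat_map g" and fq: "represents f q" and gr: "represents g r"
  shows "represents (f \<otimes>\<^bsub>hat_2V\<^esub> g) (q \<otimes> r)"
proof -
  from fq obtain U V where UV: "partition_list U" "partition_list V" "sends_list f V U"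
    "q = value_list U \<otimes> inv value_list V" unfolding represents_def by blast
  from gr obtain U' V' where UV': "partition_list U'" "partition_list V'" "sends_list g V' U'"
    "r = value_list U' \<otimes> inv value_list V'" unfolding represents_def by blast
  obtain d where d: "\<And>xs ys. (xs, ys) \<in> set V \<union> set U' \<Longrightarrow> length xs \<le> d \<and> length ys \<le> d"
    using bounded_lengths[of "set V \<union> set U'"] by blast
  obtain Z where Z: "partition_list Z" "set Z = grid d"
    using partition_cells_grid by (rule partition_list_of_set)
  have ref: "refines (set Z) (set V)" "refines (set Z) (set U')"
    unfolding Z(2) using UV UV' d by (auto simp: partition_list_def intro!: grid_refines)
  obtain W where W: "partition_list W" "sends_list f Z W"
    "value_list W \<otimes> inv value_list Z = value_list U \<otimes> inv value_list V"
    using UV(2,1,3) Z(1) ref(1) by (rule refine_representation)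
  have gi: "hat_map (inv\<^bsub>hat_2V\<^esub> g)" using g by (simp add: hat_2V_inv hat_map_inverse)
  obtain W' where W': "partition_list W'" "sends_list (inv\<^bsub>hat_2V\<^esub> g) Z W'"
    "value_list W' \<otimes> inv value_list Z = value_list V' \<otimes> inv value_list U'"
    using UV'(1,2) sends_list_inv[OF g UV'(3)] Z(1) ref(2) by (rule refine_representation)
  have "inv\<^bsub>hat_2V\<^esub> (inv\<^bsub>hat_2V\<^esub> g) = g"
    using g group.inv_inv[OF group_hat_2V, of g] by (simp add: carrier_hat_2V)
  then have "sends_list g W' Z" using sends_list_inv[OF gi W'(2)] by simp
  then have s: "sends_list (f \<otimes>\<^bsub>hat_2V\<^esub> g) W' W" using W(2) by (rule sends_list_mult[OF f g])
  have r: "r = inv (value_list W' \<otimes> inv value_list Z)"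
    unfolding W'(3) UV'(4) using UV' by (simp add: inv_mult_group)
  have "r = value_list Z \<otimes> inv value_list W'"
    unfolding r using W'(1) Z(1) by (simp add: inv_mult_group)
  then have "q \<otimes> r = (value_list W \<otimes> inv value_list Z) \<otimes> (value_list Z \<otimes> inv value_list W')"
    unfolding UV(4) W(3)[symmetric] by (rule arg_cong)
  also have "\<dots> = value_list W \<otimes> inv value_list W'"
    using W(1) W'(1) Z(1) by (simp add: m_assoc cancel_left)
  finally show ?thesis by (rule representsI[OF W(1) W'(1) s])
qed

lemma represents_one: "represents \<one>\<^bsub>hat_2V\<^esub> q \<longleftrightarrow> q = \<one>"
proof
  assume "represents \<one>\<^bsub>hat_2V\<^esub> q"
  then obtain U V where UV: "partition_list U" "partition_list V" "sends_list \<one>\<^bsub>hat_2V\<^esub> V U"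
    "q = value_list U \<otimes> inv value_list V" unfolding represents_def by blast
  have "V = U" using sends_list_one UV(3) by (rule sends_list_unique)
  with UV show "q = \<one>" by simp
next
  assume "q = \<one>"
  then show "represents \<one>\<^bsub>hat_2V\<^esub> q"
    using representsI[OF partition_list_comb[of 0] partition_list_comb[of 0] sends_list_one, of q]
    by (simp add: partition_list_comb[of 0, simplified])
qed

end

section \<open>Words and normal closures\<close>

primrec word_value :: "('g, 'b) monoid_scheme \<Rightarrow> ('a \<Rightarrow> 'g) \<Rightarrow> 'a gword \<Rightarrow> 'g" where
  "word_value G e [] = \<one>\<^bsub>G\<^esub>"
| "word_value G e (l # w) =
     (if snd l then e (fst l) else inv\<^bsub>G\<^esub> e (fst l)) \<otimes>\<^bsub>G\<^esub> word_value G e w"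

text \<open>
  Evaluation of a class of words on a representative; \<open>lift_word_class\<close> shows that the
  choice does not matter.
\<close>

definition lift_word :: "('g, 'b) monoid_scheme \<Rightarrow> ('a \<Rightarrow> 'g) \<Rightarrow> 'a gword set \<Rightarrow> 'g" where
  "lift_word G e U = word_value G e (SOME w. w \<in> U)"

lemma carrier_free_group: "carrier free_group = range word_class"
  and one_free_group: "\<one>\<^bsub>free_group\<^esub> = word_class []"
  by (simp_all add: free_group_def)

context group
begin

lemma word_value_closed: "(\<And>x. e x \<in> carrier G) \<Longrightarrow> word_value G e w \<in> carrier G"
  by (induction w) auto

lemma word_value_append:
  assumes "\<And>x. e x \<in> carrier G"
  shows "word_value G e (u @ w) = word_value G e u \<otimes> word_value G e w"
  by (induction u) (simp_all add: assms m_assoc word_value_closed)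

lemma word_value_cancels:
  assumes e: "\<And>x. e x \<in> carrier G" and c: "cancels u w"
  shows "word_value G e u = word_value G e w"
  using c
proof cases
  case (1 u x b w)
  have "word_value G e [(x, b), (x, \<not> b)] = \<one>"
    using e by (cases b) simp_all
  then show ?thesis
    unfolding 1 by (simp only: word_value_append[OF e] word_value_closed[OF e] l_one)
qed

lemma lift_word_class:
  assumes e: "\<And>x. e x \<in> carrier G"
  shows "lift_word G e (word_class w) = word_value G e w"
proof -
  have "w \<in> word_class w" by (simp add: word_class_def)
  then have "(SOME v. v \<in> word_class w) \<in> word_class w" by (rule someI)
  then have "equivclp cancels w (SOME v. v \<in> word_class w)" by (simp add: word_class_def)
  then have "word_value G e w = word_value G e (SOME v. v \<in> word_class w)"
  proof (induction rule: equivclp_induct)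
    case (step y z)
    then show ?case using word_value_cancels[OF e, of y z] word_value_cancels[OF e, of z y] by auto
  qed simp
  then show ?thesis by (simp add: lift_word_def)
qed

lemma lift_word_hom:
  assumes e: "\<And>x. e x \<in> carrier G"
  shows "lift_word G e \<in> hom free_group G"
proof (rule homI)
  fix U assume "U \<in> carrier (free_group :: 'c gword set monoid)"
  then show "lift_word G e U \<in> carrier G"
    by (auto simp: carrier_free_group lift_word_class[OF e] word_value_closed[OF e])
next
  fix U W assume "U \<in> carrier (free_group :: 'c gword set monoid)" "W \<in> carrier (free_group :: 'c gword set monoid)"
  then obtain u w where "U = word_class u" "W = word_class w" by (auto simp: carrier_free_group)
  then show "lift_word G e (U \<otimes>\<^bsub>free_group\<^esub> W) = lift_word G e U \<otimes> lift_word G e W"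
    by (simp add: free_group_mult lift_word_class[OF e] word_value_append[OF e])
qed

lemma word_value_positive:
  "word_value G e (map (\<lambda>x. (x, True)) xs) = positive_product G e xs"
  by (induction xs) simp_all

lemma normal_closure_normal:
  assumes "R \<subseteq> carrier G" shows "normal_closure G R \<lhd> G"
proof -
  let ?F = "{N. N \<lhd> G \<and> R \<subseteq> N}"
  have "carrier G \<lhd> G"
    unfolding normal_inv_iff using subgroup_self by simp
  then have ne: "?F \<noteq> {}" using assms by blast
  have "subgroup (\<Inter>?F) G"
    using ne by (intro subgroups_Inter) (auto simp: normal_imp_subgroup)
  then show ?thesis
    unfolding normal_closure_def normal_inv_iff by (auto simp: normal_inv_iff)
qed

lemma normal_closure_contains: "R \<subseteq> normal_closure G R"
  unfolding normal_closure_def by blast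

lemma normal_closure_least: "N \<lhd> G \<Longrightarrow> R \<subseteq> N \<Longrightarrow> normal_closure G R \<subseteq> N"
  unfolding normal_closure_def by blast

end

section \<open>The presentation\<close>

abbreviation evaluate :: "gen_2V gword set \<Rightarrow> real \<times> real \<Rightarrow> real \<times> real" where
  "evaluate \<equiv> lift_word group_2V elt_2V"

abbreviation relator_closure :: "gen_2V gword set set" where
  "relator_closure \<equiv> normal_closure free_group (relators relations_2V)"

abbreviation presented_group :: "gen_2V gword set set monoid" where
  "presented_group \<equiv> free_group Mod relator_closure"

abbreviation coset :: "gen_2V gword set \<Rightarrow> gen_2V gword set set" where
  "coset U \<equiv> relator_closure #>\<^bsub>free_group\<^esub> U"

lemma relators_carrier: "relators E \<subseteq> carrier free_group"
proof -
  interpret group free_group by (rule group_free_group)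
  have "positive_word u \<in> carrier free_group" for u :: "'a list"
    by (simp add: positive_word_def carrier_free_group)
  then show ?thesis by (auto simp: relators_def)
qed

lemma relator_closure_normal: "relator_closure \<lhd> free_group"
  using group.normal_closure_normal[OF group_free_group relators_carrier] .

lemma coset_hom: "coset \<in> hom free_group presented_group"
  using normal.r_coset_hom_Mod[OF relator_closure_normal] .

lemma group_presented_group: "group presented_group"
  using normal.factorgroup_is_group[OF relator_closure_normal] .

lemma evaluate_hom: "evaluate \<in> hom free_group group_2V"
  using group.lift_word_hom[OF group_group_2V elt_2V_carrier] .

lemma evaluate_word: "evaluate (word_class w) = word_value group_2V elt_2V w"
  using group.lift_word_class[OF group_group_2V elt_2V_carrier] .

lemma coset_positive:
  "coset (positive_word xs) = positive_product presented_group (\<lambda>x. coset (free_gen x)) xs"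
proof (induction xs)
  case Nil
  interpret Q: group presented_group by (rule group_presented_group)
  have "coset \<one>\<^bsub>free_group\<^esub> = \<one>\<^bsub>presented_group\<^esub>"
    using hom_one[OF coset_hom group_free_group group_presented_group] .
  then show ?case by (simp add: positive_word_def one_free_group)
next
  case (Cons x xs)
  have "positive_word (x # xs) = free_gen x \<otimes>\<^bsub>free_group\<^esub> positive_word xs"
    by (simp add: positive_word_def free_gen_def free_group_mult)
  then show ?case
    using hom_mult[OF coset_hom, of "free_gen x" "positive_word xs"] Cons
    by (simp add: carrier_free_group free_gen_def positive_word_def)
qed

interpretation presented: relations_group presented_group "\<lambda>x. coset (free_gen x)"
proof (rule relations_group.intro[OF group_presented_group], unfold_locales)
  show "coset (free_gen x) \<in> carrier presented_group" for x
    using hom_in_carrier[OF coset_hom] by (simp add: carrier_free_group free_gen_def)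
  fix u w assume uw: "(u, w) \<in> relations_2V"
  interpret F: group "free_group :: gen_2V gword set monoid" by (rule group_free_group)
  interpret N: normal relator_closure free_group by (rule relator_closure_normal)
  have car: "positive_word u \<in> carrier free_group" "positive_word w \<in> carrier free_group"
    by (simp_all add: positive_word_def carrier_free_group)
  have "positive_word u \<otimes>\<^bsub>free_group\<^esub> inv\<^bsub>free_group\<^esub> positive_word w \<in> relators relations_2V"
    using uw by (auto simp: relators_def)
  then have "positive_word u \<otimes>\<^bsub>free_group\<^esub> inv\<^bsub>free_group\<^esub> positive_word w \<in> relator_closure"
    using F.normal_closure_contains by blast
  moreover have "positive_word u = positive_word u \<otimes>\<^bsub>free_group\<^esub> inv\<^bsub>free_group\<^esub> positive_word w \<otimes>\<^bsub>free_group\<^esub> positive_word w"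
    using car by (simp add: F.m_assoc)
  ultimately have "positive_word u \<in> coset (positive_word w)" unfolding r_coset_def by blast
  then have "coset (positive_word u) = coset (positive_word w)"
    using F.repr_independence[OF _ car(2) N.is_subgroup] by simp
  then show "positive_product presented_group (\<lambda>x. coset (free_gen x)) u =
      positive_product presented_group (\<lambda>x. coset (free_gen x)) w"
    by (simp add: coset_positive)
qed

lemma word_represents:
  "presented.represents (word_value group_2V elt_2V w) (coset (word_class w))"
proof (induction w)
  case Nil
  have "coset \<one>\<^bsub>free_group\<^esub> = \<one>\<^bsub>presented_group\<^esub>"
    using hom_one[OF coset_hom group_free_group group_presented_group] .
  then show ?case using presented.represents_one by (simp add: one_free_group)
next
  case (Cons l w)
  obtain x b where l: "l = (x, b)" by (cases l)
  have hx: "hat_map (elt_2V x)" using elt_2V_carrier[of x] by (simp add: carrier_group_2V)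
  have hw: "hat_map (word_value group_2V elt_2V w)"
    using group.word_value_closed[OF group_group_2V, of elt_2V w] elt_2V_carrier
    by (simp add: carrier_group_2V)
  have gx: "presented.represents (elt_2V x) (coset (free_gen x))" by (rule presented.represents_gen)
  have split: "coset (word_class ((x, b) # w)) = coset (word_class [(x, b)]) \<otimes>\<^bsub>presented_group\<^esub> coset (word_class w)"
    using hom_mult[OF coset_hom, of "word_class [(x, b)]" "word_class w"]
    by (simp add: carrier_free_group free_group_mult)
  show ?case
  proof (cases b)
    case True
    then show ?thesis
      using presented.represents_mult[OF hx hw gx Cons] split unfolding l by (simp add: free_gen_def)
  next
    case False
    have "inv\<^bsub>free_group\<^esub> (free_gen x) = word_class [(x, False)]"
    proof (rule group.inv_equality[OF group_free_group])
      show "word_class [(x, False)] \<otimes>\<^bsub>free_group\<^esub> free_gen x = \<one>\<^bsub>free_group\<^esub>"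
        using word_class_inverse[of "[(x, True)]"] by (simp add: free_gen_def free_group_mult one_free_group)
    qed (simp_all add: carrier_free_group free_gen_def)
    then have ci: "coset (word_class [(x, False)]) = inv\<^bsub>presented_group\<^esub> coset (free_gen x)"
      using group_hom.hom_inv[of free_group presented_group coset "free_gen x"] coset_hom
        group_free_group group_presented_group
      by (simp add: group_hom_def group_hom_axioms_def carrier_free_group free_gen_def)
    have hi: "hat_map (inv\<^bsub>hat_2V\<^esub> elt_2V x)" using hx by (simp add: hat_2V_inv hat_map_inverse)
    show ?thesis
      using presented.represents_mult[OF hi hw presented.represents_inv[OF hx gx] Cons] split False ci
        group_2V_inv[OF elt_2V_carrier, of x]
      unfolding l by simp
  qed
qed

text \<open>
  The relators evaluate to 1 since the relations hold in 2V. Conversely, a word with value 1 has a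
  class represented by the identity, which forces this class to be 1.
\<close>

lemma kernel_evaluate: "kernel free_group group_2V evaluate = relator_closure"
proof
  interpret F: group "free_group :: gen_2V gword set monoid" by (rule group_free_group)
  interpret V: group group_2V by (rule group_group_2V)
  interpret ev: group_hom free_group group_2V evaluate
    by unfold_locales (rule evaluate_hom)
  interpret N: normal relator_closure free_group by (rule relator_closure_normal)
  have pos: "evaluate (positive_word u) = positive_product group_2V elt_2V u" for u
    unfolding positive_word_def evaluate_word by (rule V.word_value_positive)
  have "relators relations_2V \<subseteq> kernel free_group group_2V evaluate"
  proof
    fix r assume "r \<in> relators relations_2V"
    then obtain u w where uw: "(u, w) \<in> relations_2V"
      "r = positive_word u \<otimes>\<^bsub>free_group\<^esub> inv\<^bsub>free_group\<^esub> positive_word w"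
      unfolding relators_def by blast
    have car: "positive_word v \<in> carrier free_group" for v :: "gen_2V list"
      by (simp add: positive_word_def carrier_free_group)
    have eq: "evaluate (positive_word u) = evaluate (positive_word w)"
      unfolding pos using uw(1) by (rule relations_2V_hold)
    have "evaluate r = evaluate (positive_word u) \<otimes>\<^bsub>group_2V\<^esub> inv\<^bsub>group_2V\<^esub> evaluate (positive_word w)"
      unfolding uw(2) using car by (simp del: group_2V_mult)
    also have "\<dots> = \<one>\<^bsub>group_2V\<^esub>"
      unfolding eq using ev.hom_closed[OF car] by (rule V.r_inv)
    finally show "r \<in> kernel free_group group_2V evaluate"
      unfolding kernel_def uw(2) using car by simp
  qed
  then show "relator_closure \<subseteq> kernel free_group group_2V evaluate"
    by (rule F.normal_closure_least[OF ev.normal_kernel])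
  show "kernel free_group group_2V evaluate \<subseteq> relator_closure"
  proof
    fix U assume "U \<in> kernel free_group group_2V evaluate"
    then obtain w where w: "U = word_class w" "evaluate U = \<one>\<^bsub>group_2V\<^esub>"
      by (auto simp: kernel_def carrier_free_group)
    then have "presented.represents \<one>\<^bsub>hat_2V\<^esub> (coset U)"
      using word_represents[of w] by (simp add: evaluate_word)
    then have "coset U = \<one>\<^bsub>presented_group\<^esub>" unfolding presented.represents_one .
    then have "coset U = relator_closure" by (simp add: FactGroup_def)
    moreover have "U \<in> coset U"
      using w(1) N.is_subgroup by (intro F.rcos_self) (simp_all add: carrier_free_group)
    ultimately show "U \<in> relator_closure" by simp
  qed
qed

text \<open>
  A fine grid of the divided square is mapped to cells. The images lie in the same square because
  all other points are fixed, and they form a partition because \<open>f\<close> is a bijection.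
\<close>

lemma group_2V_sends_grid:
  assumes f: "f \<in> carrier group_2V"
  obtains Z U where "partition_list Z" "partition_list U" "sends_list f Z U"
proof -
  have hf: "hat_map f" and ff: "fixes_others f" using f by (simp_all add: carrier_group_2V)
  have B: "f \<in> Bij cantor_squares" using hf by (rule hat_map_Bij)
  obtain d where d: "\<forall>i xs ys. d \<le> length xs \<longrightarrow> d \<le> length ys \<longrightarrow> (\<exists>b. sends f (i, xs, ys) b)"
    using hf by (rule hat_map_depth)
  obtain Z where Z: "partition_list Z" "set Z = grid d"
    using partition_cells_grid by (rule partition_list_of_set)
  have inj: "y = z" if "f y = f z" "y \<in> cantor_squares" "z \<in> cantor_squares" for y z
    using Bij_image(1)[OF B] that by (rule inj_onD)
  have fixed: "f z = z" if "z \<in> cell_points (Suc j, r)" for z j r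
  proof -
    have "inside r whole" by (cases r) simp
    then have "z \<in> cell_points (Suc j, whole)" using that inside_cell_points by blast
    then obtain p where "z = place (Suc j, whole) p" "p \<in> cantor_square"
      unfolding cell_points_def by (rule imageE)
    then show ?thesis using ff sendsD unfolding fixes_others_def by metis
  qed
  have "\<exists>s. sends f (0, Z ! m) (0, s)" if m: "m < length Z" for m
  proof -
    have "Z ! m \<in> grid d" using nth_mem[OF m] Z(2) by simp
    moreover obtain xs ys where xy: "Z ! m = (xs, ys)" by (cases "Z ! m")
    ultimately have "d \<le> length xs" "d \<le> length ys" by (simp_all add: grid_def)
    then obtain b where b: "sends f (0, Z ! m) b" using d unfolding xy by blast
    obtain i s where bi: "b = (i, s)" by (cases b)
    have o: "(0, 0) \<in> cantor_square" using cantor_set_ends by simp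
    let ?z = "place (0, Z ! m) (0, 0)"
    have z: "?z \<in> cantor_squares" "f ?z = place (i, s) (0, 0)"
      using place_in[OF o] sendsD[OF b o] bi by simp_all
    have "i = 0"
    proof (cases i)
      case (Suc j)
      \<comment> \<open>a point sent to another square has a fixed image, so by injectivity it lies in that square itself\<close>
      have c: "place (i, s) (0, 0) \<in> cell_points (Suc j, s)"
        unfolding cell_points_def Suc using o by (rule imageI)
      have "f (f ?z) = f ?z" unfolding z(2) using c by (rule fixed)
      then have "f ?z = ?z"
        using inj[of "f ?z" ?z] z place_in[OF o, of "(i, s)"] by simp
      then have "place (0, Z ! m) (0, 0) \<in> cell_points (Suc j, s)" using c z(2) by simp
      moreover have "place (0, Z ! m) (0, 0) \<in> cell_points (0, Z ! m)"
        unfolding cell_points_def using o by (rule imageI)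
      ultimately have "0 = Suc j" using cell_points_disjoint by blast
      then show ?thesis by simp
    qed
    then show ?thesis using b bi by blast
  qed
  then obtain h where h: "\<And>m. m < length Z \<Longrightarrow> sends f (0, Z ! m) (0, h m)" by metis
  define U where "U = map h [0..<length Z]"
  have Ul: "length U = length Z" and Um: "\<And>m. m < length Z \<Longrightarrow> U ! m = h m"
    by (simp_all add: U_def)
  have s: "sends_list f Z U" by (simp add: sends_list_def list_all2_conv_all_nth Ul Um h)
  have idx: "m = n" if mn: "m < length Z" "n < length Z" "meets (U ! m) (U ! n)" for m n
  proof -
    obtain z where z: "z \<in> cell_points (0, U ! m)" "z \<in> cell_points (0, U ! n)"
      using meets_cell_points[OF mn(3)] by blast
    have "z \<in> f ` cell_points (0, Z ! m)" using z(1) sends_image[OF h[OF mn(1)]] Um mn by simp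
    then obtain x where x: "z = f x" "x \<in> cell_points (0, Z ! m)" by (rule imageE)
    have "z \<in> f ` cell_points (0, Z ! n)" using z(2) sends_image[OF h[OF mn(2)]] Um mn by simp
    then obtain y where y: "z = f y" "y \<in> cell_points (0, Z ! n)" by (rule imageE)
    have "x = y" using inj x y cell_points_subset by blast
    then have "meets (Z ! m) (Z ! n)" using x(2) y(2) cell_points_disjoint by blast
    then have "Z ! m = Z ! n"
      using Z(1) mn partition_cells_meets[of "set Z"] by (simp add: partition_list_def)
    then show ?thesis using Z(1) mn by (simp add: partition_list_def nth_eq_iff_index_eq)
  qed
  have "distinct U"
    unfolding distinct_conv_nth using idx Ul meets_refl by metis
  moreover have "partition_cells (set U)"
    unfolding partition_cells_def
  proof (intro conjI ballI allI impI)
    fix r s assume "r \<in> set U" "s \<in> set U" "meets r s"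
    then obtain m n where "m < length Z" "n < length Z" "r = U ! m" "s = U ! n"
      unfolding in_set_conv_nth Ul by blast
    then show "r = s" using idx \<open>meets r s\<close> by blast
  next
    fix t
    have o: "(0, 0) \<in> cantor_square" using cantor_set_ends by simp
    let ?z = "place (0, t) (0, 0)"
    have zc: "?z \<in> cell_points (0, t)" unfolding cell_points_def using o by (rule imageI)
    then have "?z \<in> f ` cantor_squares" unfolding Bij_image(2)[OF B] using cell_points_subset by blast
    then obtain y where y: "?z = f y" "y \<in> cantor_squares" by (rule imageE)
    then obtain i where i: "y \<in> cell_points (i, whole)" by (auto simp: cantor_squares_eq)
    have "i = 0"
    proof (cases i)
      case (Suc j)
      then have "?z \<in> cell_points (Suc j, whole)" using fixed[of y j whole] y(1) i by simp
      then show ?thesis using cell_points_disjoint[OF zc] by blast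
    qed
    then obtain r where r: "r \<in> set Z" "y \<in> cell_points (0, r)"
      using partition_cells_points[of "set Z" y 0] Z(1) i by (auto simp: partition_list_def)
    then obtain m where m: "m < length Z" "Z ! m = r" by (metis in_set_conv_nth)
    have "f y \<in> f ` cell_points (0, r)" using r(2) by (rule imageI)
    then have "?z \<in> cell_points (0, U ! m)" using sends_image[OF h[OF m(1)]] m Um y(1) by simp
    then have "meets (U ! m) t" using zc cell_points_disjoint by blast
    then show "\<exists>r\<in>set U. meets r t" using m(1) Ul by (metis nth_mem)
  qed simp
  ultimately show thesis using that[OF Z(1) _ s] by (simp add: partition_list_def)
qed

text \<open>
  Every list is obtained from the one-element list by cuts and exchanges, each of which multiplies
  the map by a generator or by 1.
\<close>

lemma evaluate_reaches:
  assumes "partition_list L"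
  shows "\<exists>g \<in> evaluate ` carrier free_group. sends_list g (comb (length L - 1)) L"
proof -
  interpret F: group "free_group :: gen_2V gword set monoid" by (rule group_free_group)
  interpret V: group group_2V by (rule group_group_2V)
  interpret ev: group_hom free_group group_2V evaluate
    by unfold_locales (rule evaluate_hom)
  interpret H: subgroup "evaluate ` carrier free_group" group_2V by (rule ev.img_is_subgroup)
  have elt: "elt_2V x \<in> evaluate ` carrier free_group" for x
  proof -
    have "evaluate (word_class [(x, True)]) = elt_2V x"
      unfolding evaluate_word using elt_2V_carrier[of x] V.r_one[OF elt_2V_carrier, of x] by simp
    then show ?thesis unfolding carrier_free_group by (metis rangeI imageI)
  qed
  have mult: "\<exists>h \<in> evaluate ` carrier free_group. sends_list h W T"
    if "g \<in> evaluate ` carrier free_group" "k \<in> evaluate ` carrier free_group"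
      "sends_list k W V" "sends_list g V T" for g k W V T
  proof -
    have "g \<in> carrier group_2V" "k \<in> carrier group_2V" using that H.subset by blast+
    then have "sends_list (g \<otimes>\<^bsub>group_2V\<^esub> k) W T"
      using sends_list_mult that by (simp add: carrier_group_2V)
    then show ?thesis using H.m_closed[OF that(1,2)] by blast
  qed
  have one: "\<one>\<^bsub>hat_2V\<^esub> \<in> evaluate ` carrier free_group" using H.one_closed by simp
  have pos: "length L = Suc (length L - 1)" if "m < length L" for L :: "cell list" and m using that by simp
  have "length [whole] = Suc 0" by simp
  show ?thesis
  proof (rule refinement_induct[of "[whole]" L "\<lambda>L. \<exists>g \<in> evaluate ` carrier free_group. sends_list g (comb (length L - 1)) L"])
    show "partition_list [whole]" by (simp add: partition_list_def partition_cells_whole)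
    show "partition_list L" by (rule assms)
    show "refines (set L) (set [whole])" by (auto simp: refines_def)
    show "\<exists>g \<in> evaluate ` carrier free_group. sends_list g (comb (length [whole] - 1)) [whole]"
      using one sends_list_one[of "[whole]"] by (intro bexI[of _ "\<one>\<^bsub>hat_2V\<^esub>"]) simp_all
  next
    fix L c m assume L: "\<exists>g \<in> evaluate ` carrier free_group. sends_list g (comb (length L - 1)) L" "m < length L"
    from L(1) obtain g where g: "g \<in> evaluate ` carrier free_group" "sends_list g (comb (length L - 1)) L" by blast
    define k where "k = length L - 1"
    have l: "length L = Suc k" using L(2) by (simp add: k_def)
    have gc: "sends_list g (cut c m (comb k)) (cut c m L)" using g(2) unfolding k_def by (rule sends_list_cut)
    have "\<exists>x \<in> evaluate ` carrier free_group. sends_list x (comb (Suc k)) (cut c m (comb k))"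
    proof (cases "m < k")
      case True
      then show ?thesis using elt_A_B_level elt by blast
    next
      case False
      then have m: "m = k" using L(2) l by simp
      show ?thesis
      proof (cases c)
        case True
        then have c: "c = True" by simp
        show ?thesis unfolding c m using elt_C_sends[of k] elt by blast
      next
        case False
        then show ?thesis using one sends_list_one[of "comb (Suc k)"] m
          by (intro bexI[of _ "\<one>\<^bsub>hat_2V\<^esub>"]) simp_all
      qed
    qed
    then obtain x where "x \<in> evaluate ` carrier free_group" "sends_list x (comb (Suc k)) (cut c m (comb k))" by blast
    from mult[OF g(1) this gc]
    show "\<exists>g \<in> evaluate ` carrier free_group. sends_list g (comb (length (cut c m L) - 1)) (cut c m L)"
      using L(2) l by simp
  next
    fix L m assume L: "\<exists>g \<in> evaluate ` carrier free_group. sends_list g (comb (length L - 1)) L" "Suc m < length L"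
    from L(1) obtain g where g: "g \<in> evaluate ` carrier free_group" "sends_list g (comb (length L - 1)) L" by blast
    define k where "k = length L - 1"
    have l: "length L = Suc k" using L(2) by (simp add: k_def)
    have gc: "sends_list g (exchange m (comb k)) (exchange m L)" using g(2) unfolding k_def by (rule sends_list_exchange)
    have "\<exists>x \<in> evaluate ` carrier free_group. sends_list x (comb k) (exchange m (comb k))"
    proof (cases "Suc m < k")
      case True
      then show ?thesis using elt_Pi_level elt by blast
    next
      case False
      then have "k = Suc m" using L(2) l by simp
      then show ?thesis using elt_Pibar_sends[of m] elt by blast
    qed
    then obtain x where "x \<in> evaluate ` carrier free_group" "sends_list x (comb k) (exchange m (comb k))" by blast
    from mult[OF g(1) this gc]
    show "\<exists>g \<in> evaluate ` carrier free_group. sends_list g (comb (length (exchange m L) - 1)) (exchange m L)"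
      using l by simp
  qed
qed

lemma evaluate_surjective: "evaluate ` carrier free_group = carrier group_2V"
proof
  interpret F: group "free_group :: gen_2V gword set monoid" by (rule group_free_group)
  interpret V: group group_2V by (rule group_group_2V)
  interpret ev: group_hom free_group group_2V evaluate
    by unfold_locales (rule evaluate_hom)
  interpret H: subgroup "evaluate ` carrier free_group" group_2V by (rule ev.img_is_subgroup)
  show "evaluate ` carrier free_group \<subseteq> carrier group_2V" by (rule H.subset)
  show "carrier group_2V \<subseteq> evaluate ` carrier free_group"
  proof
    fix f assume f: "f \<in> carrier group_2V"
    then obtain Z U where ZU: "partition_list Z" "partition_list U" "sends_list f Z U"
      by (rule group_2V_sends_grid)
    obtain g where g: "g \<in> evaluate ` carrier free_group" "sends_list g (comb (length Z - 1)) Z"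
      using evaluate_reaches[OF ZU(1)] by blast
    obtain h where h: "h \<in> evaluate ` carrier free_group" "sends_list h (comb (length U - 1)) U"
      using evaluate_reaches[OF ZU(2)] by blast
    have c: "g \<in> carrier group_2V" "h \<in> carrier group_2V" using g h H.subset by blast+
    have "sends_list (f \<otimes>\<^bsub>group_2V\<^esub> g) (comb (length U - 1)) U"
      using sends_list_mult[OF _ _ g(2) ZU(3)] f c sends_list_length[OF ZU(3)]
      by (simp add: carrier_group_2V)
    then have "f \<otimes>\<^bsub>group_2V\<^esub> g = h"
      using h(2) V.m_closed[OF f c(1)] c(2) partition_list_comb by (blast intro: sends_list_determines)
    then have "f = h \<otimes>\<^bsub>group_2V\<^esub> inv\<^bsub>group_2V\<^esub> g"
      using f c V.inv_solve_right by metis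
    then show "f \<in> evaluate ` carrier free_group"
      using H.m_closed[OF h(1) H.m_inv_closed[OF g(1)]] by simp
  qed
qed

theorem theorem3:
  shows "is_presented_by group_2V elt_2V (relators relations_2V)"
proof -
  interpret ev: group_hom free_group group_2V evaluate
    using evaluate_hom group_free_group group_group_2V
    by (simp add: group_hom_def group_hom_axioms_def)
  have iso: "(\<lambda>X. the_elem (evaluate ` X)) \<in> iso presented_group group_2V"
    using ev.FactGroup_iso_set[OF evaluate_surjective] unfolding kernel_evaluate .
  have "the_elem (evaluate ` coset (free_gen x)) = elt_2V x" for x
  proof -
    have x: "free_gen x \<in> carrier free_group" by (simp add: carrier_free_group free_gen_def)
    have "evaluate y = evaluate (free_gen x)" if "y \<in> coset (free_gen x)" for y
    proof -
      from that obtain n where n: "n \<in> relator_closure" "y = n \<otimes>\<^bsub>free_group\<^esub> free_gen x"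
        unfolding r_coset_def by blast
      then have "n \<in> carrier free_group" "evaluate n = \<one>\<^bsub>group_2V\<^esub>"
        unfolding kernel_evaluate[symmetric] kernel_def by auto
      then show ?thesis unfolding n(2) using x ev.hom_closed[OF x] ev.H.l_one by (simp del: group_2V_mult group_2V_one)
    qed
    moreover have "free_gen x \<in> coset (free_gen x)"
      using x normal_imp_subgroup[OF relator_closure_normal] by (rule group.rcos_self[OF group_free_group])
    ultimately have "evaluate ` coset (free_gen x) = {evaluate (free_gen x)}" by blast
    moreover have "evaluate (free_gen x) = elt_2V x"
      unfolding free_gen_def evaluate_word using ev.H.r_one[OF elt_2V_carrier, of x] by simp
    ultimately show ?thesis by simp
  qed
  then have gens: "\<forall>x. (\<lambda>X. the_elem (evaluate ` X)) (coset (free_gen x)) = elt_2V x" by blast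
  show ?thesis
    unfolding is_presented_by_def
  proof (intro conjI allI)
    show "\<exists>\<phi>\<in>iso presented_group group_2V. \<forall>x. \<phi> (coset (free_gen x)) = elt_2V x"
      using gens iso by (rule bexI)
  qed (rule group_group_2V elt_2V_carrier relators_carrier)+
qed

end
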